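(* Let $\mathfrak g=(\mathbb R Z\oplus\mathfrak u)\ltimes\mathfrak n$ be a real Lie algebra, where $\mathfrak u$ is a compact semisimple Lie algebra, $\mathfrak n$ is a nilpotent Lie algebra, and $Z$ is a non-zero element commuting with $\mathfrak u$. Let $\mathfrak n=\mathfrak n_1\oplus\dots\oplus\mathfrak n_k$ be the decomposition of $\mathfrak n$ as a $\mathfrak u$-module into irreducible components. If some $\mathfrak n_j$ admits a decomposition $\mathfrak n_j=V_1\oplus V_2$ and an inner product satisfying properties (1)–(6) listed in the context (for the representation of $\mathfrak u$ on $\mathfrak n_j$), and $\operatorname{ad}Z|_{\mathfrak n}$ acts as a positive multiple of the identity on every $\mathfrak n_i$, then $\mathfrak g$ admits an inner product with negative Ricci curvature.
   Context: All Lie algebras are finite-dimensional. A real Lie algebra is compact semisimple if its Killing form is negative definite. In $\mathfrak g=(\mathbb R Z\oplus\mathfrak u)\ltimes\mathfrak n$, $\mathfrak n$ is an ideal on which $\mathbb R Z\oplus\mathfrak u$ acts by derivations. $\mathfrak u_{\mathbb C}=\mathfrak u\otimes_{\mathbb R}\mathbb C$, with Killing form $B$, Cartan subalgebra $\mathfrak h$, root system $\Delta$, a fixed positive system $\Delta^+$, and one-dimensional root spaces $(\mathfrak u_{\mathbb C})_\alpha$. For $\alpha\in\Delta$, $H_\alpha\in\mathfrak h$ is defined by $B(H,H_\alpha)=\alpha(H)$ for all $H\in\mathfrak h$; $\mathfrak h_{\mathbb R}$ is the real span of all $H_\alpha$. Root vectors $X_\alpha\in(\mathfrak u_{\mathbb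 C})_\alpha$ are chosen with $[X_\alpha,X_{-\alpha}]=H_\alpha$; $[X_\alpha,X_\beta]=N_{\alpha,\beta}X_{\alpha+\beta}$ if $\alpha+\beta\in\Delta$, with $N_{\alpha,\beta}=-N_{-\alpha,-\beta}\in\mathbb R$; $[X_\alpha,X_\beta]=0$ if $\alpha+\beta\neq0$ and $\alpha+\beta\notin\Delta$; and such that $\mathfrak u=\sum_{\alpha\in\Delta}\mathbb R\,iH_\alpha+\sum_{\alpha\in\Delta}\mathbb R X^\alpha+\sum_{\alpha\in\Delta}\mathbb R Y^\alpha$, where $X^\alpha=X_\alpha-X_{-\alpha}$ and $Y^\alpha=i(X_\alpha+X_{-\alpha})$ (this is always possible up to isomorphism, by uniqueness of compact real forms). Properties, for a real representation $(\pi,V)$ of $\mathfrak u$ with a decomposition $V=V_1\oplus V_2$ and an inner product $\langle\cdot,\cdot\rangle$ on $V$: (1) $V_1$ and $V_2$ are $i\mathfrak h_{\mathbb R}$-invariant. (2) $\pi(X^\alpha)(V_1)\subset V_2$ and $\pi(Y^\alpha)(V_1)\subset V_2$ for every $\alpha\in\Delta^+$. (3) $V_1$ is orthogonal to $V_2$. (4) $\pi(H)$ is a skew-symmetric operator of $V$ for every $H\in i\mathfrak h_{\mathbb R}$. (5) $\pi(X^\alpha)|_{V_1}$ and $\pi(Y^\alpha)|_{V_1}$ are non-zero for every $\alpha\in\Delta^+$. (6) $\operatorname{tr}\big((\pi(Y)|_{V_1})^t\,\pi(X)|_{V_1}\big)=0$ whenever $X\neq Y$ are elements of $\{X^\alpha,Y^\alpha:\alpha\in\Delta^+\}$.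 An inner product on a real Lie algebra $\mathfrak g$ has negative Ricci curvature if the corresponding left-invariant Riemannian metric on the simply connected Lie group with Lie algebra $\mathfrak g$ has negative definite Ricci operator. *)

theory Defs
  imports "HOL-Analysis.Analysis" "HOL-Library.Function_Algebras"
begin

section \<open>Lie algebras over a field\<close>

text \<open>The scalar multiplication is a parameter, so that the same notions serve for a real Lie
  algebra and for its complexification. A Lie algebra lives on a subspace \<open>L\<close> of the ambient
  space; the bracket is only constrained on \<open>L\<close>.\<close>

locale lie_algebra = vector_space scale
  for scale :: "'k::field \<Rightarrow> 'v::ab_group_add \<Rightarrow> 'v" +
  fixes L :: "'v set" and br :: "'v \<Rightarrow> 'v \<Rightarrow> 'v"
  assumes subspace_L: "subspace L"
    and br_closed: "x \<in> L \<Longrightarrow> y \<in> L \<Longrightarrow> br x y \<in> L"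
    and br_add_left: "x \<in> L \<Longrightarrow> y \<in> L \<Longrightarrow> z \<in> L \<Longrightarrow> br (x + y) z = br x z + br y z"
    and br_add_right: "x \<in> L \<Longrightarrow> y \<in> L \<Longrightarrow> z \<in> L \<Longrightarrow> br x (y + z) = br x y + br x z"
    and br_scale_left: "x \<in> L \<Longrightarrow> y \<in> L \<Longrightarrow> br (scale c x) y = scale c (br x y)"
    and br_scale_right: "x \<in> L \<Longrightarrow> y \<in> L \<Longrightarrow> br x (scale c y) = scale c (br x y)"
    and br_self: "x \<in> L \<Longrightarrow> br x x = 0"
    and jacobi: "x \<in> L \<Longrightarrow> y \<in> L \<Longrightarrow> z \<in> L \<Longrightarrow>
      br x (br y z) + br y (br z x) + br z (br x y) = 0"

definition lie_subalgebra ::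
  "('k::field \<Rightarrow> 'v::ab_group_add \<Rightarrow> 'v) \<Rightarrow> 'v set \<Rightarrow> ('v \<Rightarrow> 'v \<Rightarrow> 'v) \<Rightarrow> 'v set \<Rightarrow> bool" where
  "lie_subalgebra s L br K \<longleftrightarrow>
     module.subspace s K \<and> K \<subseteq> L \<and> (\<forall>x\<in>K. \<forall>y\<in>K. br x y \<in> K)"

definition lie_ideal ::
  "('k::field \<Rightarrow> 'v::ab_group_add \<Rightarrow> 'v) \<Rightarrow> 'v set \<Rightarrow> ('v \<Rightarrow> 'v \<Rightarrow> 'v) \<Rightarrow> 'v set \<Rightarrow> bool" where
  "lie_ideal s L br K \<longleftrightarrow>
     module.subspace s K \<and> K \<subseteq> L \<and> (\<forall>x\<in>L. \<forall>y\<in>K. br x y \<in> K)"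

primrec lower_central ::
  "('k::field \<Rightarrow> 'v::ab_group_add \<Rightarrow> 'v) \<Rightarrow> 'v set \<Rightarrow> ('v \<Rightarrow> 'v \<Rightarrow> 'v) \<Rightarrow> nat \<Rightarrow> 'v set" where
  "lower_central s L br 0 = L"
| "lower_central s L br (Suc m) =
     module.span s {br x y | x y. x \<in> L \<and> y \<in> lower_central s L br m}"

definition nilpotent_lie ::
  "('k::field \<Rightarrow> 'v::ab_group_add \<Rightarrow> 'v) \<Rightarrow> 'v set \<Rightarrow> ('v \<Rightarrow> 'v \<Rightarrow> 'v) \<Rightarrow> bool" where
  "nilpotent_lie s L br \<longleftrightarrow> (\<exists>m. lower_central s L br m = {0})"

text \<open>Trace of an endomorphism of the finite-dimensional subspace \<open>W\<close>: the sum of the diagonal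
  entries of its matrix in some basis of \<open>W\<close>.\<close>

definition trace_on ::
  "('k::field \<Rightarrow> 'v::ab_group_add \<Rightarrow> 'v) \<Rightarrow> 'v set \<Rightarrow> ('v \<Rightarrow> 'v) \<Rightarrow> 'k" where
  "trace_on s W f =
     (let B = (SOME B. \<not> module.dependent s B \<and> module.span s B = W)
      in \<Sum>b\<in>B. module.representation s B (f b) b)"

definition killing_form ::
  "('k::field \<Rightarrow> 'v::ab_group_add \<Rightarrow> 'v) \<Rightarrow> 'v set \<Rightarrow> ('v \<Rightarrow> 'v \<Rightarrow> 'v) \<Rightarrow> 'v \<Rightarrow> 'v \<Rightarrow> 'k" where
  "killing_form s L br x y = trace_on s L (\<lambda>z. br x (br y z))"

definition compact_semisimple ::
  "'a::real_vector set \<Rightarrow> ('a \<Rightarrow> 'a \<Rightarrow> 'a) \<Rightarrow> bool" where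
  "compact_semisimple u br \<longleftrightarrow>
     lie_algebra scaleR u br \<and> (\<forall>x\<in>u. x \<noteq> 0 \<longrightarrow> killing_form scaleR u br x x < 0)"

section \<open>Roots\<close>

definition cartan_subalgebra ::
  "('k::field \<Rightarrow> 'v::ab_group_add \<Rightarrow> 'v) \<Rightarrow> 'v set \<Rightarrow> ('v \<Rightarrow> 'v \<Rightarrow> 'v) \<Rightarrow> 'v set \<Rightarrow> bool" where
  "cartan_subalgebra s L br h \<longleftrightarrow>
     lie_subalgebra s L br h \<and> nilpotent_lie s h br \<and> {x \<in> L. \<forall>y\<in>h. br x y \<in> h} = h"

definition root_space ::
  "('k::field \<Rightarrow> 'v::ab_group_add \<Rightarrow> 'v) \<Rightarrow> 'v set \<Rightarrow> ('v \<Rightarrow> 'v \<Rightarrow> 'v) \<Rightarrow> 'v set \<Rightarrow>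
    ('v \<Rightarrow> 'k) \<Rightarrow> 'v set" where
  "root_space s L br h \<alpha> = {x \<in> L. \<forall>H\<in>h. br H x = s (\<alpha> H) x}"

text \<open>A linear functional on \<open>h\<close> is represented by the function that extends it by \<open>0\<close> outside
  \<open>h\<close>; thus functionals are equal iff they agree on \<open>h\<close>, and \<open>\<alpha> + \<beta>\<close>, \<open>- \<alpha>\<close>, \<open>0\<close> are
  pointwise.\<close>

definition dual_on ::
  "('k::field \<Rightarrow> 'v::ab_group_add \<Rightarrow> 'v) \<Rightarrow> 'v set \<Rightarrow> ('v \<Rightarrow> 'k) set" where
  "dual_on s h = {\<alpha>. (\<forall>x\<in>h. \<forall>y\<in>h. \<alpha> (x + y) = \<alpha> x + \<alpha> y) \<and>
     (\<forall>c. \<forall>x\<in>h. \<alpha> (s c x) = c * \<alpha> x) \<and> (\<forall>x. x \<notin> h \<longrightarrow> \<alpha> x = 0)}"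

definition roots ::
  "('k::field \<Rightarrow> 'v::ab_group_add \<Rightarrow> 'v) \<Rightarrow> 'v set \<Rightarrow> ('v \<Rightarrow> 'v \<Rightarrow> 'v) \<Rightarrow> 'v set \<Rightarrow>
    ('v \<Rightarrow> 'k) set" where
  "roots s L br h = {\<alpha> \<in> dual_on s h. \<alpha> \<noteq> 0 \<and> root_space s L br h \<alpha> \<noteq> {0}}"

definition positive_system :: "('v \<Rightarrow> 'k::field) set \<Rightarrow> ('v \<Rightarrow> 'k) set \<Rightarrow> bool" where
  "positive_system \<Delta> \<Delta>p \<longleftrightarrow>
     \<Delta>p \<union> uminus ` \<Delta>p = \<Delta> \<and> \<Delta>p \<inter> uminus ` \<Delta>p = {} \<and>
     (\<forall>\<alpha>\<in>\<Delta>p. \<forall>\<beta>\<in>\<Delta>p. \<alpha> + \<beta> \<in> \<Delta> \<longrightarrow> \<alpha> + \<beta> \<in> \<Delta>p)"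

section \<open>Complexification\<close>

text \<open>The complexification of a real subspace \<open>u\<close> is \<open>u \<times> u\<close>, the pair \<open>(x, y)\<close> standing for
  \<open>x \<otimes> 1 + y \<otimes> \<i>\<close>; \<open>u\<close> itself sits inside as \<open>u \<times> {0}\<close>. The real structure of \<open>u \<times> u\<close>
  underlying \<open>cscale\<close> is the componentwise one of the product type.\<close>

definition cscale :: "complex \<Rightarrow> 'a::real_vector \<times> 'a \<Rightarrow> 'a \<times> 'a" where
  "cscale c p =
     (Re c *\<^sub>R fst p - Im c *\<^sub>R snd p, Re c *\<^sub>R snd p + Im c *\<^sub>R fst p)"

definition cbracket ::
  "('a::real_vector \<Rightarrow> 'a \<Rightarrow> 'a) \<Rightarrow> 'a \<times> 'a \<Rightarrow> 'a \<times> 'a \<Rightarrow> 'a \<times> 'a" where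
  "cbracket br p q =
     (br (fst p) (fst q) - br (snd p) (snd q), br (fst p) (snd q) + br (snd p) (fst q))"

lemma vector_space_cscale: "vector_space cscale"
  by unfold_locales (auto simp: cscale_def algebra_simps)

lemma cscale_of_real: "cscale (complex_of_real r) p = r *\<^sub>R p"
  by (simp add: cscale_def scaleR_prod_def)

section \<open>Root vectors adapted to a compact real form\<close>

text \<open>\<open>X\<^sup>\<alpha> = X\<^sub>\<alpha> - X\<^sub>-\<^sub>\<alpha>\<close> and \<open>Y\<^sup>\<alpha> = \<i> (X\<^sub>\<alpha> + X\<^sub>-\<^sub>\<alpha>\<close>).\<close>

definition Xup :: "(('a::real_vector \<times> 'a \<Rightarrow> complex) \<Rightarrow> 'a \<times> 'a) \<Rightarrow>
    ('a \<times> 'a \<Rightarrow> complex) \<Rightarrow> 'a \<times> 'a" where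
  "Xup X \<alpha> = X \<alpha> - X (- \<alpha>)"

definition Yup :: "(('a::real_vector \<times> 'a \<Rightarrow> complex) \<Rightarrow> 'a \<times> 'a) \<Rightarrow>
    ('a \<times> 'a \<Rightarrow> complex) \<Rightarrow> 'a \<times> 'a" where
  "Yup X \<alpha> = cscale \<i> (X \<alpha> + X (- \<alpha>))"

text \<open>\<open>Hv \<alpha>\<close> is the vector of \<open>h\<close> dual to \<open>\<alpha>\<close> under the Killing form and \<open>X \<alpha>\<close> the root
  vector. The last condition says that \<open>u\<close> is the compact real form spanned over the reals by
  the \<open>\<i> H\<^sub>\<alpha>\<close>, \<open>X\<^sup>\<alpha>\<close>, \<open>Y\<^sup>\<alpha>\<close>.\<close>

definition compact_root_data ::
  "('a::real_vector \<Rightarrow> 'a \<Rightarrow> 'a) \<Rightarrow> 'a set \<Rightarrow> ('a \<times> 'a) set \<Rightarrow>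
    ('a \<times> 'a \<Rightarrow> complex) set \<Rightarrow> ('a \<times> 'a \<Rightarrow> complex) set \<Rightarrow>
    (('a \<times> 'a \<Rightarrow> complex) \<Rightarrow> 'a \<times> 'a) \<Rightarrow> (('a \<times> 'a \<Rightarrow> complex) \<Rightarrow> 'a \<times> 'a) \<Rightarrow> bool" where
  "compact_root_data br u h \<Delta> \<Delta>p Hv X \<longleftrightarrow>
     cartan_subalgebra cscale (u \<times> u) (cbracket br) h \<and>
     \<Delta> = roots cscale (u \<times> u) (cbracket br) h \<and>
     positive_system \<Delta> \<Delta>p \<and>
     (\<forall>\<alpha>\<in>\<Delta>. Hv \<alpha> \<in> h \<and>
        (\<forall>H\<in>h. killing_form cscale (u \<times> u) (cbracket br) H (Hv \<alpha>) = \<alpha> H)) \<and>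
     (\<forall>\<alpha>\<in>\<Delta>. X \<alpha> \<in> root_space cscale (u \<times> u) (cbracket br) h \<alpha>) \<and>
     (\<forall>\<alpha>\<in>\<Delta>. cbracket br (X \<alpha>) (X (- \<alpha>)) = Hv \<alpha>) \<and>
     (\<exists>N :: ('a \<times> 'a \<Rightarrow> complex) \<Rightarrow> ('a \<times> 'a \<Rightarrow> complex) \<Rightarrow> real.
        \<forall>\<alpha>\<in>\<Delta>. \<forall>\<beta>\<in>\<Delta>. \<alpha> + \<beta> \<in> \<Delta> \<longrightarrow>
          cbracket br (X \<alpha>) (X \<beta>) = cscale (complex_of_real (N \<alpha> \<beta>)) (X (\<alpha> + \<beta>)) \<and>
          N \<alpha> \<beta> = - N (- \<alpha>) (- \<beta>)) \<and>
     (\<forall>\<alpha>\<in>\<Delta>. \<forall>\<beta>\<in>\<Delta>. \<alpha> + \<beta> \<noteq> 0 \<and> \<alpha> + \<beta> \<notin> \<Delta> \<longrightarrow> cbracket br (X \<alpha>) (X \<beta>) = 0) \<and>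
     u \<times> {0} = span ((\<lambda>\<alpha>. cscale \<i> (Hv \<alpha>)) ` \<Delta> \<union> Xup X ` \<Delta> \<union> Yup X ` \<Delta>)"

text \<open>The real subspace \<open>\<i> h\<^sub>\<real>\<close>, with \<open>h\<^sub>\<real>\<close> the real span of the \<open>H\<^sub>\<alpha>\<close>; it lies in
  \<open>u \<times> {0}\<close> and is given here as a subset of \<open>u\<close>.\<close>

definition ihR ::
  "('a::real_vector \<times> 'a \<Rightarrow> complex) set \<Rightarrow> (('a \<times> 'a \<Rightarrow> complex) \<Rightarrow> 'a \<times> 'a) \<Rightarrow> 'a set" where
  "ihR \<Delta> Hv = {x. (x, 0) \<in> cscale \<i> ` span (Hv ` \<Delta>)}"

section \<open>Representations and inner products\<close>

definition direct_sum2 :: "'a::real_vector set \<Rightarrow> 'a set \<Rightarrow> 'a set \<Rightarrow> bool" where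
  "direct_sum2 V A B \<longleftrightarrow>
     subspace A \<and> subspace B \<and> A \<inter> B = {0} \<and> V = {a + b | a b. a \<in> A \<and> b \<in> B}"

definition direct_sum :: "'a::real_vector set \<Rightarrow> 'i set \<Rightarrow> ('i \<Rightarrow> 'a set) \<Rightarrow> bool" where
  "direct_sum V I W \<longleftrightarrow>
     finite I \<and> (\<forall>i\<in>I. subspace (W i)) \<and>
     V = {\<Sum>i\<in>I. w i | w. \<forall>i\<in>I. w i \<in> W i} \<and>
     (\<forall>w. (\<forall>i\<in>I. w i \<in> W i) \<and> (\<Sum>i\<in>I. w i) = 0 \<longrightarrow> (\<forall>i\<in>I. w i = 0))"

definition invariant_under :: "'g set \<Rightarrow> ('g \<Rightarrow> 'v \<Rightarrow> 'v) \<Rightarrow> 'v set \<Rightarrow> bool" where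
  "invariant_under S \<pi> W \<longleftrightarrow> (\<forall>x\<in>S. \<forall>v\<in>W. \<pi> x v \<in> W)"

definition irreducible_module ::
  "'g set \<Rightarrow> ('g \<Rightarrow> 'v::real_vector \<Rightarrow> 'v) \<Rightarrow> 'v set \<Rightarrow> bool" where
  "irreducible_module u \<pi> V \<longleftrightarrow>
     subspace V \<and> invariant_under u \<pi> V \<and> V \<noteq> {0} \<and>
     (\<forall>W. subspace W \<and> W \<subseteq> V \<and> invariant_under u \<pi> W \<longrightarrow> W = {0} \<or> W = V)"

definition inner_product_on :: "'v::real_vector set \<Rightarrow> ('v \<Rightarrow> 'v \<Rightarrow> real) \<Rightarrow> bool" where
  "inner_product_on V ip \<longleftrightarrow>
     (\<forall>x\<in>V. \<forall>y\<in>V. \<forall>z\<in>V. ip (x + y) z = ip x z + ip y z) \<and>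
     (\<forall>c. \<forall>x\<in>V. \<forall>y\<in>V. ip (c *\<^sub>R x) y = c * ip x y) \<and>
     (\<forall>x\<in>V. \<forall>y\<in>V. ip x y = ip y x) \<and>
     (\<forall>x\<in>V. x \<noteq> 0 \<longrightarrow> ip x x > 0)"

text \<open>The transpose, with respect to \<open>ip\<close>, of a linear map defined on the subspace \<open>U\<close>; its
  values lie in \<open>U\<close>.\<close>

definition transpose_on ::
  "('v \<Rightarrow> 'v \<Rightarrow> real) \<Rightarrow> 'v set \<Rightarrow> ('v \<Rightarrow> 'v) \<Rightarrow> 'v \<Rightarrow> 'v" where
  "transpose_on ip U f w = (THE v. v \<in> U \<and> (\<forall>x\<in>U. ip (f x) w = ip x v))"

text \<open>The conditions on a decomposition \<open>V = V1 \<oplus> V2\<close> of a representation \<open>\<pi>\<close> of \<open>u\<close>. As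
  \<open>X\<^sup>\<alpha>\<close> and \<open>Y\<^sup>\<alpha>\<close> lie in \<open>u \<times> {0}\<close>, the elements of \<open>u\<close> that they denote are their first
  components.\<close>

definition adapted_decomposition ::
  "('a::real_vector \<times> 'a \<Rightarrow> complex) set \<Rightarrow> ('a \<times> 'a \<Rightarrow> complex) set \<Rightarrow>
    (('a \<times> 'a \<Rightarrow> complex) \<Rightarrow> 'a \<times> 'a) \<Rightarrow> (('a \<times> 'a \<Rightarrow> complex) \<Rightarrow> 'a \<times> 'a) \<Rightarrow>
    ('a \<Rightarrow> 'v::real_vector \<Rightarrow> 'v) \<Rightarrow> 'v set \<Rightarrow> 'v set \<Rightarrow> 'v set \<Rightarrow> ('v \<Rightarrow> 'v \<Rightarrow> real) \<Rightarrow> bool" where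
  "adapted_decomposition \<Delta> \<Delta>p Hv X \<pi> V V1 V2 ip \<longleftrightarrow>
     direct_sum2 V V1 V2 \<and> inner_product_on V ip \<and>
     (invariant_under (ihR \<Delta> Hv) \<pi> V1 \<and> invariant_under (ihR \<Delta> Hv) \<pi> V2) \<and>
     (\<forall>\<alpha>\<in>\<Delta>p. \<pi> (fst (Xup X \<alpha>)) ` V1 \<subseteq> V2 \<and> \<pi> (fst (Yup X \<alpha>)) ` V1 \<subseteq> V2) \<and>
     (\<forall>v\<in>V1. \<forall>w\<in>V2. ip v w = 0) \<and>
     (\<forall>H\<in>ihR \<Delta> Hv. \<forall>v\<in>V. \<forall>w\<in>V. ip (\<pi> H v) w = - ip v (\<pi> H w)) \<and>
     (\<forall>\<alpha>\<in>\<Delta>p. (\<exists>v\<in>V1. \<pi> (fst (Xup X \<alpha>)) v \<noteq> 0) \<and> (\<exists>v\<in>V1. \<pi> (fst (Yup X \<alpha>)) v \<noteq> 0)) \<and>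
     (\<forall>x \<in> fst ` (Xup X ` \<Delta>p \<union> Yup X ` \<Delta>p). \<forall>y \<in> fst ` (Xup X ` \<Delta>p \<union> Yup X ` \<Delta>p).
        x \<noteq> y \<longrightarrow> trace_on scaleR V1 (\<lambda>v. transpose_on ip V1 (\<pi> y) (\<pi> x v)) = 0)"

section \<open>Ricci curvature of a left-invariant metric\<close>

text \<open>Left-invariant vector fields are identified with elements of the Lie algebra. They form a
  global frame, inner products of left-invariant fields are constant functions, and the
  covariant derivative of a left-invariant field along another one is again left-invariant. So
  the Levi-Civita connection is the operation on the Lie algebra that is torsion-free,
  \<open>\<nabla>\<^sub>x y - \<nabla>\<^sub>y x = [x, y]\<close>, and metric, \<open>0 = x \<langle>y, z\<rangle> = \<langle>\<nabla>\<^sub>x y, z\<rangle> + \<langle>y, \<nabla>\<^sub>x z\<rangle>\<close>.\<close>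

definition levi_civita ::
  "('a::real_vector \<Rightarrow> 'a \<Rightarrow> 'a) \<Rightarrow> ('a \<Rightarrow> 'a \<Rightarrow> real) \<Rightarrow> 'a \<Rightarrow> 'a \<Rightarrow> 'a" where
  "levi_civita br ip = (THE D. bilinear D \<and>
     (\<forall>x y. D x y - D y x = br x y) \<and>
     (\<forall>x y z. ip (D x y) z + ip y (D x z) = 0))"

definition riemann_curvature ::
  "('a::real_vector \<Rightarrow> 'a \<Rightarrow> 'a) \<Rightarrow> ('a \<Rightarrow> 'a \<Rightarrow> real) \<Rightarrow> 'a \<Rightarrow> 'a \<Rightarrow> 'a \<Rightarrow> 'a" where
  "riemann_curvature br ip x y z =
     (let D = levi_civita br ip in D x (D y z) - D y (D x z) - D (br x y) z)"

definition ricci_tensor ::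
  "('a::real_vector \<Rightarrow> 'a \<Rightarrow> 'a) \<Rightarrow> ('a \<Rightarrow> 'a \<Rightarrow> real) \<Rightarrow> 'a \<Rightarrow> 'a \<Rightarrow> real" where
  "ricci_tensor br ip y z = trace_on scaleR UNIV (\<lambda>x. riemann_curvature br ip x y z)"

definition ricci_operator ::
  "('a::real_vector \<Rightarrow> 'a \<Rightarrow> 'a) \<Rightarrow> ('a \<Rightarrow> 'a \<Rightarrow> real) \<Rightarrow> 'a \<Rightarrow> 'a" where
  "ricci_operator br ip x = (THE v. \<forall>y. ip v y = ricci_tensor br ip x y)"

definition negative_ricci ::
  "('a::real_vector \<Rightarrow> 'a \<Rightarrow> 'a) \<Rightarrow> ('a \<Rightarrow> 'a \<Rightarrow> real) \<Rightarrow> bool" where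
  "negative_ricci br ip \<longleftrightarrow> (\<forall>x. x \<noteq> 0 \<longrightarrow> ip (ricci_operator br ip x) x < 0)"

end

theory Submission
  imports Defs
begin

text \<open>
  Why the theorem is true. In an orthonormal frame the Ricci form is a polynomial in the structure
  constants (\<open>ip_ricci_operator_self\<close>), so its negativity is an open condition on them
  (\<open>ricci_form_negative_open\<close>). Rescaling the vectors of a basis changes the metric but not the Lie
  algebra. Hence it suffices to find a degeneration of the bracket, obtained by rescaling, whose
  limit has negative Ricci form; the limit need not be isomorphic to the given Lie algebra.

  Give the basis vectors degrees: \<open>0\<close> for \<open>Z\<close> and the torus \<open>\<i> h\<^sub>\<real>\<close> of \<open>u\<close>, \<open>1\<close> for the span of the
  \<open>X\<^sup>\<alpha>\<close> and \<open>Y\<^sup>\<alpha>\<close>, \<open>3\<close> for \<open>V2\<close>, and \<open>2\<close> for \<open>V1\<close> and all irreducible components other than the chosen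
  one. The bracket does not raise the total degree: the only pairs with room for an increase would
  be those of total degree at most \<open>2\<close>, and there \<open>Z\<close> acts diagonally, the torus preserves \<open>V1\<close> and the
  other components, and \<open>[u, u] \<subseteq> u\<close>.
  Rescaling a vector of degree \<open>m\<close> by \<open>r ^ m\<close> and letting \<open>r \<rightarrow> 0\<close> leaves the associated graded
  bracket (\<open>ex_negative_ricci_if_graded\<close>). It is the bracket of a solvable algebra: what survives is
  the action of \<open>Z\<close> and the torus, and the maps \<open>V1 \<rightarrow> V2\<close> given by the \<open>X\<^sup>\<alpha>\<close> and \<open>Y\<^sup>\<alpha>\<close>.

  The graded Ricci form is negative for a suitable choice of the remaining scales
  (\<open>ex_weights_ricci_form_graded_negative\<close>), block by block. On degree \<open>1\<close>, the maps \<open>V1 \<rightarrow> V2\<close>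
  contribute a negative multiple of their Hilbert--Schmidt form, which is diagonal by (6) and
  definite by (5). On degrees \<open>2\<close> and \<open>3\<close>, the mean curvature of a short \<open>Z\<close> dominates everything
  else. On \<open>Z\<close> and the torus, the Ricci form is minus the square norm of the symmetric part of the
  adjoint action. For the torus this would vanish in a metric that is invariant under it; therefore
  \<open>X\<^sup>\<alpha>\<close> and \<open>Y\<^sup>\<alpha>\<close> are given different lengths, so that rotations in their plane are not skew. The
  positive terms caused by this are suppressed by making the torus long.

  The theory of roots supplies the input: the \<open>\<i> H\<^sub>\<beta>\<close> rotate the planes of the \<open>X\<^sup>\<alpha>\<close> and \<open>Y\<^sup>\<alpha>\<close>
  with real speeds (\<open>torus_action\<close>), these vectors are independent (\<open>pv_independent\<close>), the torus acts
  faithfully on them because \<open>u\<close> has no center (\<open>torus_faithful\<close>), and \<open>\<i> H\<^sub>\<alpha>\<close> is a bracket, so that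
  its adjoint map has trace zero.
\<close>

section \<open>Orthonormal bases\<close>

definition orthonormal_basis ::
  "('v::real_vector \<Rightarrow> 'v \<Rightarrow> real) \<Rightarrow> 'i set \<Rightarrow> ('i \<Rightarrow> 'v) \<Rightarrow> 'v set \<Rightarrow> bool" where
  "orthonormal_basis ip I e W \<longleftrightarrow>
     finite I \<and> (\<forall>i\<in>I. \<forall>j\<in>I. ip (e i) (e j) = (if i = j then 1 else 0)) \<and> span (e ` I) = W"

lemma ip_subset: "inner_product_on V ip \<Longrightarrow> W \<subseteq> V \<Longrightarrow> inner_product_on W ip"
  by (simp add: inner_product_on_def subset_eq)

lemma ip_add: "inner_product_on V ip \<Longrightarrow> x \<in> V \<Longrightarrow> y \<in> V \<Longrightarrow> z \<in> V \<Longrightarrow> ip (x + y) z = ip x z + ip y z"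
  and ip_scale: "inner_product_on V ip \<Longrightarrow> x \<in> V \<Longrightarrow> y \<in> V \<Longrightarrow> ip (c *\<^sub>R x) y = c * ip x y"
  and ip_sym: "inner_product_on V ip \<Longrightarrow> x \<in> V \<Longrightarrow> y \<in> V \<Longrightarrow> ip x y = ip y x"
  and ip_pos: "inner_product_on V ip \<Longrightarrow> x \<in> V \<Longrightarrow> x \<noteq> 0 \<Longrightarrow> ip x x > 0"
  by (simp_all add: inner_product_on_def)

lemma ip_zero_left:
  assumes "inner_product_on W ip" "subspace W" "y \<in> W"
  shows "ip 0 y = 0"
proof -
  have "ip (0 *\<^sub>R 0) y = 0 * ip 0 y"
    by (rule ip_scale[OF assms(1) subspace_0[OF assms(2)] assms(3)])
  then show ?thesis by simp
qed

lemma ip_sum_left: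
  assumes ip: "inner_product_on W ip" and W: "subspace W" and y: "y \<in> W"
    and f: "\<And>i. i \<in> A \<Longrightarrow> f i \<in> W"
  shows "ip (\<Sum>i\<in>A. a i *\<^sub>R f i) y = (\<Sum>i\<in>A. a i * ip (f i) y)"
  using f
proof (induction A rule: infinite_finite_induct)
  case (insert x A)
  have 1: "a x *\<^sub>R f x \<in> W" "(\<Sum>i\<in>A. a i *\<^sub>R f i) \<in> W"
    using W insert.prems by (auto intro!: subspace_scale subspace_sum)
  then have "ip (\<Sum>i\<in>insert x A. a i *\<^sub>R f i) y = ip (a x *\<^sub>R f x) y + ip (\<Sum>i\<in>A. a i *\<^sub>R f i) y"
    using insert.hyps ip_add[OF ip _ _ y] by simp
  also have "ip (a x *\<^sub>R f x) y = a x * ip (f x) y"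
    using insert.prems by (intro ip_scale[OF ip _ y]) auto
  finally show ?case using insert by auto
qed (auto simp: ip_zero_left[OF ip W y])

lemma ip_sum_right:
  assumes ip: "inner_product_on W ip" and W: "subspace W" and y: "y \<in> W"
    and f: "\<And>i. i \<in> A \<Longrightarrow> f i \<in> W"
  shows "ip y (\<Sum>i\<in>A. a i *\<^sub>R f i) = (\<Sum>i\<in>A. a i * ip y (f i))"
proof -
  have "(\<Sum>i\<in>A. a i *\<^sub>R f i) \<in> W" using W f by (auto intro!: subspace_scale subspace_sum)
  then have "ip y (\<Sum>i\<in>A. a i *\<^sub>R f i) = ip (\<Sum>i\<in>A. a i *\<^sub>R f i) y"
    by (rule ip_sym[OF ip y])
  also have "\<dots> = (\<Sum>i\<in>A. a i * ip (f i) y)" by (rule ip_sum_left[OF ip W y f])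
  also have "\<dots> = (\<Sum>i\<in>A. a i * ip y (f i))"
    using ip_sym[OF ip _ y] f by (intro sum.cong) auto
  finally show ?thesis .
qed

lemma ip_diff_left:
  assumes ip: "inner_product_on W ip" and W: "subspace W" and "x \<in> W" "y \<in> W" "z \<in> W"
  shows "ip (x - y) z = ip x z - ip y z"
proof -
  have "ip ((x - y) + y) z = ip (x - y) z + ip y z"
    using assms subspace_diff by (intro ip_add[OF ip]) auto
  then show ?thesis by simp
qed

lemma orthonormal_basis_in: "orthonormal_basis ip I e W \<Longrightarrow> i \<in> I \<Longrightarrow> e i \<in> W"
  unfolding orthonormal_basis_def using span_superset by blast

lemma orthonormal_basis_subspace: "orthonormal_basis ip I e W \<Longrightarrow> subspace W"
  unfolding orthonormal_basis_def by auto

lemma orthonormal_expansion: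
  assumes ip: "inner_product_on W ip" and e: "orthonormal_basis ip I e W" and x: "x \<in> W"
  shows "x = (\<Sum>i\<in>I. ip x (e i) *\<^sub>R e i)"
proof -
  have W: "subspace W" by (rule orthonormal_basis_subspace[OF e])
  note eW = orthonormal_basis_in[OF e]
  have fin: "finite I" using e by (simp add: orthonormal_basis_def)
  have "x \<in> span (e ` I)" using e x by (simp add: orthonormal_basis_def)
  then have "x \<in> W \<and> x = (\<Sum>i\<in>I. ip x (e i) *\<^sub>R e i)"
  proof (induction rule: span_induct_alt)
    case base
    show ?case using eW subspace_0[OF W] by (simp add: ip_zero_left[OF ip W])
  next
    case (step c v y)
    then obtain k where k: "k \<in> I" "v = e k" by auto
    have yW: "y \<in> W" using step.IH by blast
    have "ip (c *\<^sub>R v + y) (e i) = c * (if k = i then 1 else 0) + ip y (e i)" if "i \<in> I" for i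
    proof -
      have "ip (c *\<^sub>R v + y) (e i) = ip (c *\<^sub>R v) (e i) + ip y (e i)"
        using yW eW[OF that] k(2) eW[OF k(1)] subspace_scale[OF W] by (intro ip_add[OF ip]) auto
      also have "ip (c *\<^sub>R v) (e i) = c * ip v (e i)"
        using eW[OF that] k(2) eW[OF k(1)] by (intro ip_scale[OF ip]) auto
      finally show ?thesis using e k that by (simp add: orthonormal_basis_def)
    qed
    then have "(\<Sum>i\<in>I. ip (c *\<^sub>R v + y) (e i) *\<^sub>R e i)
        = (\<Sum>i\<in>I. (c * (if k = i then 1 else 0)) *\<^sub>R e i + ip y (e i) *\<^sub>R e i)"
      by (simp add: scaleR_add_left)
    also have "\<dots> = (\<Sum>i\<in>I. if k = i then c *\<^sub>R e i else 0) + (\<Sum>i\<in>I. ip y (e i) *\<^sub>R e i)"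
      by (simp only: sum.distrib) (intro arg_cong2[where f="(+)"] sum.cong refl, auto)
    also have "\<dots> = c *\<^sub>R v + y" using step.IH k fin by simp
    finally show ?case
      using yW eW[OF k(1)] k(2) W by (simp add: subspace_add subspace_scale)
  qed
  then show ?thesis by blast
qed

lemma ip_expansion:
  assumes ip: "inner_product_on W ip" and e: "orthonormal_basis ip I e W" and x: "x \<in> W" and y: "y \<in> W"
  shows "ip x y = (\<Sum>i\<in>I. ip x (e i) * ip y (e i))"
proof -
  have "ip x y = ip x (\<Sum>i\<in>I. ip y (e i) *\<^sub>R e i)"
    using orthonormal_expansion[OF ip e y] by simp
  also have "\<dots> = (\<Sum>i\<in>I. ip y (e i) * ip x (e i))"
    by (rule ip_sum_right[OF ip orthonormal_basis_subspace[OF e] x orthonormal_basis_in[OF e]])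
  finally show ?thesis by (simp add: mult.commute)
qed

lemma orthonormal_basis_ext:
  assumes ip: "inner_product_on W ip" and e: "orthonormal_basis ip I e W" and x: "x \<in> W" and y: "y \<in> W"
    and eq: "\<And>i. i \<in> I \<Longrightarrow> ip x (e i) = ip y (e i)"
  shows "x = y"
  using orthonormal_expansion[OF ip e x] orthonormal_expansion[OF ip e y] eq by simp

lemma orthonormal_basis_independent:
  assumes ip: "inner_product_on W ip" and E: "orthonormal_basis ip E (\<lambda>x. x) W"
  shows "independent E"
proof (rule independent_if_scalars_zero)
  show finE: "finite E" using E by (simp add: orthonormal_basis_def)
  fix f x assume 0: "(\<Sum>x\<in>E. f x *\<^sub>R x) = 0" and x: "x \<in> E"
  note EW = orthonormal_basis_in[OF E] and subW = orthonormal_basis_subspace[OF E]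
  have "0 = ip (\<Sum>x\<in>E. f x *\<^sub>R x) x"
    unfolding 0 using ip_zero_left[OF ip subW EW[OF x]] by simp
  also have "\<dots> = (\<Sum>y\<in>E. f y * ip y x)" by (rule ip_sum_left[OF ip subW EW[OF x] EW])
  also have "\<dots> = (\<Sum>y\<in>E. if y = x then f x else 0)"
    using E x by (intro sum.cong) (auto simp: orthonormal_basis_def)
  finally show "f x = 0" using finE x by simp
qed

text \<open>The basis chosen by \<open>trace_on\<close> is one, since every subspace has a basis.\<close>

lemma basis_choice:
  fixes W :: "'v::real_vector set"
  assumes "subspace W"
  defines "B \<equiv> SOME B. \<not> module.dependent scaleR B \<and> module.span scaleR B = W"
  shows "independent B" "span B = W"
proof -
  obtain C where C: "C \<subseteq> W" "independent C" "W \<subseteq> span C"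
    using maximal_independent_subset[of W] by blast
  then have "span C = W" using span_minimal[OF C(1) assms(1)] by blast
  with C have "\<exists>B. \<not> module.dependent scaleR B \<and> module.span scaleR B = W"
    unfolding dependent_raw_def span_raw_def by blast
  from someI_ex[OF this] show "independent B" "span B = W"
    unfolding B_def dependent_raw_def span_raw_def by blast+
qed

text \<open>Writing each vector \<open>b\<close> of an arbitrary basis in the orthonormal basis turns the diagonal
  sum over the \<open>b\<close> into the sum of the \<open>ip (f (e i)) (e i)\<close>; so a trace may be
  computed in any orthonormal basis.\<close>

lemma trace_on_orthonormal:
  assumes ip: "inner_product_on W ip" and e: "orthonormal_basis ip I e W"
    and f: "\<And>x. x \<in> W \<Longrightarrow> f x \<in> W"
    and add: "\<And>x y. x \<in> W \<Longrightarrow> y \<in> W \<Longrightarrow> f (x + y) = f x + f y"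
    and scale: "\<And>a x. x \<in> W \<Longrightarrow> f (a *\<^sub>R x) = a *\<^sub>R f x"
  shows "trace_on scaleR W f = (\<Sum>i\<in>I. ip (f (e i)) (e i))"
proof -
  have W: "subspace W" by (rule orthonormal_basis_subspace[OF e])
  note eW = orthonormal_basis_in[OF e]
  have fin: "finite I" using e by (simp add: orthonormal_basis_def)
  define B where "B = (SOME B. \<not> module.dependent scaleR B \<and> module.span scaleR B = W)"
  have indep: "independent B" and spanB: "span B = W"
    using basis_choice[OF W] unfolding B_def by auto
  have BW: "B \<subseteq> W" using spanB span_superset by blast
  have finB: "finite B"
    using independent_span_bound[OF finite_imageI[OF fin] indep, of e] BW e
    by (simp add: orthonormal_basis_def)
  have f_sum: "f (\<Sum>i\<in>A. a i *\<^sub>R e i) = (\<Sum>i\<in>A. a i *\<^sub>R f (e i))" if "A \<subseteq> I" for A a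
    using finite_subset[OF that fin] that
  proof (induction A rule: finite_induct)
    case empty
    show ?case using scale[of 0 0] subspace_0[OF W] by simp
  next
    case (insert k A)
    have "a k *\<^sub>R e k \<in> W" "(\<Sum>i\<in>A. a i *\<^sub>R e i) \<in> W"
      using insert.prems eW W by (auto intro!: subspace_scale subspace_sum)
    then show ?case using insert eW by (simp add: add scale)
  qed
  have "trace_on scaleR W f = (\<Sum>b\<in>B. representation B (f b) b)"
    unfolding trace_on_def B_def Let_def representation_raw_def by simp
  also have "\<dots> = (\<Sum>b\<in>B. \<Sum>i\<in>I. ip b (e i) * representation B (f (e i)) b)"
  proof (rule sum.cong[OF refl])
    fix b assume "b \<in> B"
    then have "b = (\<Sum>i\<in>I. ip b (e i) *\<^sub>R e i)"
      using BW by (intro orthonormal_expansion[OF ip e]) auto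
    then have "f b = f (\<Sum>i\<in>I. ip b (e i) *\<^sub>R e i)" by simp
    also have "\<dots> = (\<Sum>i\<in>I. ip b (e i) *\<^sub>R f (e i))" using f_sum[of I] by simp
    finally have 1: "f b = \<dots>" .
    have "representation B (\<Sum>i\<in>I. ip b (e i) *\<^sub>R f (e i)) b
        = (\<Sum>i\<in>I. representation B (ip b (e i) *\<^sub>R f (e i)) b)"
      using f eW spanB W by (subst representation_sum[OF indep]) (auto intro: subspace_scale)
    also have "\<dots> = (\<Sum>i\<in>I. ip b (e i) * representation B (f (e i)) b)"
      using f eW spanB by (intro sum.cong refl) (simp add: representation_scale[OF indep])
    finally show "representation B (f b) b = (\<Sum>i\<in>I. ip b (e i) * representation B (f (e i)) b)"
      using 1 by simp
  qed
  also have "\<dots> = (\<Sum>i\<in>I. \<Sum>b\<in>B. representation B (f (e i)) b * ip b (e i))"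
    by (subst sum.swap) (simp add: mult.commute)
  also have "\<dots> = (\<Sum>i\<in>I. ip (f (e i)) (e i))"
  proof (rule sum.cong[OF refl])
    fix i assume i: "i \<in> I"
    have "(\<Sum>b\<in>B. representation B (f (e i)) b *\<^sub>R b) = f (e i)"
      using f[OF eW[OF i]] spanB by (intro sum_representation_eq[OF indep _ finB]) auto
    moreover have "ip (\<Sum>b\<in>B. representation B (f (e i)) b *\<^sub>R b) (e i)
        = (\<Sum>b\<in>B. representation B (f (e i)) b * ip b (e i))"
      using BW by (intro ip_sum_left[OF ip W eW[OF i]]) auto
    ultimately show "(\<Sum>b\<in>B. representation B (f (e i)) b * ip b (e i)) = ip (f (e i)) (e i)"
      by simp
  qed
  finally show ?thesis .
qed

text \<open>Gram--Schmidt, for an inner product that is only given on the span.\<close>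

lemma ex_orthonormal_basis:
  assumes "finite S" "inner_product_on (span S) ip"
  shows "\<exists>E. orthonormal_basis ip E (\<lambda>x. x) (span S)"
  using assms
proof (induction S rule: finite_induct)
  case empty
  show ?case by (rule exI[of _ "{}"]) (simp add: orthonormal_basis_def)
next
  case (insert a S)
  let ?W = "span (insert a S)"
  have sub: "span S \<subseteq> ?W" by (rule span_mono) auto
  have ipS: "inner_product_on (span S) ip" using ip_subset[OF insert.prems sub] .
  obtain E where E: "orthonormal_basis ip E (\<lambda>x. x) (span S)" using insert.IH[OF ipS] by blast
  have finE: "finite E" and onE: "\<And>x y. x \<in> E \<Longrightarrow> y \<in> E \<Longrightarrow> ip x y = (if x = y then 1 else 0)"
    and spE: "span E = span S" using E by (auto simp: orthonormal_basis_def)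
  show ?case
  proof (cases "a \<in> span S")
    case True
    then have "span (insert a S) = span S" by (rule span_redundant)
    then show ?thesis using E by auto
  next
    case False
    note ip = insert.prems
    define b where "b = a - (\<Sum>x\<in>E. ip a x *\<^sub>R x)"
    have ES: "E \<subseteq> span S" using spE span_superset by blast
    then have EW: "E \<subseteq> ?W" using sub by blast
    have aW: "a \<in> ?W" by (simp add: span_base)
    have sumS: "(\<Sum>x\<in>E. ip a x *\<^sub>R x) \<in> span S" using ES by (auto intro!: span_sum span_scale)
    then have sumW: "(\<Sum>x\<in>E. ip a x *\<^sub>R x) \<in> ?W" using sub by blast
    have bW: "b \<in> ?W" unfolding b_def by (rule span_diff[OF aW sumW])
    have b0: "b \<noteq> 0" using False sumS unfolding b_def by auto
    have orth: "ip b y = 0" if y: "y \<in> E" for y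
    proof -
      have yW: "y \<in> ?W" using y EW by auto
      have "ip b y = ip a y - ip (\<Sum>x\<in>E. ip a x *\<^sub>R x) y"
        unfolding b_def by (rule ip_diff_left[OF ip subspace_span aW sumW yW])
      also have "ip (\<Sum>x\<in>E. ip a x *\<^sub>R x) y = (\<Sum>x\<in>E. ip a x * ip x y)"
        using EW by (intro ip_sum_left[OF ip subspace_span yW]) auto
      also have "\<dots> = (\<Sum>x\<in>E. if x = y then ip a x else 0)"
        using onE y by (intro sum.cong) auto
      finally show ?thesis using y finE by simp
    qed
    define c where "c = b /\<^sub>R sqrt (ip b b)"
    have pos: "ip b b > 0" by (rule ip_pos[OF ip bW b0])
    have scl: "ip (r *\<^sub>R x) y = r * ip x y" if "x \<in> ?W" "y \<in> ?W" for r x y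
      by (rule ip_scale[OF ip that])
    have sym: "ip x y = ip y x" if "x \<in> ?W" "y \<in> ?W" for x y
      by (rule ip_sym[OF ip that])
    have cW: "c \<in> ?W" unfolding c_def by (rule span_scale[OF bW])
    have cy: "ip c y = 0" "ip y c = 0" if "y \<in> E" for y
      using scl[OF bW, of y] orth[OF that] EW that sym[OF cW, of y] by (auto simp: c_def)
    have cc: "ip c c = 1"
    proof -
      have "ip c c = inverse (sqrt (ip b b)) * ip b c" unfolding c_def using scl[OF bW] cW c_def by simp
      also have "ip b c = ip c b" using sym[OF bW cW] .
      also have "ip c b = inverse (sqrt (ip b b)) * ip b b" unfolding c_def using scl[OF bW bW] by simp
      finally show ?thesis using pos by (simp add: field_simps)
    qed
    have "c \<notin> E" using cy cc by force
    have a_eq: "a = sqrt (ip b b) *\<^sub>R c + (\<Sum>x\<in>E. ip a x *\<^sub>R x)"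
      using pos by (simp add: c_def b_def)
    have "span (insert c E) = ?W"
    proof
      show "span (insert c E) \<subseteq> ?W" by (rule span_minimal) (use cW EW in auto)
      have "(\<Sum>x\<in>E. ip a x *\<^sub>R x) \<in> span (insert c E)"
        by (intro span_sum span_scale span_base) auto
      then have "a \<in> span (insert c E)"
        using span_add[OF span_scale[OF span_base[OF insertI1]], of _ c E "sqrt (ip b b)"] a_eq by metis
      moreover have "S \<subseteq> span (insert c E)"
        using spE span_superset[of S] span_mono[of E "insert c E"] by blast
      ultimately show "?W \<subseteq> span (insert c E)" by (intro span_minimal) auto
    qed
    then have "orthonormal_basis ip (insert c E) (\<lambda>x. x) ?W"
      using finE onE cy cc \<open>c \<notin> E\<close> unfolding orthonormal_basis_def by auto
    then show ?thesis by blast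
  qed
qed

section \<open>The Ricci form in an orthonormal frame\<close>

text \<open>The value of the Ricci form at the vector with coordinates \<open>x\<close>, in terms of the structure
  constants \<open>c i j k = \<langle>[e i, e j], e k\<rangle>\<close> of an orthonormal frame \<open>e\<close>. The middle term is minus the
  square norm of the symmetric part of \<open>ad x\<close>; the last one is \<open>- \<langle>[m, x], x\<rangle>\<close> for the mean
  curvature vector \<open>m\<close>, whose inner product with any \<open>y\<close> is the trace of \<open>ad y\<close>. The
  formula makes sense for arbitrary \<open>c\<close>, which will be used for limits of structure constants.\<close>

definition ricci_form :: "'i set \<Rightarrow> ('i \<Rightarrow> 'i \<Rightarrow> 'i \<Rightarrow> real) \<Rightarrow> ('i \<Rightarrow> real) \<Rightarrow> real" where
  "ricci_form I c x =
     (\<Sum>k\<in>I. \<Sum>l\<in>I. (\<Sum>i\<in>I. c k l i * x i)\<^sup>2) / 4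
     - (\<Sum>k\<in>I. \<Sum>l\<in>I. (\<Sum>i\<in>I. x i * (c i k l + c i l k))\<^sup>2) / 4
     - (\<Sum>k\<in>I. (\<Sum>l\<in>I. c k l l) * (\<Sum>i\<in>I. \<Sum>j\<in>I. c k i j * x i * x j))"

locale real_lie_algebra =
  fixes br :: "'a::real_vector \<Rightarrow> 'a \<Rightarrow> 'a"
  assumes lie: "lie_algebra scaleR (UNIV :: 'a set) br"
begin

lemma br_add: "br (x + y) z = br x z + br y z" "br z (x + y) = br z x + br z y"
  and br_scale: "br (a *\<^sub>R x) y = a *\<^sub>R br x y" "br x (a *\<^sub>R y) = a *\<^sub>R br x y"
  and br_self: "br x x = 0"
  using lie_algebra.br_add_left[OF lie] lie_algebra.br_add_right[OF lie] lie_algebra.br_scale_left[OF lie]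
    lie_algebra.br_scale_right[OF lie] lie_algebra.br_self[OF lie] by auto

lemma br_anti: "br x y = - br y x"
proof -
  have "br (x + y) (x + y) = br x y + br y x"
    unfolding br_add by (simp add: br_self)
  then show ?thesis by (simp add: br_self eq_neg_iff_add_eq_0)
qed

lemma br_zero: "br 0 x = 0" "br x 0 = 0"
  using br_scale(1)[of 0 0 x] br_scale(2)[of x 0 0] by simp_all

lemma br_minus: "br (- x) y = - br x y" "br x (- y) = - br x y"
  using br_scale(1)[of "-1" x y] br_scale(2)[of x "-1" y] by simp_all

lemma br_diff: "br (x - y) z = br x z - br y z" "br z (x - y) = br z x - br z y"
  using br_add(1)[of x "- y" z] br_add(2)[of z x "- y"] by (simp_all add: br_minus)

lemmas br_simps = br_add br_scale br_zero br_minus br_diff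

lemma br_deriv: "br x (br y z) = br (br x y) z + br y (br x z)"
proof -
  have "br x (br y z) + br y (br z x) + br z (br x y) = 0"
    using lie_algebra.jacobi[OF lie] by simp
  then show ?thesis
    using br_anti[of z x] br_anti[of z "br x y"] by (simp add: br_minus algebra_simps)
qed

end

locale metric_lie_algebra = real_lie_algebra br
  for br :: "'a::real_vector \<Rightarrow> 'a \<Rightarrow> 'a" +
  fixes ip :: "'a \<Rightarrow> 'a \<Rightarrow> real" and I :: "'i set" and e :: "'i \<Rightarrow> 'a"
  assumes ip: "inner_product_on (UNIV :: 'a set) ip"
    and frame: "orthonormal_basis ip I e UNIV"
begin

lemma ip_add_left: "ip (x + y) z = ip x z + ip y z"
  and ip_scale_left: "ip (a *\<^sub>R x) z = a * ip x z"
  and ip_commute: "ip x y = ip y x"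
  by (simp_all add: ip_add[OF ip] ip_scale[OF ip] ip_sym[OF ip, of x y])

lemma ip_add_right: "ip z (x + y) = ip z x + ip z y"
  and ip_scale_right: "ip z (a *\<^sub>R x) = a * ip z x"
  using ip_add_left ip_scale_left ip_commute by metis+

lemma ip_minus: "ip (- x) y = - ip x y" "ip y (- x) = - ip y x"
  using ip_scale_left[of "-1" x y] ip_scale_right[of y "-1" x] by simp_all

lemma ip_diff: "ip (x - y) z = ip x z - ip y z" "ip z (x - y) = ip z x - ip z y"
  using ip_add_left[of x "- y" z] ip_add_right[of z x "- y"] by (simp_all add: ip_minus)

lemmas ip_simps = ip_add_left ip_add_right ip_scale_left ip_scale_right ip_minus ip_diff

lemma ip_sum: "ip (\<Sum>i\<in>A. a i *\<^sub>R f i) z = (\<Sum>i\<in>A. a i * ip (f i) z)"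
  "ip z (\<Sum>i\<in>A. a i *\<^sub>R f i) = (\<Sum>i\<in>A. a i * ip z (f i))"
  by (rule ip_sum_left[OF ip] ip_sum_right[OF ip]; simp)+

lemma expand: "x = (\<Sum>i\<in>I. ip x (e i) *\<^sub>R e i)"
  by (rule orthonormal_expansion[OF ip frame]) simp

lemma parseval: "ip x y = (\<Sum>i\<in>I. ip x (e i) * ip y (e i))"
  by (rule ip_expansion[OF ip frame]) auto

lemma eqI_ip: "(\<And>z. ip x z = ip y z) \<Longrightarrow> x = y"
  by (rule orthonormal_basis_ext[OF ip frame]) auto

text \<open>The Koszul formula for the Levi-Civita connection of left-invariant fields; their inner products
  are constant, so only the bracket terms of the general formula remain.\<close>

definition nabla :: "'a \<Rightarrow> 'a \<Rightarrow> 'a" where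
  "nabla x y = (\<Sum>i\<in>I. ((ip (br x y) (e i) - ip (br y (e i)) x + ip (br (e i) x) y) / 2) *\<^sub>R e i)"

lemma linear_functional_expand:
  assumes "\<And>x y. \<phi> (x + y) = \<phi> x + \<phi> y" "\<And>a x. \<phi> (a *\<^sub>R x) = a * \<phi> x"
  shows "\<phi> x = (\<Sum>i\<in>I. ip x (e i) * \<phi> (e i))"
proof -
  have "linear \<phi>" by (rule linearI) (simp_all add: assms)
  then have "\<phi> (\<Sum>i\<in>I. ip x (e i) *\<^sub>R e i) = (\<Sum>i\<in>I. ip x (e i) * \<phi> (e i))"
    by (simp add: linear_sum linear_scale assms(2))
  then show ?thesis using expand[of x] by simp
qed

lemma ip_nabla: "ip (nabla x y) z = (ip (br x y) z - ip (br y z) x + ip (br z x) y) / 2"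
proof -
  let ?\<phi> = "\<lambda>z. (ip (br x y) z - ip (br y z) x + ip (br z x) y) / 2"
  have "?\<phi> z = (\<Sum>i\<in>I. ip z (e i) * ?\<phi> (e i))"
    by (rule linear_functional_expand) (simp_all add: br_add br_scale ip_simps field_simps)
  then show ?thesis
    by (simp add: nabla_def ip_sum mult.commute ip_commute[of z])
qed

lemma nabla_add: "nabla (x + y) z = nabla x z + nabla y z" "nabla z (x + y) = nabla z x + nabla z y"
  by (rule eqI_ip; simp add: ip_nabla ip_simps br_add field_simps)+

lemma nabla_scale: "nabla (a *\<^sub>R x) z = a *\<^sub>R nabla x z" "nabla z (a *\<^sub>R x) = a *\<^sub>R nabla z x"
  by (rule eqI_ip; simp add: ip_nabla ip_simps br_scale field_simps)+

lemma nabla_torsion: "nabla x y - nabla y x = br x y"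
proof (rule eqI_ip)
  fix z show "ip (nabla x y - nabla y x) z = ip (br x y) z"
    using br_anti[of y x] br_anti[of z x] br_anti[of y z]
    by (simp add: ip_simps ip_nabla ip_minus field_simps)
qed

lemma nabla_metric: "ip (nabla x y) z + ip y (nabla x z) = 0"
  using br_anti[of y x] br_anti[of z x] br_anti[of y z]
  by (simp add: ip_commute[of y "nabla x z"] ip_nabla ip_minus field_simps)

lemma levi_civita_eq: "levi_civita br ip = nabla"
  unfolding levi_civita_def
proof (rule the_equality)
  show "bilinear nabla \<and> (\<forall>x y. nabla x y - nabla y x = br x y) \<and>
      (\<forall>x y z. ip (nabla x y) z + ip y (nabla x z) = 0)"
    unfolding bilinear_def
    by (auto intro!: linearI simp: nabla_add nabla_scale nabla_torsion nabla_metric)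
next
  fix D assume D: "bilinear D \<and> (\<forall>x y. D x y - D y x = br x y) \<and>
      (\<forall>x y z. ip (D x y) z + ip y (D x z) = 0)"
  have t: "ip (D x y) z - ip (D y x) z = ip (br x y) z" for x y z
  proof -
    have "D x y - D y x = br x y" using D by blast
    then show ?thesis by (metis ip_diff(1))
  qed
  have m: "ip (D x y) z = - ip (D x z) y" for x y z
  proof -
    have "ip (D x y) z + ip y (D x z) = 0" using D by blast
    then show ?thesis using ip_commute[of y "D x z"] by simp
  qed
  show "D = nabla"
  proof (intro ext eqI_ip)
    fix x y z
    \<comment> \<open>Torsion and metric conditions for the cyclic permutations of \<open>x, y, z\<close> determine \<open>D\<close>.\<close>
    show "ip (D x y) z = ip (nabla x y) z"
      using t[of x y z] t[of y z x] t[of z x y] m[of x y z] m[of y z x] m[of z x y]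
      by (simp add: ip_nabla)
  qed
qed

lemma riemann_eq:
  "riemann_curvature br ip x y z = nabla x (nabla y z) - nabla y (nabla x z) - nabla (br x y) z"
  by (simp add: riemann_curvature_def levi_civita_eq Let_def)

lemma ricci_tensor_eq: "ricci_tensor br ip y z = (\<Sum>i\<in>I. ip (riemann_curvature br ip (e i) y z) (e i))"
  unfolding ricci_tensor_def
  by (rule trace_on_orthonormal[OF ip frame])
     (simp_all add: riemann_eq nabla_add nabla_scale br_add br_scale algebra_simps)

lemma ip_ricci_operator: "ip (ricci_operator br ip x) y = ricci_tensor br ip x y"
proof -
  define v where "v = (\<Sum>i\<in>I. ricci_tensor br ip x (e i) *\<^sub>R e i)"
  have v: "ip v y = ricci_tensor br ip x y" for y
  proof -
    have "ricci_tensor br ip x y = (\<Sum>i\<in>I. ip y (e i) * ricci_tensor br ip x (e i))"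
      by (rule linear_functional_expand)
         (simp_all add: ricci_tensor_eq riemann_eq nabla_add nabla_scale ip_simps
           sum.distrib sum_subtractf sum_distrib_left algebra_simps)
    then show ?thesis by (simp add: v_def ip_sum ip_commute[of y] mult.commute)
  qed
  have "ricci_operator br ip x = v"
    unfolding ricci_operator_def
  proof (rule the_equality)
    fix w assume "\<forall>y. ip w y = ricci_tensor br ip x y"
    then show "w = v" using v by (intro eqI_ip) simp
  qed (use v in simp)
  then show ?thesis using v by simp
qed

text \<open>Two of the three curvature terms combine: with \<open>N k l = ip (nabla (e k) y) (e l)\<close> and
  \<open>A k l = ip (br y (e k)) (e l)\<close>, the Koszul formula makes \<open>N\<close> the sum of \<open>- (A + A\<^sup>t) / 2\<close> and
  an antisymmetric matrix, so \<open>tr (N N\<^sup>t)\<close> splits and the terms linear in \<open>N\<close> only see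
  the symmetric part. The third term is the mean curvature, since
  \<open>\<Sum>i. ip (nabla (e i) (e i)) z\<close> is the trace of \<open>br z\<close>.\<close>

lemma ricci_tensor_frame:
  "ricci_tensor br ip y y =
     (\<Sum>k\<in>I. \<Sum>l\<in>I. (ip (br (e k) (e l)) y)\<^sup>2) / 4
     - (\<Sum>k\<in>I. \<Sum>l\<in>I. (ip (br y (e k)) (e l) + ip (br y (e l)) (e k))\<^sup>2) / 4
     - (\<Sum>k\<in>I. (\<Sum>l\<in>I. ip (br (e k) (e l)) (e l)) * ip (br (e k) y) y)"
proof -
  define A where "A k l = ip (br y (e k)) (e l)" for k l
  define W where "W k l = ip (br (e k) (e l)) y" for k l
  define N where "N k l = ip (nabla (e k) y) (e l)" for k l
  have W: "W l k = - W k l" for k l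
    unfolding W_def using br_anti[of "e l" "e k"] by (simp add: ip_minus)
  have N: "N k l = - (A k l + A l k) / 2 - W k l / 2" for k l
    unfolding N_def A_def W_def ip_nabla
    using br_anti[of "e k" y] br_anti[of "e k" "e l"] by (simp add: ip_minus field_simps)
  have third: "(\<Sum>i\<in>I. ip (nabla (e i) (nabla y y)) (e i))
      = - (\<Sum>k\<in>I. (\<Sum>l\<in>I. ip (br (e k) (e l)) (e l)) * ip (br (e k) y) y)"
  proof -
    have ny: "ip (nabla y y) (e k) = ip (br (e k) y) y" for k
      using br_anti[of y "e k"] by (simp add: ip_nabla br_self ip_minus ip_scale_left[of 0 0, simplified])
    have "(\<Sum>i\<in>I. ip (nabla (e i) z) (e i)) = - (\<Sum>l\<in>I. ip (br z (e l)) (e l))" for z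
    proof -
      have "ip (nabla (e i) z) (e i) = - ip (br z (e i)) (e i)" for i
        using br_anti[of "e i" z] by (simp add: ip_nabla br_self ip_minus ip_scale_left[of 0 0, simplified])
      then show ?thesis by (simp add: sum_negf)
    qed
    also have "- (\<Sum>l\<in>I. ip (br (nabla y y) (e l)) (e l))
        = - (\<Sum>k\<in>I. ip (nabla y y) (e k) * (\<Sum>l\<in>I. ip (br (e k) (e l)) (e l)))"
      by (subst linear_functional_expand[of "\<lambda>z. \<Sum>l\<in>I. ip (br z (e l)) (e l)"])
         (simp_all add: br_add br_scale ip_simps sum.distrib sum_distrib_left)
    finally show ?thesis by (simp add: mult.commute ny)
  qed
  have second: "ip (nabla y (nabla (e i) y)) (e i) = - (\<Sum>l\<in>I. N i l * N i l) - (\<Sum>l\<in>I. A i l * N i l)"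
    for i
  proof -
    have "ip (nabla y (nabla (e i) y)) (e i) = - ip (nabla (e i) y) (nabla y (e i))"
      using nabla_metric[of y "nabla (e i) y" "e i"] by simp
    also have "nabla y (e i) = nabla (e i) y + br y (e i)"
      using nabla_torsion[of y "e i"] by (simp add: algebra_simps)
    also have "- ip (nabla (e i) y) (nabla (e i) y + br y (e i))
        = - ip (nabla (e i) y) (nabla (e i) y) - ip (br y (e i)) (nabla (e i) y)"
      by (simp add: ip_simps ip_commute)
    finally show ?thesis
      using parseval[of "nabla (e i) y" "nabla (e i) y"] parseval[of "br y (e i)" "nabla (e i) y"]
      by (simp add: N_def A_def)
  qed
  have fourth: "ip (nabla (br (e i) y) y) (e i) = - (\<Sum>l\<in>I. A i l * N l i)" for i
  proof -
    have "ip (nabla (br y (e i)) y) (e i) = (\<Sum>l\<in>I. ip (br y (e i)) (e l) * ip (nabla (e l) y) (e i))"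
      by (rule linear_functional_expand) (simp_all add: nabla_add nabla_scale ip_simps)
    moreover have "nabla (br (e i) y) y = - nabla (br y (e i)) y"
      using br_anti[of "e i" y] nabla_scale(1)[of "-1"] by simp
    ultimately show ?thesis by (simp add: A_def N_def ip_minus)
  qed
  have "ricci_tensor br ip y y
      = (\<Sum>i\<in>I. ip (nabla (e i) (nabla y y)) (e i)) - (\<Sum>i\<in>I. ip (nabla y (nabla (e i) y)) (e i))
        - (\<Sum>i\<in>I. ip (nabla (br (e i) y) y) (e i))"
    by (simp add: ricci_tensor_eq riemann_eq ip_diff sum_subtractf)
  also have "\<dots> = - (\<Sum>k\<in>I. (\<Sum>l\<in>I. ip (br (e k) (e l)) (e l)) * ip (br (e k) y) y)
      + (\<Sum>k\<in>I. \<Sum>l\<in>I. N k l * N k l + A k l * N k l + A k l * N l k)"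
    unfolding third second fourth by (simp add: sum.distrib sum_negf sum_subtractf)
  also have "(\<Sum>k\<in>I. \<Sum>l\<in>I. N k l * N k l + A k l * N k l + A k l * N l k)
      = (\<Sum>k\<in>I. \<Sum>l\<in>I. (W k l)\<^sup>2) / 4 - (\<Sum>k\<in>I. \<Sum>l\<in>I. (A k l + A l k)\<^sup>2) / 4"
  proof -
    let ?f = "\<lambda>k l. (A k l + A l k) * W k l / 2 - (A k l - A l k) * (A k l + A l k) / 2"
    have "N k l * N k l + A k l * N k l + A k l * N l k
        = (W k l)\<^sup>2 / 4 - (A k l + A l k)\<^sup>2 / 4 + ?f k l" for k l
      unfolding N W[of k l] by (simp add: power2_eq_square field_simps)
    then have "(\<Sum>k\<in>I. \<Sum>l\<in>I. N k l * N k l + A k l * N k l + A k l * N l k)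
      = (\<Sum>k\<in>I. \<Sum>l\<in>I. (W k l)\<^sup>2) / 4 - (\<Sum>k\<in>I. \<Sum>l\<in>I. (A k l + A l k)\<^sup>2) / 4 + (\<Sum>k\<in>I. \<Sum>l\<in>I. ?f k l)"
      by (simp add: sum.distrib sum_subtractf sum_divide_distrib)
    moreover have "(\<Sum>k\<in>I. \<Sum>l\<in>I. ?f k l) = 0"
    proof -
      \<comment> \<open>The remainder pairs symmetric matrices with antisymmetric ones.\<close>
      have f: "?f l k = - ?f k l" for k l
        unfolding W[of k l] by (simp add: field_simps)
      have "(\<Sum>k\<in>I. \<Sum>l\<in>I. ?f k l) = (\<Sum>k\<in>I. \<Sum>l\<in>I. ?f l k)" by (rule sum.swap)
      also have "\<dots> = (\<Sum>k\<in>I. \<Sum>l\<in>I. - ?f k l)" by (subst f) (rule refl)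
      also have "\<dots> = - (\<Sum>k\<in>I. \<Sum>l\<in>I. ?f k l)" by (simp only: sum_negf)
      finally show ?thesis by linarith
    qed
    ultimately show ?thesis by simp
  qed
  finally show ?thesis by (simp add: A_def W_def)
qed

lemma ip_ricci_operator_self:
  "ip (ricci_operator br ip x) x =
     ricci_form I (\<lambda>i j k. ip (br (e i) (e j)) (e k)) (\<lambda>i. ip x (e i))"
proof -
  have 1: "ip (br (e k) (e l)) x = (\<Sum>i\<in>I. ip (br (e k) (e l)) (e i) * ip x (e i))" for k l
    by (rule parseval)
  have 2: "ip (br x (e k)) (e l) + ip (br x (e l)) (e k)
      = (\<Sum>i\<in>I. ip x (e i) * (ip (br (e i) (e k)) (e l) + ip (br (e i) (e l)) (e k)))" for k l
    by (rule linear_functional_expand) (simp_all add: br_add br_scale ip_simps algebra_simps)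
  have 3: "ip (br (e k) x) x = (\<Sum>i\<in>I. \<Sum>j\<in>I. ip (br (e k) (e i)) (e j) * ip x (e i) * ip x (e j))" for k
  proof -
    have "ip (br (e k) x) x = (\<Sum>i\<in>I. ip x (e i) * ip (br (e k) (e i)) x)"
      by (rule linear_functional_expand[of "\<lambda>y. ip (br (e k) y) x"]) (simp_all add: br_add br_scale ip_simps)
    also have "\<dots> = (\<Sum>i\<in>I. \<Sum>j\<in>I. ip (br (e k) (e i)) (e j) * ip x (e i) * ip x (e j))"
      unfolding 1 sum_distrib_left by (simp add: mult_ac)
    finally show ?thesis .
  qed
  show ?thesis
    unfolding ip_ricci_operator ricci_tensor_frame ricci_form_def 1 2 3 ..
qed

end

section \<open>Degeneration to a graded bracket\<close>

lemma ricci_form_scale: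
  assumes "\<And>i. i \<in> I \<Longrightarrow> x i = s * y i"
  shows "ricci_form I c x = s\<^sup>2 * ricci_form I c y"
proof -
  have 1: "(\<Sum>i\<in>I. c k l i * x i)\<^sup>2 = s\<^sup>2 * (\<Sum>i\<in>I. c k l i * y i)\<^sup>2" for k l
    by (simp add: assms sum_distrib_left[symmetric] power_mult_distrib mult.left_commute cong: sum.cong)
  have 2: "(\<Sum>i\<in>I. x i * (c i k l + c i l k))\<^sup>2 = s\<^sup>2 * (\<Sum>i\<in>I. y i * (c i k l + c i l k))\<^sup>2" for k l
    by (simp add: assms sum_distrib_left[symmetric] power_mult_distrib mult.assoc cong: sum.cong)
  have 3: "(\<Sum>i\<in>I. \<Sum>j\<in>I. c k i j * x i * x j) = s\<^sup>2 * (\<Sum>i\<in>I. \<Sum>j\<in>I. c k i j * y i * y j)" for k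
    by (simp add: assms sum_distrib_left power2_eq_square mult_ac cong: sum.cong)
  show ?thesis
    unfolding ricci_form_def 1 2 3
    by (simp add: sum_distrib_left[symmetric] right_diff_distrib mult.left_commute)
qed

text \<open>By homogeneity, negativity need only be checked on the unit sphere, which is compact; so the
  tube lemma carries negativity at \<open>r = 0\<close> to a whole neighbourhood of \<open>0\<close>.\<close>

lemma ricci_form_negative_open:
  fixes c :: "real \<Rightarrow> 'i \<Rightarrow> 'i \<Rightarrow> 'i \<Rightarrow> real"
  assumes fin: "finite I"
    and cont: "\<And>i j k. continuous_on UNIV (\<lambda>r. c r i j k)"
    and neg: "\<And>x. \<exists>i\<in>I. x i \<noteq> 0 \<Longrightarrow> ricci_form I (c 0) x < 0"
  shows "\<exists>r>0. \<forall>x. (\<exists>i\<in>I. x i \<noteq> 0) \<longrightarrow> ricci_form I (c r) x < 0"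
proof -
  \<comment> \<open>Coordinates outside \<open>I\<close> do not affect \<open>ricci_form\<close>; fixing them at \<open>0\<close> makes the sphere compact.\<close>
  define K where "K = (PiE UNIV (\<lambda>i. if i \<in> I then {-1..1} else {0::real})) \<inter> {x. (\<Sum>i\<in>I. (x i)\<^sup>2) = 1}"
  have "compactin (product_topology (\<lambda>i. euclidean::real topology) UNIV)
      (PiE UNIV (\<lambda>i. if i \<in> I then {-1..1} else {0::real}))"
    unfolding compactin_PiE by auto
  then have "compact (PiE UNIV (\<lambda>i. if i \<in> I then {-1..1} else {0::real}))"
    unfolding euclidean_product_topology by simp
  moreover have "closed {x :: 'i \<Rightarrow> real. (\<Sum>i\<in>I. (x i)\<^sup>2) = 1}"
    by (intro closed_Collect_eq continuous_intros continuous_on_product_coordinates)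
  ultimately have K: "compact K" unfolding K_def by (rule compact_Int_closed)
  define W where "W = {p. ricci_form I (c (fst p)) (snd p) < 0}"
  have c1: "continuous_on UNIV (\<lambda>p :: real \<times> ('i \<Rightarrow> real). c (fst p) i j k)" for i j k
    by (rule continuous_on_compose2[OF cont continuous_on_fst]) (auto intro: continuous_intros)
  have c2: "continuous_on UNIV (\<lambda>p :: real \<times> ('i \<Rightarrow> real). snd p i)" for i
    by (rule continuous_on_compose2[OF continuous_on_product_coordinates continuous_on_snd])
      (auto intro: continuous_intros)
  have "open W"
    unfolding W_def ricci_form_def
    by (intro open_Collect_less continuous_intros c1 c2) auto
  moreover have "{0} \<times> K \<subseteq> W"
  proof -
    have "\<exists>i\<in>I. x i \<noteq> 0" if "x \<in> K" for x
    proof (rule ccontr)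
      assume "\<not> (\<exists>i\<in>I. x i \<noteq> 0)"
      then have "(\<Sum>i\<in>I. (x i)\<^sup>2) = 0" by simp
      then show False using that by (simp add: K_def)
    qed
    then show ?thesis using neg by (auto simp: W_def)
  qed
  ultimately obtain X0 where X0: "0 \<in> X0" "open X0" "X0 \<times> K \<subseteq> W"
    using Elementary_Topology.tube_lemma[OF K, of W 0] by blast
  obtain \<epsilon> where \<epsilon>: "\<epsilon> > 0" "ball 0 \<epsilon> \<subseteq> X0"
    using X0 open_contains_ball by blast
  have "ricci_form I (c (\<epsilon>/2)) x < 0" if x: "\<exists>i\<in>I. x i \<noteq> 0" for x
  proof -
    define s where "s = sqrt (\<Sum>i\<in>I. (x i)\<^sup>2)"
    have spos: "(\<Sum>i\<in>I. (x i)\<^sup>2) > 0" using x fin by (auto intro: sum_pos2)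
    have s: "s > 0" "s\<^sup>2 = (\<Sum>i\<in>I. (x i)\<^sup>2)" using spos by (auto simp: s_def)
    define y where "y i = (if i \<in> I then x i / s else 0)" for i
    have y1: "(\<Sum>i\<in>I. (y i)\<^sup>2) = 1"
      using s spos by (simp add: y_def power_divide sum_divide_distrib[symmetric] cong: sum.cong)
    have "y i \<in> {-1..1}" if "i \<in> I" for i
    proof -
      have "(y i)\<^sup>2 \<le> (\<Sum>i\<in>I. (y i)\<^sup>2)" using that fin by (intro member_le_sum) auto
      then have "\<bar>y i\<bar> \<le> 1" using y1 by (simp add: abs_square_le_1)
      then show ?thesis by (simp add: abs_le_iff)
    qed
    moreover have "y i = 0" if "i \<notin> I" for i using that by (simp add: y_def)
    ultimately have "y \<in> K" using y1 by (simp add: K_def PiE_def Pi_def)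
    moreover have "\<epsilon>/2 \<in> X0" using \<epsilon> by (auto simp: subset_eq)
    ultimately have "ricci_form I (c (\<epsilon>/2)) y < 0" using X0(3) by (auto simp: W_def)
    moreover have "ricci_form I (c (\<epsilon>/2)) x = s\<^sup>2 * ricci_form I (c (\<epsilon>/2)) y"
      by (rule ricci_form_scale) (use s in \<open>simp add: y_def\<close>)
    ultimately show ?thesis using s(1) by (simp add: mult_pos_neg)
  qed
  then show ?thesis using \<epsilon>(1) by (intro exI[of _ "\<epsilon>/2"]) auto
qed

text \<open>If every nonzero \<open>c i j k\<close> satisfies \<open>d k \<le> d i + d j\<close>, this is the limit, as \<open>r \<rightarrow> 0\<close>, of the
  structure constants in the basis of the \<open>(r ^ d b / \<kappa> b) *\<^sub>R b\<close>.\<close>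

definition graded_part ::
  "('b \<Rightarrow> nat) \<Rightarrow> ('b \<Rightarrow> real) \<Rightarrow> ('b \<Rightarrow> 'b \<Rightarrow> 'b \<Rightarrow> real) \<Rightarrow> 'b \<Rightarrow> 'b \<Rightarrow> 'b \<Rightarrow> real" where
  "graded_part d \<kappa> c i j k = (if d k = d i + d j then c i j k * \<kappa> k / (\<kappa> i * \<kappa> j) else 0)"

text \<open>Declaring the rescaled basis to be orthonormal gives a metric whose Ricci form is close to that of
  the graded bracket when \<open>r\<close> is small.\<close>

lemma ex_negative_ricci_if_graded:
  fixes br :: "'a::real_vector \<Rightarrow> 'a \<Rightarrow> 'a" and d :: "'a \<Rightarrow> nat"
  assumes lie: "lie_algebra scaleR (UNIV :: 'a set) br"
    and B: "finite B" "independent B" "span B = UNIV"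
  defines "c \<equiv> \<lambda>i j k. representation B (br i j) k"
  assumes \<kappa>: "\<And>b. \<kappa> b > 0"
    and filt: "\<And>i j k. i \<in> B \<Longrightarrow> j \<in> B \<Longrightarrow> k \<in> B \<Longrightarrow> c i j k \<noteq> 0 \<Longrightarrow> d k \<le> d i + d j"
    and neg: "\<And>x. \<exists>i\<in>B. x i \<noteq> 0 \<Longrightarrow> ricci_form B (graded_part d \<kappa> c) x < 0"
  shows "\<exists>ip. inner_product_on (UNIV :: 'a set) ip \<and> negative_ricci br ip"
proof -
  \<comment> \<open>The structure constants in the rescaled basis, written as polynomials in \<open>r\<close>, so that \<open>r = 0\<close> is
     allowed; there \<open>0 ^ 0 = 1\<close> yields exactly the graded part.\<close>
  define C where "C r i j k = (if d k \<le> d i + d j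
      then c i j k * \<kappa> k / (\<kappa> i * \<kappa> j) * r ^ (d i + d j - d k) else 0)" for r i j k
  have "C 0 = graded_part d \<kappa> c"
    by (intro ext) (auto simp: C_def graded_part_def power_0_left)
  moreover have "continuous_on UNIV (\<lambda>r. C r i j k)" for i j k
    using \<kappa>[of i] \<kappa>[of j]
    by (cases "d k \<le> d i + d j") (auto simp: C_def intro!: continuous_intros)
  ultimately obtain r where r: "r > 0" "\<And>x. \<exists>i\<in>B. x i \<noteq> 0 \<Longrightarrow> ricci_form B (C r) x < 0"
    using ricci_form_negative_open[OF B(1), of C] neg by auto
  define w where "w b = \<kappa> b / r ^ d b" for b
  have w: "w b > 0" for b using \<kappa> r(1) by (simp add: w_def)
  define rep where "rep = representation B"
  define ip where "ip x y = (\<Sum>b\<in>B. (w b)\<^sup>2 * rep x b * rep y b)" for x y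
  define e where "e b = (1 / w b) *\<^sub>R b" for b
  have rep_add: "rep (x + y) b = rep x b + rep y b" and rep_scale: "rep (a *\<^sub>R x) b = a * rep x b"
    for a x y b using B by (simp_all add: rep_def representation_add representation_scale)
  have rep_basis: "rep b b' = (if b' = b then 1 else 0)" if "b \<in> B" for b b'
    using representation_basis[OF B(2) that] by (simp add: rep_def)
  have expand: "(\<Sum>b\<in>B. rep x b *\<^sub>R b) = x" for x
    unfolding rep_def by (rule sum_representation_eq) (use B in auto)
  have ip_e: "ip x (e b) = w b * rep x b" if "b \<in> B" for x b
  proof -
    have "ip x (e b) = (\<Sum>b'\<in>B. if b' = b then (w b)\<^sup>2 * rep x b * (1 / w b) else 0)"
      unfolding ip_def e_def rep_scale rep_basis[OF that] by (intro sum.cong) auto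
    then show ?thesis using that B(1) w[of b] by (simp add: power2_eq_square)
  qed
  have ip: "inner_product_on UNIV ip"
    unfolding inner_product_on_def
  proof (intro conjI ballI allI impI)
    fix x :: 'a assume "x \<noteq> 0"
    have "\<exists>b\<in>B. rep x b \<noteq> 0"
    proof (rule ccontr)
      assume "\<not> ?thesis"
      then have "(\<Sum>b\<in>B. rep x b *\<^sub>R b) = 0" by simp
      then show False using expand[of x] \<open>x \<noteq> 0\<close> by simp
    qed
    then obtain b where b: "b \<in> B" "rep x b \<noteq> 0" by blast
    have "(\<Sum>b\<in>B. (w b * rep x b)\<^sup>2) > 0"
      using b w[of b] B(1) by (intro sum_pos2[of B b]) auto
    then show "ip x x > 0" by (simp add: ip_def power2_eq_square mult_ac)
  qed (simp_all add: ip_def rep_add rep_scale sum.distrib sum_distrib_left algebra_simps)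
  have frame: "orthonormal_basis ip B e UNIV"
    unfolding orthonormal_basis_def
  proof (intro conjI ballI)
    fix i j assume "i \<in> B" "j \<in> B"
    then show "ip (e i) (e j) = (if i = j then 1 else 0)"
      using w[of j] by (simp add: ip_e e_def[of i] rep_scale rep_basis)
  next
    have "B \<subseteq> span (e ` B)"
    proof
      fix b assume "b \<in> B"
      then have "w b *\<^sub>R e b \<in> span (e ` B)" by (intro span_scale span_base) simp
      then show "b \<in> span (e ` B)" using w[of b] by (simp add: e_def)
    qed
    then show "span (e ` B) = UNIV"
      using B(3) span_minimal[OF _ subspace_span] by blast
  qed (rule B(1))
  interpret M: metric_lie_algebra br ip B e
    by (intro metric_lie_algebra.intro real_lie_algebra.intro metric_lie_algebra_axioms.intro)
      (fact lie, fact ip, fact frame)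
  have C: "ip (br (e i) (e j)) (e k) = C r i j k" if "i \<in> B" "j \<in> B" "k \<in> B" for i j k
  proof -
    have "ip (br (e i) (e j)) (e k) = w k / (w i * w j) * c i j k"
      using that unfolding e_def[of i] e_def[of j] M.br_scale
      by (simp add: M.ip_simps ip_e c_def rep_def)
    also have "\<dots> = C r i j k"
    proof (cases "c i j k = 0")
      case False
      then have le: "d k \<le> d i + d j" using filt that by blast
      then have "r ^ (d i + d j) = r ^ (d i + d j - d k) * r ^ d k"
        by (simp flip: power_add)
      then have "r ^ d i * r ^ d j / r ^ d k = r ^ (d i + d j - d k)"
        using r(1) by (simp add: power_add)
      then have "w k / (w i * w j) = \<kappa> k / (\<kappa> i * \<kappa> j) * r ^ (d i + d j - d k)"
        using \<kappa>[of i] \<kappa>[of j] r(1) by (simp add: w_def field_simps)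
      then show ?thesis using le by (simp add: C_def)
    qed (simp add: C_def)
    finally show ?thesis .
  qed
  have "ip (ricci_operator br ip x) x < 0" if "x \<noteq> 0" for x
  proof -
    have "\<exists>i\<in>B. ip x (e i) \<noteq> 0"
    proof (rule ccontr)
      assume "\<not> ?thesis"
      then show False using M.expand[of x] that by simp
    qed
    moreover have "ricci_form B (\<lambda>i j k. ip (br (e i) (e j)) (e k)) y = ricci_form B (C r) y" for y
      unfolding ricci_form_def by (simp add: C cong: sum.cong)
    ultimately show ?thesis
      unfolding M.ip_ricci_operator_self using r(2) by simp
  qed
  then show ?thesis using ip unfolding negative_ricci_def by blast
qed

section \<open>Negativity of the graded bracket\<close>

text \<open>The scales are \<open>1 / \<mu>\<close> for \<open>Z\<close>, \<open>\<mu>\<close> for the other vectors of degree \<open>0\<close>, and \<open>1\<close> in positive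
  degree, with \<open>\<mu>\<close> large. In the Ricci form of the graded bracket \<open>g\<close>, pair the square of
  \<open>E k l = \<Sum>i. g k l i * x i\<close>, which enters positively, with the square of twice the symmetric part
  \<open>A k l\<close> of \<open>ad x\<close>, which enters negatively. If \<open>Z\<close> is one of \<open>k\<close> and \<open>l\<close>, the two cancel. Otherwise
  \<open>(E k l)\<^sup>2\<close> is at most a constant times \<open>sp / \<mu>\<^sup>2 + sn\<close>, where \<open>sp\<close> and \<open>sn\<close> are the square norms of
  the components of \<open>x\<close> of degree \<open>1\<close> and of degree at least \<open>2\<close>. Three kinds of blocks of \<open>A\<close>
  are kept: those in degree \<open>1\<close> detect the torus by \<open>nonskew\<close>, those from degree \<open>2\<close> to \<open>3\<close> give the
  form \<open>\<Sum>p. Q p * (x p)\<^sup>2\<close>, which beats \<open>sp / \<mu>\<^sup>2\<close>, and the diagonal ones detect \<open>Z\<close>. The mean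
  curvature points along \<open>Z\<close> and contributes \<open>- \<mu>\<^sup>2 * \<tau> * (\<Sum>n. \<gamma> n * (x n)\<^sup>2)\<close>, which beats \<open>sn\<close>.\<close>

lemma ex_weights_ricci_form_graded_negative:
  fixes c :: "'b \<Rightarrow> 'b \<Rightarrow> 'b \<Rightarrow> real" and d :: "'b \<Rightarrow> nat"
  assumes fin: "finite I" and ZI: "Z \<in> I" and dZ: "d Z = 0"
    and anti: "\<And>i j k. i \<in> I \<Longrightarrow> j \<in> I \<Longrightarrow> k \<in> I \<Longrightarrow> c j i k = - c i j k"
    and Z_low: "\<And>j k. j \<in> I \<Longrightarrow> k \<in> I \<Longrightarrow> d j \<le> 1 \<Longrightarrow> c Z j k = 0"
    and Z_high: "\<And>j k. j \<in> I \<Longrightarrow> k \<in> I \<Longrightarrow> d j \<ge> 2 \<Longrightarrow> c Z j k = (if k = j then \<gamma> j else 0)"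
    and deg00: "\<And>i j k. i \<in> I \<Longrightarrow> j \<in> I \<Longrightarrow> k \<in> I \<Longrightarrow> d i = 0 \<Longrightarrow> d j = 0 \<Longrightarrow> c i j k = 0"
    and trace0: "\<And>i. i \<in> I \<Longrightarrow> i \<noteq> Z \<Longrightarrow> d i = 0 \<Longrightarrow> (\<Sum>l\<in>I. c i l l) = 0"
    and nonskew: "\<And>y. \<lbrakk>\<And>h. y h \<noteq> 0 \<Longrightarrow> d h = 0 \<and> h \<noteq> Z;
       \<And>k l. k \<in> I \<Longrightarrow> l \<in> I \<Longrightarrow> d k = 1 \<Longrightarrow> d l = 1 \<Longrightarrow> (\<Sum>h\<in>I. y h * (c h k l + c h l k)) = 0\<rbrakk>
       \<Longrightarrow> \<forall>h\<in>I. y h = 0"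
    and orth: "\<And>p q. p \<in> I \<Longrightarrow> q \<in> I \<Longrightarrow> d p = 1 \<Longrightarrow> d q = 1 \<Longrightarrow> p \<noteq> q \<Longrightarrow>
       (\<Sum>k\<in>{k \<in> I. d k = 2}. \<Sum>l\<in>{l \<in> I. d l = 3}. c p k l * c q k l) = 0"
    and nonzero: "\<And>p. p \<in> I \<Longrightarrow> d p = 1 \<Longrightarrow> \<exists>k\<in>I. \<exists>l\<in>I. d k = 2 \<and> d l = 3 \<and> c p k l \<noteq> 0"
    and \<gamma>: "\<And>j. j \<in> I \<Longrightarrow> d j \<ge> 2 \<Longrightarrow> \<gamma> j > 0" and ex_high: "\<exists>j\<in>I. d j \<ge> 2"
  shows "\<exists>\<kappa>. (\<forall>b. \<kappa> b > 0) \<and>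
    (\<forall>x. (\<exists>i\<in>I. x i \<noteq> 0) \<longrightarrow> ricci_form I (graded_part d \<kappa> c) x < 0)"
proof -
  define U where "U = {k \<in> I. d k = 2}"
  define V where "V = {l \<in> I. d l = 3}"
  define P where "P = {i \<in> I. d i = 1}"
  define N where "N = {i \<in> I. d i \<ge> 2}"
  have sub: "U \<subseteq> I" "V \<subseteq> I" "P \<subseteq> I" "N \<subseteq> I" by (auto simp: U_def V_def P_def N_def)
  have finite: "finite U" "finite V" "finite P" "finite N"
    using sub fin finite_subset by blast+
  define Q where "Q p = (\<Sum>k\<in>U. \<Sum>l\<in>V. (c p k l)\<^sup>2)" for p
  define S where "S k l = (\<Sum>i\<in>I. (c k l i)\<^sup>2)" for k l
  define T where "T = (\<Sum>k\<in>I. \<Sum>l\<in>I. S k l)"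
  define \<tau> where "\<tau> = (\<Sum>n\<in>N. \<gamma> n)"
  have T: "T \<ge> 0" by (simp add: T_def S_def sum_nonneg)
  have S: "S k l \<ge> 0" for k l by (simp add: S_def sum_nonneg)
  have Qpos: "Q p > 0" if "p \<in> P" for p
  proof -
    have "p \<in> I" "d p = 1" using that by (simp_all add: P_def)
    from nonzero[OF this] obtain k l where kl: "k \<in> U" "l \<in> V" "c p k l \<noteq> 0"
      unfolding U_def V_def by blast
    have "(\<Sum>l\<in>V. (c p k l)\<^sup>2) > 0" using kl finite by (intro sum_pos2[of V l]) auto
    then show ?thesis
      unfolding Q_def using kl finite by (intro sum_pos2[of U k]) (auto intro: sum_nonneg)
  qed
  have \<gamma>N: "\<gamma> n > 0" if "n \<in> N" for n using \<gamma> that by (auto simp: N_def)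
  have \<tau>: "\<tau> > 0"
    unfolding \<tau>_def using ex_high finite \<gamma>N by (intro sum_pos) (auto simp: N_def)
  \<comment> \<open>As \<open>\<mu> \<le> \<mu>\<^sup>2\<close>, this choice makes \<open>\<mu>\<^sup>2\<close> exceed each summand, hence the bounds \<open>\<mu>P\<close> and \<open>\<mu>N\<close>.\<close>
  define \<mu> where "\<mu> = 1 + (\<Sum>p\<in>P. T / Q p) + (\<Sum>n\<in>N. T / (4 * \<tau> * \<gamma> n))"
  have nn: "(\<Sum>p\<in>P. T / Q p) \<ge> 0" "(\<Sum>n\<in>N. T / (4 * \<tau> * \<gamma> n)) \<ge> 0"
    using T Qpos \<tau> \<gamma>N by (auto intro!: sum_nonneg divide_nonneg_nonneg mult_nonneg_nonneg simp: less_imp_le)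
  then have \<mu>: "\<mu> \<ge> 1" by (simp add: \<mu>_def)
  then have \<mu>2: "\<mu> \<le> \<mu>\<^sup>2" by (simp add: power2_eq_square)
  have \<mu>P: "T / \<mu>\<^sup>2 < Q p" if "p \<in> P" for p
  proof -
    have "T / Q p \<le> (\<Sum>p\<in>P. T / Q p)"
      using that finite T Qpos by (intro member_le_sum) (auto simp: less_imp_le)
    then have "T / Q p < \<mu>\<^sup>2" using nn \<mu>2 by (simp add: \<mu>_def)
    then show ?thesis using Qpos[OF that] \<mu> by (simp add: field_simps)
  qed
  have \<mu>N: "T < 4 * \<mu>\<^sup>2 * \<tau> * \<gamma> n" if "n \<in> N" for n
  proof -
    have "T / (4 * \<tau> * \<gamma> n) \<le> (\<Sum>n\<in>N. T / (4 * \<tau> * \<gamma> n))"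
      using that finite T \<tau> \<gamma>N by (intro member_le_sum) (auto simp: less_imp_le)
    then have "T / (4 * \<tau> * \<gamma> n) < \<mu>\<^sup>2" using nn \<mu>2 by (simp add: \<mu>_def)
    then show ?thesis using \<gamma>N[OF that] \<tau> by (simp add: field_simps)
  qed
  define \<kappa> where "\<kappa> b = (if b = Z then 1 / \<mu> else if d b = 0 then \<mu> else 1)" for b
  have \<kappa>pos: "\<kappa> b > 0" for b using \<mu> by (auto simp: \<kappa>_def)
  define g where "g = graded_part d \<kappa> c"
  have g0: "g i j k = 0" if "d k \<noteq> d i + d j" for i j k
    using that by (simp add: g_def graded_part_def)
  have g_anti: "g j i k = - g i j k" if "i \<in> I" "j \<in> I" "k \<in> I" for i j k
    using anti[OF that] by (simp add: g_def graded_part_def add.commute mult.commute)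
  have gZ: "g Z j k = (if k = j \<and> j \<in> N then \<mu> * \<gamma> j else 0)" if "j \<in> I" "k \<in> I" for j k
  proof (cases "d j \<ge> 2")
    case True
    then have "\<kappa> j = 1" using dZ by (auto simp: \<kappa>_def)
    then show ?thesis
      using True that dZ \<mu> by (auto simp: g_def graded_part_def Z_high N_def \<kappa>_def)
  next
    case False
    then show ?thesis using that by (auto simp: g_def graded_part_def Z_low N_def)
  qed
  have g_high: "g i j k = 0" if "i \<in> I" "j \<in> I" "d i = 0" "d j = 0" "k \<in> I" for i j k
    using deg00[of i j k] that by (simp add: g_def graded_part_def)
  have g_toZ: "g i j Z = 0" if "i \<in> I" "j \<in> I" for i j
  proof (cases "d i + d j = 0")
    case True
    then show ?thesis using g_high[of i j Z] that ZI by simp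
  next
    case False
    then show ?thesis using g0[of Z i j] dZ by simp
  qed
  have g_bound: "(g i j k)\<^sup>2 \<le> (c i j k)\<^sup>2" if "i \<in> I" "j \<in> I" "k \<in> I" "i \<noteq> Z" "j \<noteq> Z" for i j k
  proof (cases "d k = d i + d j \<and> d k \<noteq> 0")
    case True
    then have k: "\<kappa> k = 1" using dZ by (auto simp: \<kappa>_def)
    have "\<kappa> i * \<kappa> j \<ge> 1 * 1" using \<mu> that by (intro mult_mono) (auto simp: \<kappa>_def)
    then have m: "(\<kappa> i * \<kappa> j)\<^sup>2 \<ge> 1" by (intro one_le_power) simp
    have "g i j k = c i j k / (\<kappa> i * \<kappa> j)" using True k by (simp add: g_def graded_part_def)
    then have "(g i j k)\<^sup>2 = (c i j k)\<^sup>2 / (\<kappa> i * \<kappa> j)\<^sup>2" by (simp only: power_divide)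
    also have "\<dots> \<le> (c i j k)\<^sup>2 / 1" using m by (intro divide_left_mono) auto
    finally show ?thesis by simp
  next
    case False
    have "g i j k = 0"
    proof (cases "d k = d i + d j")
      case True
      then have "d i = 0" "d j = 0" using False by auto
      then show ?thesis using g_high that by simp
    qed (rule g0)
    then show ?thesis by simp
  qed
  have g_bound1: "(g i j k)\<^sup>2 \<le> (c i j k)\<^sup>2 / \<mu>\<^sup>2"
    if "i \<noteq> Z" "j \<noteq> Z" "d i + d j = 1" for i j k
  proof (cases "d k = 1")
    case True
    then have k: "\<kappa> k = 1" using dZ by (auto simp: \<kappa>_def)
    have "d i = 0 \<and> d j = 1 \<or> d i = 1 \<and> d j = 0" using that(3) by arith
    then have "\<kappa> i * \<kappa> j = \<mu>" using that by (auto simp: \<kappa>_def)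
    then show ?thesis
      using True k that(3) by (simp add: g_def graded_part_def power_divide)
  next
    case False
    then show ?thesis using g0 that(3) by simp
  qed
  have neg: "ricci_form I g x < 0" if x: "\<exists>i\<in>I. x i \<noteq> 0" for x
  proof -
    define E where "E k l = (\<Sum>i\<in>I. g k l i * x i)" for k l
    define A where "A k l = (\<Sum>i\<in>I. x i * (g i k l + g i l k))" for k l
    define xh where "xh i = (if d i = 0 \<and> i \<noteq> Z then x i else 0)" for i
    define F where "F k l = (\<Sum>h\<in>I. xh h * (c h k l + c h l k))" for k l
    define sp where "sp = (\<Sum>i\<in>P. (x i)\<^sup>2)"
    define sn where "sn = (\<Sum>i\<in>N. (x i)\<^sup>2)"
    \<comment> \<open>An upper bound for \<open>(E k l)\<^sup>2 - (A k l)\<^sup>2\<close> in which all but the three useful kinds of entries of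
       \<open>A\<close> have been dropped.\<close>
    define b where "b k l = S k l * (sp / \<mu>\<^sup>2 + sn)
        - (if k \<in> P then if l \<in> P then (F k l)\<^sup>2 / \<mu>\<^sup>2 else 0 else 0)
        - (if k \<in> U then if l \<in> V then (\<Sum>p\<in>P. x p * c p k l)\<^sup>2 else 0 else 0)
        - (if l = k then if k \<in> N then (A k k)\<^sup>2 else 0 else 0)" for k l
    have spn: "sp \<ge> 0" "sn \<ge> 0" by (auto simp: sp_def sn_def sum_nonneg)
    have A_sym: "A k l = A l k" for k l by (simp add: A_def add.commute)
    have E_anti: "(E l k)\<^sup>2 = (E k l)\<^sup>2" if "k \<in> I" "l \<in> I" for k l
    proof -
      have "E l k = - E k l"
        unfolding E_def using g_anti[OF that] by (simp add: sum_negf cong: sum.cong)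
      then show ?thesis by simp
    qed
    have Z_cancel: "(E Z l)\<^sup>2 = (A Z l)\<^sup>2" if l: "l \<in> I" for l
    proof -
      have "A Z l = (\<Sum>i\<in>I. x i * g i Z l)"
        unfolding A_def using g_toZ l by (simp cong: sum.cong)
      also have "\<dots> = (\<Sum>i\<in>I. - (g Z l i * x i))"
      proof (rule sum.cong[OF refl])
        fix i assume i: "i \<in> I"
        have "g i Z l = - g Z i l" using g_anti[OF ZI i l] .
        also have "g Z i l = g Z l i" using gZ i l by auto
        finally show "x i * g i Z l = - (g Z l i * x i)" by simp
      qed
      finally have "A Z l = - E Z l" by (simp add: E_def sum_negf)
      then show ?thesis by simp
    qed
    have E_bound: "(E k l)\<^sup>2 \<le> S k l * (sp / \<mu>\<^sup>2 + sn)"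
      if kl: "k \<in> I" "l \<in> I" "k \<noteq> Z" "l \<noteq> Z" for k l
    proof -
      let ?y = "\<lambda>i. if d i = d k + d l then x i else 0"
      have "E k l = (\<Sum>i\<in>I. g k l i * ?y i)"
        unfolding E_def using g0 by (intro sum.cong) auto
      then have CS: "(E k l)\<^sup>2 \<le> (\<Sum>i\<in>I. (g k l i)\<^sup>2) * (\<Sum>i\<in>I. (?y i)\<^sup>2)"
        using Cauchy_Schwarz_ineq_sum by metis
      have y_nonneg: "(\<Sum>i\<in>I. (?y i)\<^sup>2) \<ge> 0" by (simp add: sum_nonneg)
      consider "d k + d l = 0" | "d k + d l = 1" | "d k + d l \<ge> 2" by linarith
      then show ?thesis
      proof cases
        case 1
        then have "E k l = 0" unfolding E_def using g_high kl by simp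
        then show ?thesis using S spn by simp
      next
        case 2
        have "(\<Sum>i\<in>I. (g k l i)\<^sup>2) \<le> S k l / \<mu>\<^sup>2"
          unfolding S_def sum_divide_distrib using g_bound1[OF kl(3,4) 2] by (intro sum_mono)
        moreover have "(\<Sum>i\<in>I. (?y i)\<^sup>2) = sp"
          unfolding sp_def P_def sum.inter_filter[OF fin] using 2 by (intro sum.cong) auto
        ultimately have "(E k l)\<^sup>2 \<le> S k l / \<mu>\<^sup>2 * sp"
          using CS mult_right_mono[of _ "S k l / \<mu>\<^sup>2" sp] spn by fastforce
        moreover have "S k l * sn \<ge> 0" using S spn by simp
        ultimately show ?thesis by (simp add: distrib_left)
      next
        case 3
        have "(\<Sum>i\<in>I. (g k l i)\<^sup>2) \<le> S k l"
          unfolding S_def using g_bound kl by (intro sum_mono) auto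
        moreover have "(\<Sum>i\<in>I. (?y i)\<^sup>2) \<le> sn"
          unfolding sn_def N_def sum.inter_filter[OF fin] using 3 by (intro sum_mono) auto
        ultimately have "(E k l)\<^sup>2 \<le> S k l * sn"
          using CS mult_mono[OF _ _ S y_nonneg] by fastforce
        moreover have "S k l * (sp / \<mu>\<^sup>2) \<ge> 0" using S spn by simp
        ultimately show ?thesis by (simp add: distrib_left)
      qed
    qed
    have A_P: "A k l = F k l / \<mu>" if "k \<in> P" "l \<in> P" for k l
    proof -
      have kl: "k \<in> I" "l \<in> I" "d k = 1" "d l = 1" using that by (auto simp: P_def)
      then have \<kappa>kl: "\<kappa> k = 1" "\<kappa> l = 1" using dZ by (auto simp: \<kappa>_def)
      have "x i * (g i k l + g i l k) = xh i * (c i k l + c i l k) / \<mu>" if i: "i \<in> I" for i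
      proof (cases "i = Z")
        case True
        then show ?thesis using gZ kl by (auto simp: xh_def N_def)
      next
        case False
        then show ?thesis
          using kl \<kappa>kl g0 by (auto simp: xh_def g_def graded_part_def \<kappa>_def add_divide_distrib distrib_left)
      qed
      then show ?thesis unfolding A_def F_def by (simp add: sum_divide_distrib)
    qed
    have A_UV: "A k l = (\<Sum>p\<in>P. x p * c p k l)" if "k \<in> U" "l \<in> V" for k l
    proof -
      have kl: "k \<in> I" "l \<in> I" "d k = 2" "d l = 3" using that by (auto simp: U_def V_def)
      then have \<kappa>kl: "\<kappa> k = 1" "\<kappa> l = 1" using dZ by (auto simp: \<kappa>_def)
      have "x i * (g i k l + g i l k) = (if d i = 1 then x i * c i k l else 0)" for i
        using kl \<kappa>kl dZ by (auto simp: g_def graded_part_def \<kappa>_def)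
      then show ?thesis unfolding A_def P_def sum.inter_filter[OF fin] by simp
    qed
    have pointwise: "(E k l)\<^sup>2 - (A k l)\<^sup>2 \<le> b k l" if kl: "k \<in> I" "l \<in> I" for k l
    proof (cases "k = Z \<or> l = Z")
      case True
      then have "(E k l)\<^sup>2 = (A k l)\<^sup>2"
        using Z_cancel[OF kl(1)] Z_cancel[OF kl(2)] E_anti[OF ZI kl(1)] A_sym by auto
      moreover have "b k l \<ge> 0"
      proof -
        have "b k l = S k l * (sp / \<mu>\<^sup>2 + sn)"
          using True dZ by (auto simp: b_def P_def U_def V_def N_def)
        then show ?thesis using S spn by simp
      qed
      ultimately show ?thesis by simp
    next
      case False
      have "- (A k l)\<^sup>2 \<le> b k l - S k l * (sp / \<mu>\<^sup>2 + sn)"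
      proof -
        consider "k \<in> P \<and> l \<in> P" | "k \<in> U \<and> l \<in> V" | "l = k \<and> k \<in> N"
          | "\<not> (k \<in> P \<and> l \<in> P)" "\<not> (k \<in> U \<and> l \<in> V)" "\<not> (l = k \<and> k \<in> N)" by blast
        then show ?thesis
        proof cases
          case 1
          then have "b k l - S k l * (sp / \<mu>\<^sup>2 + sn) = - ((F k l)\<^sup>2 / \<mu>\<^sup>2)"
            by (auto simp: b_def P_def U_def N_def)
          then show ?thesis using A_P 1 by (simp add: power_divide)
        next
          case 2
          then have "b k l - S k l * (sp / \<mu>\<^sup>2 + sn) = - (\<Sum>p\<in>P. x p * c p k l)\<^sup>2"
            by (auto simp: b_def P_def U_def V_def N_def)
          then show ?thesis using A_UV 2 by simp
        next
          case 3
          then have "b k l - S k l * (sp / \<mu>\<^sup>2 + sn) = - (A k k)\<^sup>2"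
            by (auto simp: b_def P_def U_def V_def N_def)
          then show ?thesis using 3 by simp
        next
          case 4
          then have "b k l - S k l * (sp / \<mu>\<^sup>2 + sn) = 0" by (auto simp: b_def)
          then show ?thesis by simp
        qed
      qed
      then show ?thesis using E_bound[of k l] kl False by auto
    qed
    define H where "H = (\<Sum>k\<in>P. \<Sum>l\<in>P. (F k l)\<^sup>2)"
    define D where "D = (\<Sum>k\<in>N. (A k k)\<^sup>2)"
    have restrict: "(\<Sum>k\<in>I. if k \<in> X then f k else 0) = (\<Sum>k\<in>X. f k)" if "X \<subseteq> I"
      for X and f :: "'b \<Rightarrow> real"
      using sum.inter_restrict[OF fin, of f X] that by (simp add: Int_absorb1)
    have restrict2: "(\<Sum>k\<in>I. \<Sum>l\<in>I. if k \<in> X then if l \<in> Y then f k l else 0 else 0)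
        = (\<Sum>k\<in>X. \<Sum>l\<in>Y. f k l)" if "X \<subseteq> I" "Y \<subseteq> I" for X Y and f :: "'b \<Rightarrow> 'b \<Rightarrow> real"
    proof -
      have "(\<Sum>l\<in>I. if k \<in> X then if l \<in> Y then f k l else 0 else 0)
          = (if k \<in> X then \<Sum>l\<in>Y. f k l else 0)" for k
        using restrict[OF that(2), of "f k"] by simp
      then show ?thesis using restrict[OF that(1), of "\<lambda>k. \<Sum>l\<in>Y. f k l"] by simp
    qed
    \<comment> \<open>Expanding the square, the mixed terms vanish by \<open>orth\<close>.\<close>
    have Q_eq: "(\<Sum>k\<in>U. \<Sum>l\<in>V. (\<Sum>p\<in>P. x p * c p k l)\<^sup>2) = (\<Sum>p\<in>P. Q p * (x p)\<^sup>2)"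
    proof -
      have "(\<Sum>k\<in>U. \<Sum>l\<in>V. (\<Sum>p\<in>P. x p * c p k l)\<^sup>2)
          = (\<Sum>k\<in>U. \<Sum>l\<in>V. \<Sum>p\<in>P. \<Sum>q\<in>P. x p * x q * (c p k l * c q k l))"
        by (simp add: power2_eq_square sum_product mult_ac)
      also have "\<dots> = (\<Sum>k\<in>U. \<Sum>p\<in>P. \<Sum>l\<in>V. \<Sum>q\<in>P. x p * x q * (c p k l * c q k l))"
        by (subst sum.swap[of _ P V]) (rule refl)
      also have "\<dots> = (\<Sum>p\<in>P. \<Sum>k\<in>U. \<Sum>q\<in>P. \<Sum>l\<in>V. x p * x q * (c p k l * c q k l))"
        by (subst sum.swap[of _ P U], subst sum.swap[of _ P V]) (rule refl)
      also have "\<dots> = (\<Sum>p\<in>P. \<Sum>q\<in>P. x p * x q * (\<Sum>k\<in>U. \<Sum>l\<in>V. c p k l * c q k l))"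
        by (subst sum.swap[of _ P U]) (simp add: sum_distrib_left)
      also have "\<dots> = (\<Sum>p\<in>P. \<Sum>q\<in>P. if q = p then Q p * (x p)\<^sup>2 else 0)"
        using orth by (intro sum.cong refl) (auto simp: P_def U_def V_def Q_def power2_eq_square mult_ac)
      finally show ?thesis using finite by simp
    qed
    have diag: "(\<Sum>k\<in>I. \<Sum>l\<in>I. if l = k then if k \<in> N then (A k k)\<^sup>2 else 0 else 0) = D"
      unfolding D_def using restrict[OF sub(4), of "\<lambda>k. (A k k)\<^sup>2"] fin by (simp cong: sum.cong)
    have "(\<Sum>k\<in>I. \<Sum>l\<in>I. (E k l)\<^sup>2) - (\<Sum>k\<in>I. \<Sum>l\<in>I. (A k l)\<^sup>2) \<le> (\<Sum>k\<in>I. \<Sum>l\<in>I. b k l)"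
      unfolding sum_subtractf[symmetric] by (intro sum_mono pointwise)
    also have "(\<Sum>k\<in>I. \<Sum>l\<in>I. b k l)
        = T * (sp / \<mu>\<^sup>2 + sn) - H / \<mu>\<^sup>2 - (\<Sum>p\<in>P. Q p * (x p)\<^sup>2) - D"
      unfolding b_def sum_subtractf restrict2[OF sub(3) sub(3)] restrict2[OF sub(1) sub(2)] Q_eq diag
      by (simp add: T_def H_def sum_distrib_right sum_divide_distrib)
    finally have squares: "(\<Sum>k\<in>I. \<Sum>l\<in>I. (E k l)\<^sup>2) - (\<Sum>k\<in>I. \<Sum>l\<in>I. (A k l)\<^sup>2)
        \<le> T * (sp / \<mu>\<^sup>2 + sn) - H / \<mu>\<^sup>2 - (\<Sum>p\<in>P. Q p * (x p)\<^sup>2) - D" .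
    have mean: "(\<Sum>k\<in>I. (\<Sum>l\<in>I. g k l l) * (\<Sum>i\<in>I. \<Sum>j\<in>I. g k i j * x i * x j))
        = \<mu>\<^sup>2 * \<tau> * (\<Sum>n\<in>N. \<gamma> n * (x n)\<^sup>2)"
    proof -
      have tr: "(\<Sum>l\<in>I. g k l l) = (if k = Z then \<mu> * \<tau> else 0)" if k: "k \<in> I" for k
      proof (cases "k = Z")
        case True
        have "(\<Sum>l\<in>I. g Z l l) = (\<Sum>l\<in>I. if l \<in> N then \<mu> * \<gamma> l else 0)"
          using gZ by (intro sum.cong) auto
        then show ?thesis using True restrict[OF sub(4)] by (simp add: \<tau>_def sum_distrib_left)
      next
        case False
        have "(\<Sum>l\<in>I. g k l l) = 0"
        proof (cases "d k = 0")
          case True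
          have "g k l l = c k l l / \<mu>" for l
            using True False \<kappa>pos[of l] by (simp add: g_def graded_part_def \<kappa>_def[of k])
          then show ?thesis using trace0[OF k False True] by (simp add: sum_divide_distrib[symmetric])
        next
          case False
          then show ?thesis using g0 by simp
        qed
        then show ?thesis using False by simp
      qed
      have "(\<Sum>i\<in>I. \<Sum>j\<in>I. g Z i j * x i * x j) = (\<Sum>i\<in>I. if i \<in> N then \<mu> * (\<gamma> i * (x i)\<^sup>2) else 0)"
      proof (rule sum.cong[OF refl])
        fix i assume i: "i \<in> I"
        have "(\<Sum>j\<in>I. g Z i j * x i * x j)
            = (\<Sum>j\<in>I. if j = i then if i \<in> N then \<mu> * (\<gamma> i * (x i)\<^sup>2) else 0 else 0)"
          using gZ i by (intro sum.cong) (auto simp: power2_eq_square)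
        then show "(\<Sum>j\<in>I. g Z i j * x i * x j) = (if i \<in> N then \<mu> * (\<gamma> i * (x i)\<^sup>2) else 0)"
          using fin i by simp
      qed
      then have "(\<Sum>i\<in>I. \<Sum>j\<in>I. g Z i j * x i * x j) = \<mu> * (\<Sum>n\<in>N. \<gamma> n * (x n)\<^sup>2)"
        using restrict[OF sub(4)] by (simp add: sum_distrib_left)
      moreover have "(\<Sum>k\<in>I. (\<Sum>l\<in>I. g k l l) * (\<Sum>i\<in>I. \<Sum>j\<in>I. g k i j * x i * x j))
          = (\<Sum>k\<in>I. if k = Z then \<mu> * \<tau> * (\<Sum>i\<in>I. \<Sum>j\<in>I. g Z i j * x i * x j) else 0)"
        by (intro sum.cong refl) (simp add: tr)
      ultimately show ?thesis using fin ZI by (simp add: power2_eq_square)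
    qed
    \<comment> \<open>What remains of the positive terms is absorbed, with strictly positive coefficients left over.\<close>
    define R where "R = (\<Sum>p\<in>P. (Q p - T / \<mu>\<^sup>2) * (x p)\<^sup>2) + (\<Sum>n\<in>N. (4 * \<mu>\<^sup>2 * \<tau> * \<gamma> n - T) * (x n)\<^sup>2)"
    have "ricci_form I g x \<le> (T * (sp / \<mu>\<^sup>2 + sn) - H / \<mu>\<^sup>2 - (\<Sum>p\<in>P. Q p * (x p)\<^sup>2) - D) / 4
        - \<mu>\<^sup>2 * \<tau> * (\<Sum>n\<in>N. \<gamma> n * (x n)\<^sup>2)"
      using squares mean unfolding ricci_form_def E_def A_def by argo
    also have "\<dots> = - (H / \<mu>\<^sup>2 + D + R) / 4"
      by (simp add: R_def sp_def sn_def left_diff_distrib sum_subtractf sum_distrib_left sum_divide_distrib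
          mult_ac field_simps)
    finally have le: "ricci_form I g x \<le> - (H / \<mu>\<^sup>2 + D + R) / 4" .
    have H0: "H \<ge> 0" and D0: "D \<ge> 0" by (auto simp: H_def D_def sum_nonneg)
    have RP: "(Q p - T / \<mu>\<^sup>2) * (x p)\<^sup>2 \<ge> 0" if "p \<in> P" for p
      using \<mu>P[OF that] by simp
    have RN: "(4 * \<mu>\<^sup>2 * \<tau> * \<gamma> n - T) * (x n)\<^sup>2 \<ge> 0" if "n \<in> N" for n
      using \<mu>N[OF that] by simp
    have RP0: "(\<Sum>p\<in>P. (Q p - T / \<mu>\<^sup>2) * (x p)\<^sup>2) \<ge> 0" by (intro sum_nonneg RP)
    have RN0: "(\<Sum>n\<in>N. (4 * \<mu>\<^sup>2 * \<tau> * \<gamma> n - T) * (x n)\<^sup>2) \<ge> 0" by (intro sum_nonneg RN)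
    have "H / \<mu>\<^sup>2 + D + R > 0"
    proof (cases "\<exists>i\<in>P \<union> N. x i \<noteq> 0")
      case True
      then have "R > 0"
      proof (clarify, elim UnE)
        fix i assume i: "x i \<noteq> 0" "i \<in> P"
        then have "(\<Sum>p\<in>P. (Q p - T / \<mu>\<^sup>2) * (x p)\<^sup>2) > 0"
          using \<mu>P[of i] finite RP by (intro sum_pos2[of P i]) auto
        then show "R > 0" using RN0 by (simp add: R_def)
      next
        fix i assume i: "x i \<noteq> 0" "i \<in> N"
        then have "(\<Sum>n\<in>N. (4 * \<mu>\<^sup>2 * \<tau> * \<gamma> n - T) * (x n)\<^sup>2) > 0"
          using \<mu>N[of i] finite RN by (intro sum_pos2[of N i]) auto
        then show "R > 0" using RP0 by (simp add: R_def)
      qed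
      moreover have "H / \<mu>\<^sup>2 \<ge> 0" using H0 by simp
      ultimately show ?thesis using D0 by linarith
    next
      case False
      have R0: "R \<ge> 0" using RP0 RN0 by (simp add: R_def)
      show ?thesis
      proof (cases "\<exists>h\<in>I. xh h \<noteq> 0")
        case True
        have "\<exists>k\<in>P. \<exists>l\<in>P. F k l \<noteq> 0"
        proof (rule ccontr)
          assume none: "\<not> ?thesis"
          have "\<forall>h\<in>I. xh h = 0"
          proof (rule nonskew)
            show "d h = 0 \<and> h \<noteq> Z" if "xh h \<noteq> 0" for h using that by (simp add: xh_def split: if_splits)
            show "(\<Sum>h\<in>I. xh h * (c h k l + c h l k)) = 0"
              if "k \<in> I" "l \<in> I" "d k = 1" "d l = 1" for k l
              using none that by (auto simp: F_def P_def)
          qed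
          then show False using True by blast
        qed
        then obtain k l where kl: "k \<in> P" "l \<in> P" "F k l \<noteq> 0" by blast
        have "(\<Sum>l\<in>P. (F k l)\<^sup>2) > 0" using kl finite by (intro sum_pos2[of P l]) auto
        then have "H > 0"
          unfolding H_def by (rule sum_pos2[OF finite(3) kl(1)]) (simp add: sum_nonneg)
        then have "H / \<mu>\<^sup>2 > 0" using \<mu> by simp
        then show ?thesis using D0 R0 by linarith
      next
        case no_h: False
        have only_Z: "x i = 0" if "i \<in> I" "i \<noteq> Z" for i
        proof (cases "d i = 0")
          case True
          then show ?thesis using no_h that by (auto simp: xh_def)
        next
          case nz: False
          then have "i \<in> P \<union> N" using that by (auto simp: P_def N_def)
          then show ?thesis using False by blast
        qed
        then have xZ: "x Z \<noteq> 0" using x by auto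
        obtain n where n: "n \<in> N" using ex_high by (auto simp: N_def)
        then have nI: "n \<in> I" using sub by blast
        have "A n n = (\<Sum>i\<in>I. if i = Z then x Z * (2 * (\<mu> * \<gamma> n)) else 0)"
          unfolding A_def using only_Z gZ nI n by (intro sum.cong) auto
        then have "A n n \<noteq> 0" using fin ZI xZ \<mu> \<gamma>N[OF n] by simp
        then have "D > 0"
          unfolding D_def using n finite by (intro sum_pos2[of N n]) auto
        moreover have "H / \<mu>\<^sup>2 \<ge> 0" using H0 by simp
        ultimately show ?thesis using R0 by linarith
      qed
    qed
    then have "- (H / \<mu>\<^sup>2 + D + R) / 4 < 0" by simp
    with le show ?thesis by (rule order.strict_trans1)
  qed
  then show ?thesis using \<kappa>pos unfolding g_def by blast
qed

section \<open>The real form of the root space decomposition\<close>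

lemma (in vector_space) simultaneous_eigenvectors_independent:
  fixes T :: "'h \<Rightarrow> 'b \<Rightarrow> 'b" and \<mu> :: "'i \<Rightarrow> 'h \<Rightarrow> 'a"
  assumes "finite F"
    and add: "\<And>t x y. t \<in> S \<Longrightarrow> T t (x + y) = T t x + T t y"
    and scale: "\<And>t c x. t \<in> S \<Longrightarrow> T t (scale c x) = scale c (T t x)"
    and "\<And>i t. i \<in> F \<Longrightarrow> t \<in> S \<Longrightarrow> T t (v i) = scale (\<mu> i t) (v i)"
    and "\<And>i j. i \<in> F \<Longrightarrow> j \<in> F \<Longrightarrow> i \<noteq> j \<Longrightarrow> \<exists>t\<in>S. \<mu> i t \<noteq> \<mu> j t"
    and "(\<Sum>i\<in>F. v i) = 0"
  shows "\<forall>i\<in>F. v i = 0"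
  using assms(1,4-)
proof (induction F arbitrary: v rule: finite_induct)
  case (insert k F)
  have T0: "T t 0 = 0" if "t \<in> S" for t using scale[OF that, of 0 0] by simp
  have T_sum: "T t (\<Sum>i\<in>F. w i) = (\<Sum>i\<in>F. T t (w i))" if "t \<in> S" for t w
    by (induction F rule: infinite_finite_induct) (auto simp: T0 add that)
  have sum0: "v k + (\<Sum>i\<in>F. v i) = 0" using insert.prems(3) insert.hyps by simp
  have "\<forall>i\<in>F. scale (\<mu> i t - \<mu> k t) (v i) = 0" if t: "t \<in> S" for t
  proof (rule insert.IH)
    fix i s assume i: "i \<in> F" and s: "s \<in> S"
    show "T s (scale (\<mu> i t - \<mu> k t) (v i)) = scale (\<mu> i s) (scale (\<mu> i t - \<mu> k t) (v i))"
      using i s insert.prems(1)[of i s] by (simp add: scale mult.commute)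
  next
    fix i j assume "i \<in> F" "j \<in> F" "i \<noteq> j"
    then show "\<exists>t\<in>S. \<mu> i t \<noteq> \<mu> j t" using insert.prems(2) by blast
  next
    have "0 = T t (v k + (\<Sum>i\<in>F. v i))" using T0[OF t] sum0 by simp
    also have "\<dots> = scale (\<mu> k t) (v k) + (\<Sum>i\<in>F. scale (\<mu> i t) (v i))"
      using insert.prems(1) t by (simp add: add T_sum)
    also have "v k = - (\<Sum>i\<in>F. v i)" using sum0 by (simp add: eq_neg_iff_add_eq_0)
    finally show "(\<Sum>i\<in>F. scale (\<mu> i t - \<mu> k t) (v i)) = 0"
      by (simp add: scale_left_diff_distrib sum_subtractf scale_sum_right)
  qed
  then have F: "\<forall>i\<in>F. v i = 0"
    using insert.prems(2)[of _ k] insert.hyps(2) by (metis insertCI right_minus_eq scale_eq_0_iff)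
  then show ?case using sum0 by simp
qed simp

text \<open>Independence of a family, not only of its set of members, also gives injectivity.\<close>

lemma independent_family:
  fixes q :: "'i \<Rightarrow> 'v::real_vector"
  assumes "\<And>F f. finite F \<Longrightarrow> F \<subseteq> J \<Longrightarrow> (\<Sum>i\<in>F. f i *\<^sub>R q i) = 0 \<Longrightarrow> \<forall>i\<in>F. f i = 0"
  shows "inj_on q J" "independent (q ` J)"
proof -
  show inj: "inj_on q J"
  proof (rule inj_onI, rule ccontr)
    fix i j assume ij: "i \<in> J" "j \<in> J" "q i = q j" "i \<noteq> j"
    have "\<forall>k\<in>{i, j}. (if k = i then 1 else - 1 :: real) = 0"
      by (rule assms) (use ij in auto)
    then show False by simp
  qed
  show "independent (q ` J)"
    unfolding independent_explicit_finite_subsets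
  proof (intro allI impI ballI)
    fix S f v assume S: "S \<subseteq> q ` J" "finite S" "(\<Sum>v\<in>S. f v *\<^sub>R v) = 0" and v: "v \<in> S"
    obtain F where F: "F \<subseteq> J" "S = q ` F" using S(1) by (auto simp: subset_image_iff)
    have injF: "inj_on q F" using inj F(1) inj_on_subset by blast
    then have finF: "finite F" using S(2) F(2) finite_imageD by blast
    have "(\<Sum>i\<in>F. f (q i) *\<^sub>R q i) = 0" using S(3) F(2) by (simp add: sum.reindex[OF injF])
    then show "f v = 0" using assms[OF finF F(1), of "\<lambda>i. f (q i)"] v F(2) by auto
  qed
qed

locale compact_roots = real_lie_algebra br
  for br :: "'a::real_vector \<Rightarrow> 'a \<Rightarrow> 'a" +
  fixes u :: "'a set" and h :: "('a \<times> 'a) set"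
    and \<Delta> \<Delta>p :: "('a \<times> 'a \<Rightarrow> complex) set"
    and Hv X :: "('a \<times> 'a \<Rightarrow> complex) \<Rightarrow> 'a \<times> 'a"
  assumes u_sub: "lie_subalgebra scaleR UNIV br u"
    and u_compact: "compact_semisimple u br"
    and root_data: "compact_root_data br u h \<Delta> \<Delta>p Hv X"
begin

abbreviation "cb \<equiv> cbracket br"

lemma cb_add: "cb (p + q) r = cb p r + cb q r" "cb r (p + q) = cb r p + cb r q"
  and cb_scale: "cb (cscale a p) q = cscale a (cb p q)" "cb p (cscale a q) = cscale a (cb p q)"
  by (simp_all add: cbracket_def cscale_def br_simps algebra_simps)

lemma cb_anti: "cb p q = - cb q p"
  using br_anti[of "fst p" "fst q"] br_anti[of "snd p" "snd q"] br_anti[of "fst p" "snd q"]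
    br_anti[of "snd p" "fst q"] by (simp add: cbracket_def)

lemma cb_minus: "cb (- p) q = - cb p q" "cb p (- q) = - cb p q"
  and cb_diff: "cb (p - q) r = cb p r - cb q r" "cb r (p - q) = cb r p - cb r q"
  and cb_self: "cb p p = 0"
  and cb_zero: "cb 0 p = 0" "cb p 0 = 0"
  by (simp_all add: cbracket_def br_simps br_self br_anti[of "snd p" "fst p"] zero_prod_def)

lemma cb_deriv: "cb p (cb q r) = cb (cb p q) r + cb q (cb p r)"
proof -
  obtain p1 p2 q1 q2 r1 r2 where "p = (p1, p2)" "q = (q1, q2)" "r = (r1, r2)"
    by (metis surj_pair)
  then show ?thesis
    using br_deriv[of p1 q1 r1] br_deriv[of p1 q1 r2] br_deriv[of p1 q2 r1] br_deriv[of p1 q2 r2]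
      br_deriv[of p2 q1 r1] br_deriv[of p2 q1 r2] br_deriv[of p2 q2 r1] br_deriv[of p2 q2 r2]
    by (simp add: cbracket_def br_simps algebra_simps)
qed

lemma cscale_simps: "cscale a (cscale b p) = cscale (a * b) p" "cscale a (p + q) = cscale a p + cscale a q"
  "cscale a (p - q) = cscale a p - cscale a q" "cscale (- a) p = - cscale a p" "cscale a (- p) = - cscale a p"
  "cscale 1 p = p" "cscale a 0 = 0"
  by (simp_all add: cscale_def prod_eq_iff algebra_simps)

lemma cscale_eq_0: "cscale a p = 0 \<longleftrightarrow> a = 0 \<or> p = 0"
  using vector_space.scale_eq_0_iff[OF vector_space_cscale] .

lemma root_neg: "\<alpha> \<in> \<Delta> \<Longrightarrow> - \<alpha> \<in> \<Delta>"
  and root_neq_neg: "\<alpha> \<in> \<Delta> \<Longrightarrow> \<alpha> \<noteq> - \<alpha>"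
  and pos_root: "\<alpha> \<in> \<Delta>p \<Longrightarrow> \<alpha> \<in> \<Delta>"
  and pos_neg: "\<alpha> \<in> \<Delta>p \<Longrightarrow> - \<alpha> \<notin> \<Delta>p"
  and root_cases: "\<alpha> \<in> \<Delta> \<Longrightarrow> \<alpha> \<in> \<Delta>p \<or> - \<alpha> \<in> \<Delta>p"
proof -
  have "positive_system \<Delta> \<Delta>p" using root_data unfolding compact_root_data_def by blast
  then have un: "\<Delta>p \<union> uminus ` \<Delta>p = \<Delta>" and dis: "\<Delta>p \<inter> uminus ` \<Delta>p = {}"
    by (simp_all add: positive_system_def)
  show pr: "\<alpha> \<in> \<Delta>" if "\<alpha> \<in> \<Delta>p" using un that by blast
  show pn: "- \<alpha> \<notin> \<Delta>p" if a: "\<alpha> \<in> \<Delta>p"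
  proof
    assume "- \<alpha> \<in> \<Delta>p"
    then have "- (- \<alpha>) \<in> uminus ` \<Delta>p" by (rule imageI)
    then show False using a dis by auto
  qed
  show c: "\<alpha> \<in> \<Delta>p \<or> - \<alpha> \<in> \<Delta>p" if a: "\<alpha> \<in> \<Delta>"
  proof -
    have "\<alpha> \<in> \<Delta>p \<or> \<alpha> \<in> uminus ` \<Delta>p" using un a by blast
    then show ?thesis by auto
  qed
  show "- \<alpha> \<in> \<Delta>" if a: "\<alpha> \<in> \<Delta>"
  proof -
    have "- \<alpha> \<in> \<Delta>p \<or> - \<alpha> \<in> uminus ` \<Delta>p" using c[OF a] by auto
    then show ?thesis using un by blast
  qed
  show "\<alpha> \<noteq> - \<alpha>" if "\<alpha> \<in> \<Delta>"
    using c that pn by metis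
qed

lemma root_vector: "\<alpha> \<in> \<Delta> \<Longrightarrow> H \<in> h \<Longrightarrow> cb H (X \<alpha>) = cscale (\<alpha> H) (X \<alpha>)"
  and Hv_in: "\<alpha> \<in> \<Delta> \<Longrightarrow> Hv \<alpha> \<in> h"
  and bracket_opposite: "\<alpha> \<in> \<Delta> \<Longrightarrow> cb (X \<alpha>) (X (- \<alpha>)) = Hv \<alpha>"
  and u_span: "u \<times> {0} = span ((\<lambda>\<alpha>. cscale \<i> (Hv \<alpha>)) ` \<Delta> \<union> Xup X ` \<Delta> \<union> Yup X ` \<Delta>)"
  using root_data by (simp_all add: compact_root_data_def root_space_def)

lemma root_dual: "\<alpha> \<in> \<Delta> \<Longrightarrow> \<alpha> \<in> dual_on cscale h" "\<alpha> \<in> \<Delta> \<Longrightarrow> \<alpha> \<noteq> 0"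
  using root_data by (simp_all add: compact_root_data_def roots_def)

lemma dual_distinct:
  assumes "\<alpha> \<in> dual_on cscale h" "\<beta> \<in> dual_on cscale h" "\<alpha> \<noteq> \<beta>"
  shows "\<exists>H\<in>h. \<alpha> H \<noteq> \<beta> H"
proof -
  obtain H where H: "\<alpha> H \<noteq> \<beta> H" using assms(3) by (auto simp: fun_eq_iff)
  have "H \<in> h"
  proof (rule ccontr)
    assume "H \<notin> h"
    then have "\<alpha> H = 0" "\<beta> H = 0" using assms(1,2) unfolding dual_on_def by blast+
    then show False using H by simp
  qed
  then show ?thesis using H by blast
qed

lemma zero_dual: "0 \<in> dual_on cscale h"
  by (simp add: dual_on_def)

text \<open>The Killing form pairs \<open>Hv \<alpha>\<close> with \<open>H\<close> to \<open>\<alpha> H\<close>, and \<open>\<alpha>\<close> is nonzero.\<close>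

lemma Hv_nonzero:
  assumes "\<alpha> \<in> \<Delta>"
  shows "Hv \<alpha> \<noteq> 0"
proof
  assume 0: "Hv \<alpha> = 0"
  have "\<alpha> H = 0" if "H \<in> h" for H
  proof -
    have rep0: "module.representation cscale B 0 b = 0" for B b
    proof -
      interpret C: vector_space cscale by (rule vector_space_cscale)
      show ?thesis by (simp add: C.representation_zero)
    qed
    have "\<alpha> H = killing_form cscale (u \<times> u) cb H (Hv \<alpha>)"
      using root_data assms that by (simp add: compact_root_data_def)
    also have "\<dots> = 0"
      unfolding killing_form_def trace_on_def Let_def 0 cb_zero rep0 by simp
    finally show ?thesis .
  qed
  then show False
    using dual_distinct[OF root_dual(1)[OF assms] zero_dual root_dual(2)[OF assms]] by auto
qed

lemma X_nonzero: "\<alpha> \<in> \<Delta> \<Longrightarrow> X \<alpha> \<noteq> 0"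
  using bracket_opposite[of \<alpha>] Hv_nonzero[of \<alpha>] by (auto simp: cb_zero)

text \<open>\<open>Hv \<alpha>\<close> is a bracket of vectors of the opposite weights \<open>\<alpha>\<close> and \<open>- \<alpha>\<close>, so it has weight zero. For a
  Cartan subalgebra that is only known to be nilpotent, this is what makes the torus abelian.\<close>

lemma Hv_commutes:
  assumes \<alpha>: "\<alpha> \<in> \<Delta>" and H: "H \<in> h"
  shows "cb H (Hv \<alpha>) = 0"
proof -
  have "cb H (Hv \<alpha>) = cb (cb H (X \<alpha>)) (X (- \<alpha>)) + cb (X \<alpha>) (cb H (X (- \<alpha>)))"
    using bracket_opposite[OF \<alpha>] cb_deriv[of H "X \<alpha>" "X (- \<alpha>)"] by simp
  then show ?thesis
    using root_vector[OF \<alpha> H] root_vector[OF root_neg[OF \<alpha>] H]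
    by (simp add: cb_scale cb_minus cscale_simps)
qed

text \<open>Root vectors for distinct roots and the vectors that commute with \<open>h\<close> are simultaneous
  eigenvectors of \<open>h\<close> with distinct eigenvalues.\<close>

lemma root_independent:
  assumes F: "finite F" "F \<subseteq> \<Delta>" and p: "\<And>H. H \<in> h \<Longrightarrow> cb H p = 0"
    and sum0: "p + (\<Sum>\<alpha>\<in>F. cscale (c \<alpha>) (X \<alpha>)) = 0"
  shows "p = 0" "\<And>\<alpha>. \<alpha> \<in> F \<Longrightarrow> c \<alpha> = 0"
proof -
  interpret C: vector_space cscale by (rule vector_space_cscale)
  define v where "v \<alpha> = (if \<alpha> = 0 then p else cscale (c \<alpha>) (X \<alpha>))" for \<alpha>
  have no0: "0 \<notin> F" using F(2) root_dual(2) by blast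
  have dual: "\<alpha> \<in> dual_on cscale h" if "\<alpha> \<in> insert 0 F" for \<alpha>
    using that F(2) root_dual(1) zero_dual by blast
  have "\<forall>\<alpha>\<in>insert 0 F. v \<alpha> = 0"
  proof (rule C.simultaneous_eigenvectors_independent[where T = cb and S = h and \<mu> = "\<lambda>\<alpha>. \<alpha>"])
    show "cb H (v \<alpha>) = cscale (\<alpha> H) (v \<alpha>)" if "\<alpha> \<in> insert 0 F" "H \<in> h" for \<alpha> H
      using that p root_vector[of \<alpha> H] F(2) by (auto simp: v_def cb_scale cscale_simps mult.commute)
    show "\<exists>H\<in>h. \<alpha> H \<noteq> \<beta> H" if "\<alpha> \<in> insert 0 F" "\<beta> \<in> insert 0 F" "\<alpha> \<noteq> \<beta>" for \<alpha> \<beta>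
      using dual_distinct dual that by blast
    have "(\<Sum>\<alpha>\<in>F. v \<alpha>) = (\<Sum>\<alpha>\<in>F. cscale (c \<alpha>) (X \<alpha>))"
      using no0 by (intro sum.cong) (auto simp: v_def)
    then show "(\<Sum>\<alpha>\<in>insert 0 F. v \<alpha>) = 0"
      using F no0 sum0 by (simp add: v_def)
  qed (use F in \<open>auto simp: cb_add cb_scale\<close>)
  then have v0: "v \<alpha> = 0" if "\<alpha> \<in> insert 0 F" for \<alpha> using that by blast
  show "p = 0" using v0[of 0] by (simp add: v_def)
  show "c \<alpha> = 0" if "\<alpha> \<in> F" for \<alpha>
  proof -
    have "\<alpha> \<noteq> 0" "X \<alpha> \<noteq> 0" using that no0 F(2) X_nonzero by blast+
    then show ?thesis using v0[of \<alpha>] that by (simp add: v_def cscale_eq_0)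
  qed
qed

text \<open>The elements of \<open>u\<close> denoted by \<open>\<i> H\<^sub>\<alpha>\<close>, \<open>X\<^sup>\<alpha>\<close> and \<open>Y\<^sup>\<alpha>\<close>; they are first components because
  \<open>u\<close> sits inside its complexification as \<open>u \<times> {0}\<close>.\<close>

definition tt where "tt \<alpha> = fst (cscale \<i> (Hv \<alpha>))"
definition xx where "xx \<alpha> = fst (Xup X \<alpha>)"
definition yy where "yy \<alpha> = fst (Yup X \<alpha>)"

lemma real_form:
  assumes "\<alpha> \<in> \<Delta>"
  shows "cscale \<i> (Hv \<alpha>) = (tt \<alpha>, 0)" "Xup X \<alpha> = (xx \<alpha>, 0)" "Yup X \<alpha> = (yy \<alpha>, 0)"
    "tt \<alpha> \<in> u" "xx \<alpha> \<in> u" "yy \<alpha> \<in> u"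
proof -
  have "cscale \<i> (Hv \<alpha>) \<in> u \<times> {0}" "Xup X \<alpha> \<in> u \<times> {0}" "Yup X \<alpha> \<in> u \<times> {0}"
    unfolding u_span using assms by (auto intro: span_base)
  then show "cscale \<i> (Hv \<alpha>) = (tt \<alpha>, 0)" "Xup X \<alpha> = (xx \<alpha>, 0)" "Yup X \<alpha> = (yy \<alpha>, 0)"
    "tt \<alpha> \<in> u" "xx \<alpha> \<in> u" "yy \<alpha> \<in> u"
    by (auto simp: tt_def xx_def yy_def)
qed

lemma cb_torus:
  assumes "\<alpha> \<in> \<Delta>" "\<beta> \<in> \<Delta>"
  shows "cb (cscale \<i> (Hv \<beta>)) (Xup X \<alpha>) = cscale (\<alpha> (Hv \<beta>)) (Yup X \<alpha>)"
    and "cb (cscale \<i> (Hv \<beta>)) (Yup X \<alpha>) = - cscale (\<alpha> (Hv \<beta>)) (Xup X \<alpha>)"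
  using root_vector[OF assms(1) Hv_in[OF assms(2)]] root_vector[OF root_neg[OF assms(1)] Hv_in[OF assms(2)]]
  by (simp_all add: Xup_def Yup_def cb_scale cb_add cb_diff cscale_simps mult_ac)

lemma br_cb: "cb (a, 0) (b, 0) = (br a b, 0)"
  by (simp add: cbracket_def br_simps)

definition rt where "rt \<alpha> \<beta> = Re (\<alpha> (Hv \<beta>))"

lemma yy_nonzero:
  assumes "\<alpha> \<in> \<Delta>"
  shows "yy \<alpha> \<noteq> 0"
proof
  assume "yy \<alpha> = 0"
  then have "cscale \<i> (X \<alpha> + X (- \<alpha>)) = 0"
    using real_form(3)[OF assms] by (simp add: Yup_def zero_prod_def)
  then have "X \<alpha> + X (- \<alpha>) = 0" by (simp add: cscale_eq_0)
  then have "0 + (\<Sum>\<beta>\<in>{\<alpha>, - \<alpha>}. cscale 1 (X \<beta>)) = 0"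
    using root_neq_neg[OF assms] by (simp add: cscale_simps)
  then have "(1::complex) = 0"
    using root_independent(2)[of "{\<alpha>, - \<alpha>}" 0 "\<lambda>_. 1" \<alpha>] assms root_neg[OF assms]
    by (auto simp: cb_zero)
  then show False by simp
qed

text \<open>The roots are real on the \<open>Hv \<beta>\<close>, because \<open>ad (\<i> Hv \<beta>)\<close> maps \<open>Xup \<alpha>\<close> into the real
  form and the result is \<open>\<alpha> (Hv \<beta>)\<close> times a nonzero element of the real form.\<close>

lemma root_real:
  assumes "\<alpha> \<in> \<Delta>" "\<beta> \<in> \<Delta>"
  shows "\<alpha> (Hv \<beta>) = complex_of_real (rt \<alpha> \<beta>)"
proof -
  have "cscale (\<alpha> (Hv \<beta>)) (yy \<alpha>, 0) = (br (tt \<beta>) (xx \<alpha>), 0)"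
    using cb_torus(1)[OF assms] real_form[OF assms(1)] real_form[OF assms(2)] by (simp add: br_cb)
  then have "Im (\<alpha> (Hv \<beta>)) *\<^sub>R yy \<alpha> = 0" by (simp add: cscale_def)
  then show ?thesis using yy_nonzero[OF assms(1)] by (simp add: rt_def complex_eq_iff)
qed

lemma torus_action:
  assumes "\<alpha> \<in> \<Delta>" "\<beta> \<in> \<Delta>"
  shows "br (tt \<beta>) (xx \<alpha>) = rt \<alpha> \<beta> *\<^sub>R yy \<alpha>" "br (tt \<beta>) (yy \<alpha>) = - (rt \<alpha> \<beta> *\<^sub>R xx \<alpha>)"
  using cb_torus[OF assms] real_form[OF assms(1)] real_form[OF assms(2)] root_real[OF assms]
  by (simp_all add: br_cb cscale_of_real scaleR_prod_def)

lemma torus_commutes: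
  assumes "\<alpha> \<in> \<Delta>" "\<beta> \<in> \<Delta>"
  shows "br (tt \<alpha>) (tt \<beta>) = 0"
proof -
  have "cb (cscale \<i> (Hv \<alpha>)) (cscale \<i> (Hv \<beta>)) = 0"
    using Hv_commutes[OF assms(2) Hv_in[OF assms(1)]] by (simp add: cb_scale cscale_simps)
  then show ?thesis
    using real_form(1)[OF assms(1)] real_form(1)[OF assms(2)] by (simp add: br_cb zero_prod_def)
qed

lemma br_xx_yy:
  assumes "\<alpha> \<in> \<Delta>"
  shows "br (xx \<alpha>) (yy \<alpha>) = 2 *\<^sub>R tt \<alpha>"
proof -
  have "cb (Xup X \<alpha>) (Yup X \<alpha>) = cscale 2 (cscale \<i> (Hv \<alpha>))"
    using bracket_opposite[OF assms] cb_anti[of "X (- \<alpha>)" "X \<alpha>"]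
    by (simp add: Xup_def Yup_def cb_scale cb_add cb_diff cb_self cscale_simps)
      (simp add: cscale_def prod_eq_iff scaleR_2)
  then have "(br (xx \<alpha>) (yy \<alpha>), 0) = cscale 2 (tt \<alpha>, 0)"
    by (simp only: real_form[OF assms] br_cb)
  then show ?thesis by (simp add: cscale_def)
qed

lemma u_eq: "u = span (tt ` \<Delta> \<union> xx ` \<Delta>p \<union> yy ` \<Delta>p)"
proof -
  let ?G = "(\<lambda>\<alpha>. cscale \<i> (Hv \<alpha>)) ` \<Delta> \<union> Xup X ` \<Delta> \<union> Yup X ` \<Delta>"
  have "u = fst ` span ?G" unfolding u_span[symmetric] by force
  also have "\<dots> = span (fst ` ?G)"
    by (rule linear_span_image[symmetric]) (simp add: linear_iff)
  also have "fst ` ?G = tt ` \<Delta> \<union> xx ` \<Delta> \<union> yy ` \<Delta>"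
    by (auto simp: image_Un image_image tt_def xx_def yy_def)
  also have "span \<dots> = span (tt ` \<Delta> \<union> xx ` \<Delta>p \<union> yy ` \<Delta>p)"
  proof
    show "span (tt ` \<Delta> \<union> xx ` \<Delta>p \<union> yy ` \<Delta>p) \<subseteq> span (tt ` \<Delta> \<union> xx ` \<Delta> \<union> yy ` \<Delta>)"
      using pos_root by (intro span_mono) blast
    let ?S = "span (tt ` \<Delta> \<union> xx ` \<Delta>p \<union> yy ` \<Delta>p)"
    have "xx \<alpha> \<in> ?S \<and> yy \<alpha> \<in> ?S" if "\<alpha> \<in> \<Delta>" for \<alpha>
    proof (cases "\<alpha> \<in> \<Delta>p")
      case True
      then show ?thesis by (auto intro: span_base)
    next
      case False
      then have "- \<alpha> \<in> \<Delta>p" using root_cases[OF that] by blast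
      then have "- xx (- \<alpha>) \<in> ?S" "yy (- \<alpha>) \<in> ?S" by (auto intro: span_base span_neg)
      then show ?thesis by (simp add: xx_def yy_def Xup_def Yup_def add.commute)
    qed
    then show "span (tt ` \<Delta> \<union> xx ` \<Delta> \<union> yy ` \<Delta>) \<subseteq> ?S"
      by (intro span_minimal) (auto intro: span_base)
  qed
  finally show ?thesis .
qed

lemma ihR_eq: "ihR \<Delta> Hv = span (tt ` \<Delta>)"
proof -
  have lin: "linear (cscale \<i>)" by (simp add: linear_iff cscale_def prod_eq_iff algebra_simps)
  have "cscale \<i> ` span (Hv ` \<Delta>) = span ((\<lambda>\<alpha>. (tt \<alpha>, 0)) ` \<Delta>)"
    unfolding linear_span_image[OF lin, symmetric] image_image using real_form(1) by simp
  also have "\<dots> = (\<lambda>x. (x, 0)) ` span (tt ` \<Delta>)"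
    using linear_span_image[of "\<lambda>x. (x, 0 :: 'a)" "tt ` \<Delta>"] by (simp add: linear_iff image_image)
  finally show ?thesis unfolding ihR_def by auto
qed

text \<open>The Killing form vanishes on the center, and it is definite.\<close>

lemma centerless:
  assumes "H \<in> u" "\<And>x. x \<in> u \<Longrightarrow> br H x = 0"
  shows "H = 0"
proof (rule ccontr)
  assume "H \<noteq> 0"
  then have neg: "killing_form scaleR u br H H < 0"
    using u_compact assms(1) by (simp add: compact_semisimple_def)
  have "subspace u" using u_sub by (simp add: lie_subalgebra_def subspace_raw_def)
  note B = basis_choice[OF this]
  define B where "B = (SOME B. \<not> module.dependent scaleR B \<and> module.span scaleR B = u)"
  have "b \<in> u" if "b \<in> B" for b
    using B(2) that span_base[of b B] unfolding B_def by simp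
  then have "(\<Sum>b\<in>B. module.representation scaleR B (br H (br H b)) b) = 0"
    using assms(2) representation_zero[of B] by (simp add: br_zero representation_raw_def)
  then show False
    using neg unfolding killing_form_def trace_on_def Let_def B_def by simp
qed

lemma torus_span_action:
  assumes H: "H \<in> span (tt ` \<Delta>)" and \<alpha>: "\<alpha> \<in> \<Delta>"
  shows "\<exists>\<theta>. br H (xx \<alpha>) = \<theta> *\<^sub>R yy \<alpha> \<and> br H (yy \<alpha>) = - (\<theta> *\<^sub>R xx \<alpha>)"
  using H
proof (induction rule: span_induct_alt)
  case base
  show ?case by (intro exI[of _ 0]) (simp add: br_zero)
next
  case (step r v w)
  then obtain \<beta> \<theta> where \<beta>: "\<beta> \<in> \<Delta>" "v = tt \<beta>"
    and \<theta>: "br w (xx \<alpha>) = \<theta> *\<^sub>R yy \<alpha>" "br w (yy \<alpha>) = - (\<theta> *\<^sub>R xx \<alpha>)" by blast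
  show ?case
    by (intro exI[of _ "r * rt \<alpha> \<beta> + \<theta>"])
      (simp add: br_add br_scale \<beta>(2) torus_action[OF \<alpha> \<beta>(1)] \<theta> scaleR_add_left)
qed

text \<open>Such an element would be central in \<open>u\<close>.\<close>

lemma torus_faithful:
  assumes H: "H \<in> span (tt ` \<Delta>)"
    and xy: "\<And>\<alpha>. \<alpha> \<in> \<Delta>p \<Longrightarrow> br H (xx \<alpha>) = 0 \<and> br H (yy \<alpha>) = 0"
  shows "H = 0"
proof (rule centerless)
  show "H \<in> u" using H u_eq span_mono[of "tt ` \<Delta>" "tt ` \<Delta> \<union> xx ` \<Delta>p \<union> yy ` \<Delta>p"] by blast
  have "br H (tt \<alpha>) = 0" if \<alpha>: "\<alpha> \<in> \<Delta>" for \<alpha>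
    using H
  proof (induction rule: span_induct_alt)
    case (step r v w)
    then show ?case using torus_commutes \<alpha> by (auto simp: br_simps)
  qed (simp add: br_zero)
  then have gen: "br H b = 0" if "b \<in> tt ` \<Delta> \<union> xx ` \<Delta>p \<union> yy ` \<Delta>p" for b
    using that xy by auto
  fix x assume "x \<in> u"
  then have "x \<in> span (tt ` \<Delta> \<union> xx ` \<Delta>p \<union> yy ` \<Delta>p)" using u_eq by simp
  then show "br H x = 0"
    by (induction rule: span_induct_alt) (simp_all add: br_simps gen)
qed

text \<open>The vectors \<open>X\<^sup>\<alpha>\<close> and \<open>Y\<^sup>\<alpha> / 2\<close>. The torus acts on their plane by a multiple \<open>\<theta>\<close> of a rotation, whose
  matrix in this basis has the off-diagonal entries \<open>2 * \<theta>\<close> and \<open>- \<theta> / 2\<close>; so it is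
  skew only for \<open>\<theta> = 0\<close>.\<close>

definition pv :: "('a \<times> 'a \<Rightarrow> complex) \<times> bool \<Rightarrow> 'a" where
  "pv i = (if snd i then xx (fst i) else (1/2) *\<^sub>R yy (fst i))"

text \<open>A real combination of \<open>X\<^sup>\<alpha>\<close> and \<open>Y\<^sup>\<alpha>\<close> over positive roots is a complex combination of the root
  vectors for these roots and their negatives, which are all distinct.\<close>

lemma pv_independent:
  assumes F: "finite F" "F \<subseteq> \<Delta>p \<times> UNIV" and H: "H \<in> span (tt ` \<Delta>)"
    and sum0: "H + (\<Sum>i\<in>F. f i *\<^sub>R pv i) = 0"
  shows "H = 0" "\<And>i. i \<in> F \<Longrightarrow> f i = 0"
proof -
  define G where "G = fst ` F"
  define a where "a \<alpha> = (if (\<alpha>, True) \<in> F then f (\<alpha>, True) else 0)" for \<alpha>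
  define b where "b \<alpha> = (if (\<alpha>, False) \<in> F then f (\<alpha>, False) / 2 else 0)" for \<alpha>
  have G: "finite G" "G \<subseteq> \<Delta>p" using F by (auto simp: G_def)
  define c where "c \<alpha> = (if \<alpha> \<in> \<Delta>p then Complex (a \<alpha>) (b \<alpha>) else Complex (- a (- \<alpha>)) (b (- \<alpha>)))" for \<alpha>
  have disj: "G \<inter> uminus ` G = {}" using G(2) pos_neg by auto
  have commute: "cb K (H, 0) = 0" if K: "K \<in> h" for K
  proof -
    have "\<exists>p. (H, 0) = p \<and> cb K p = 0"
      using H
    proof (induction rule: span_induct_alt)
      case base
      show ?case using cb_zero(2)[of K] by (simp add: zero_prod_def)
    next
      case (step r x y)
      then obtain \<alpha> where \<alpha>: "\<alpha> \<in> \<Delta>" "x = tt \<alpha>" by auto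
      have "(x, 0) = cscale \<i> (Hv \<alpha>)" using real_form(1)[OF \<alpha>(1)] \<alpha>(2) by simp
      then have "cb K (x, 0) = 0" using Hv_commutes[OF \<alpha>(1) K] by (simp add: cb_scale cscale_simps)
      moreover have "(r *\<^sub>R x + y, 0) = cscale (complex_of_real r) (x, 0) + (y, 0)"
        by (simp add: cscale_def)
      ultimately show ?case using step.IH by (simp add: cb_add cb_scale cscale_simps)
    qed
    then show ?thesis by simp
  qed
  have pair: "cscale (c \<alpha>) (X \<alpha>) + cscale (c (- \<alpha>)) (X (- \<alpha>)) = (a \<alpha> *\<^sub>R xx \<alpha> + b \<alpha> *\<^sub>R yy \<alpha>, 0)"
    if "\<alpha> \<in> G" for \<alpha>
  proof -
    have \<alpha>: "\<alpha> \<in> \<Delta>p" "- \<alpha> \<notin> \<Delta>p" using that G(2) pos_neg by auto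
    have "cscale (c \<alpha>) (X \<alpha>) + cscale (c (- \<alpha>)) (X (- \<alpha>)) = a \<alpha> *\<^sub>R Xup X \<alpha> + b \<alpha> *\<^sub>R Yup X \<alpha>"
      using \<alpha> by (simp add: c_def Xup_def Yup_def cscale_def prod_eq_iff algebra_simps)
    then show ?thesis using real_form[OF pos_root[OF \<alpha>(1)]] by (simp add: scaleR_prod_def)
  qed
  have "(\<Sum>\<alpha>\<in>G \<union> uminus ` G. cscale (c \<alpha>) (X \<alpha>))
      = (\<Sum>\<alpha>\<in>G. cscale (c \<alpha>) (X \<alpha>)) + (\<Sum>\<alpha>\<in>uminus ` G. cscale (c \<alpha>) (X \<alpha>))"
    by (rule sum.union_disjoint) (use G disj in auto)
  also have "(\<Sum>\<alpha>\<in>uminus ` G. cscale (c \<alpha>) (X \<alpha>)) = (\<Sum>\<alpha>\<in>G. cscale (c (- \<alpha>)) (X (- \<alpha>)))"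
    by (subst sum.reindex) (auto intro!: inj_onI simp: fun_eq_iff)
  also have "(\<Sum>\<alpha>\<in>G. cscale (c \<alpha>) (X \<alpha>)) + (\<Sum>\<alpha>\<in>G. cscale (c (- \<alpha>)) (X (- \<alpha>)))
      = (\<Sum>\<alpha>\<in>G. (a \<alpha> *\<^sub>R xx \<alpha> + b \<alpha> *\<^sub>R yy \<alpha>, 0))"
    unfolding sum.distrib[symmetric] by (intro sum.cong refl pair)
  also have "\<dots> = (\<Sum>\<alpha>\<in>G. a \<alpha> *\<^sub>R xx \<alpha> + b \<alpha> *\<^sub>R yy \<alpha>, 0)"
    by (simp add: prod_eq_iff fst_sum snd_sum)
  also have "(\<Sum>\<alpha>\<in>G. a \<alpha> *\<^sub>R xx \<alpha> + b \<alpha> *\<^sub>R yy \<alpha>) = (\<Sum>i\<in>F. f i *\<^sub>R pv i)"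
  proof -
    have "(\<Sum>i\<in>F. f i *\<^sub>R pv i) = (\<Sum>i\<in>G \<times> UNIV. if i \<in> F then f i *\<^sub>R pv i else 0)"
    proof (rule sum.mono_neutral_cong_left)
      show "F \<subseteq> G \<times> UNIV" by (force simp: G_def)
    qed (use G(1) in auto)
    also have "\<dots> = (\<Sum>\<alpha>\<in>G. \<Sum>s\<in>UNIV. if (\<alpha>, s) \<in> F then f (\<alpha>, s) *\<^sub>R pv (\<alpha>, s) else 0)"
      by (simp add: sum.cartesian_product)
    also have "\<dots> = (\<Sum>\<alpha>\<in>G. a \<alpha> *\<^sub>R xx \<alpha> + b \<alpha> *\<^sub>R yy \<alpha>)"
      by (intro sum.cong refl) (simp add: UNIV_bool a_def b_def pv_def add.commute)
    finally show ?thesis by simp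
  qed
  finally have eq: "(\<Sum>\<alpha>\<in>G \<union> uminus ` G. cscale (c \<alpha>) (X \<alpha>)) = (\<Sum>i\<in>F. f i *\<^sub>R pv i, 0)" .
  have sum0': "(H, 0) + (\<Sum>\<alpha>\<in>G \<union> uminus ` G. cscale (c \<alpha>) (X \<alpha>)) = 0"
    unfolding eq using sum0 by (simp add: zero_prod_def)
  have sub: "G \<union> uminus ` G \<subseteq> \<Delta>" using G(2) pos_root root_neg by auto
  have ind: "(H, 0) = (0 :: 'a \<times> 'a)" "\<And>\<alpha>. \<alpha> \<in> G \<union> uminus ` G \<Longrightarrow> c \<alpha> = 0"
    using root_independent[of "G \<union> uminus ` G" "(H, 0)" c, OF _ sub commute sum0'] G(1) by auto
  show "H = 0" using ind(1) by (simp add: zero_prod_def)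
  show "f i = 0" if i: "i \<in> F" for i
  proof -
    have "fst i \<in> G" "fst i \<in> \<Delta>p" using i G(2) by (auto simp: G_def)
    then have "a (fst i) = 0" "b (fst i) = 0" using ind(2)[of "fst i"] by (auto simp: c_def complex_eq_iff)
    then show ?thesis using i by (cases i; cases "snd i") (auto simp: a_def b_def)
  qed
qed

end

section \<open>Bases adapted to the degrees\<close>

lemma independent_Un_span:
  fixes A B :: "'v::real_vector set"
  assumes A: "finite A" "independent A" and B: "finite B" "independent B"
    and AB: "span A \<inter> span B \<subseteq> {0}"
  shows "independent (A \<union> B)" "A \<inter> B = {}"
proof -
  show disj: "A \<inter> B = {}"
  proof (rule ccontr)
    assume "A \<inter> B \<noteq> {}"
    then obtain x where x: "x \<in> A" "x \<in> B" by blast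
    then have "x = 0" using AB span_base by blast
    then show False using x(1) A(2) dependent_zero by blast
  qed
  show "independent (A \<union> B)"
  proof (rule independent_if_scalars_zero)
    fix f x assume sum0: "(\<Sum>x\<in>A \<union> B. f x *\<^sub>R x) = 0" and x: "x \<in> A \<union> B"
    have eq: "(\<Sum>x\<in>A. f x *\<^sub>R x) + (\<Sum>x\<in>B. f x *\<^sub>R x) = 0"
      using sum0 A(1) B(1) disj by (simp add: sum.union_disjoint)
    have inA: "(\<Sum>x\<in>A. f x *\<^sub>R x) \<in> span A" by (intro span_sum span_scale span_base)
    have "- (\<Sum>x\<in>B. f x *\<^sub>R x) \<in> span B" by (intro span_neg span_sum span_scale span_base)
    moreover have "(\<Sum>x\<in>A. f x *\<^sub>R x) = - (\<Sum>x\<in>B. f x *\<^sub>R x)"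
      using eq by (simp add: eq_neg_iff_add_eq_0)
    ultimately have A0: "(\<Sum>x\<in>A. f x *\<^sub>R x) = 0" using inA AB by auto
    then have B0: "(\<Sum>x\<in>B. f x *\<^sub>R x) = 0" using eq by simp
    show "f x = 0"
      using x independentD[OF A(2) A(1) order_refl A0] independentD[OF B(2) B(1) order_refl B0] by blast
  qed (use A B in simp)
qed

lemma span_Un_eq:
  assumes "subspace S" "A \<subseteq> S" "B \<subseteq> S" "\<And>x. x \<in> S \<Longrightarrow> \<exists>a\<in>span A. \<exists>b\<in>span B. x = a + b"
  shows "span (A \<union> B) = S"
proof
  show "span (A \<union> B) \<subseteq> S" using assms(1-3) by (intro span_minimal) auto
  show "S \<subseteq> span (A \<union> B)"
  proof
    fix x assume "x \<in> S"
    then obtain a b where "a \<in> span A" "b \<in> span B" "x = a + b" using assms(4) by blast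
    then show "x \<in> span (A \<union> B)"
      using span_mono[of A "A \<union> B"] span_mono[of B "A \<union> B"] span_add[of a "A \<union> B" b] by blast
  qed
qed

lemma representation_outside:
  fixes B :: "'v::real_vector set"
  assumes "independent B" "S \<subseteq> B" "x \<in> span S" "k \<notin> S"
  shows "representation B x k = 0"
  using representation_extend[OF assms(1,3,2)] representation_ne_zero[of S x k] assms(4) by metis

lemma representation_orthonormal:
  assumes ip: "inner_product_on W ip" and E: "orthonormal_basis ip E (\<lambda>x. x) W"
    and B: "independent B" "E \<subseteq> B" and x: "x \<in> W" and k: "k \<in> E"
  shows "representation B x k = ip x k"
proof -
  have indE: "independent E" using B dependent_mono by blast
  have fin: "finite E" and sp: "span E = W" using E by (auto simp: orthonormal_basis_def)
  have EW: "E \<subseteq> W" using sp span_superset by blast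
  have "representation B x k = representation E x k"
    using representation_extend[OF B(1) _ B(2)] x sp by simp
  also have "representation E x k = representation E (\<Sum>b\<in>E. ip x b *\<^sub>R b) k"
    using orthonormal_expansion[OF ip E x] by simp
  also have "\<dots> = (\<Sum>b\<in>E. representation E (ip x b *\<^sub>R b) k)"
    using span_base by (subst representation_sum[OF indE]) (auto intro: span_scale span_base)
  also have "\<dots> = (\<Sum>b\<in>E. if k = b then ip x b else 0)"
    using indE span_base[of _ E]
    by (intro sum.cong refl) (simp add: representation_scale representation_basis)
  finally show ?thesis using fin k by simp
qed

lemma transpose_on_eq:
  assumes ip: "inner_product_on V ip" and U: "U \<subseteq> V" and V: "subspace V"
    and E: "orthonormal_basis ip E e U"
    and f: "\<And>x. x \<in> U \<Longrightarrow> f x \<in> V" and lin: "linear f" and w: "w \<in> V"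
  shows "transpose_on ip U f w = (\<Sum>b\<in>E. ip (f (e b)) w *\<^sub>R e b)"
proof -
  have ipU: "inner_product_on U ip" by (rule ip_subset[OF ip U])
  have eU: "e b \<in> U" if "b \<in> E" for b by (rule orthonormal_basis_in[OF E that])
  have subU: "subspace U" by (rule orthonormal_basis_subspace[OF E])
  let ?t = "\<Sum>b\<in>E. ip (f (e b)) w *\<^sub>R e b"
  have tU: "?t \<in> U" using subU eU by (intro subspace_sum subspace_scale) auto
  have t: "ip (f x) w = ip x ?t" if x: "x \<in> U" for x
  proof -
    have "ip (f x) w = ip (\<Sum>b\<in>E. ip x (e b) *\<^sub>R f (e b)) w"
      using arg_cong[OF orthonormal_expansion[OF ipU E x], of f] lin by (simp add: linear_sum linear_scale)
    also have "\<dots> = (\<Sum>b\<in>E. ip x (e b) * ip (f (e b)) w)"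
      using f eU by (intro ip_sum_left[OF ip V w]) auto
    also have "\<dots> = ip x ?t"
      using eU by (subst ip_sum_right[OF ipU subU x]) (auto simp: mult.commute)
    finally show ?thesis .
  qed
  show ?thesis
    unfolding transpose_on_def
  proof (rule the_equality)
    fix v assume v: "v \<in> U \<and> (\<forall>x\<in>U. ip (f x) w = ip x v)"
    show "v = ?t"
    proof (rule orthonormal_basis_ext[OF ipU E])
      show "ip v (e i) = ip ?t (e i)" if "i \<in> E" for i
        using v t[OF eU[OF that]] eU[OF that] tU ip_sym[OF ipU] by metis
    qed (use v tU in auto)
  qed (use tU t in auto)
qed

lemma (in real_lie_algebra) linear_br: "linear (br x)" "linear (\<lambda>y. br y x)"
  by (simp_all add: linear_iff br_simps)

text \<open>Property (6) is the orthogonality of two operators for the Hilbert--Schmidt inner product.\<close>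

lemma (in real_lie_algebra) trace_transpose_br:
  assumes ip: "inner_product_on V ip" and U: "U \<subseteq> V" and V: "subspace V"
    and E: "orthonormal_basis ip E e U"
    and x: "\<And>v. v \<in> U \<Longrightarrow> br x v \<in> V" and y: "\<And>v. v \<in> U \<Longrightarrow> br y v \<in> V"
  shows "trace_on scaleR U (\<lambda>v. transpose_on ip U (br y) (br x v))
    = (\<Sum>b\<in>E. ip (br x (e b)) (br y (e b)))"
proof -
  have ipU: "inner_product_on U ip" by (rule ip_subset[OF ip U])
  have eU: "e b \<in> U" if "b \<in> E" for b by (rule orthonormal_basis_in[OF E that])
  have subU: "subspace U" by (rule orthonormal_basis_subspace[OF E])
  have t: "transpose_on ip U (br y) w = (\<Sum>b\<in>E. ip (br y (e b)) w *\<^sub>R e b)" if "w \<in> V" for w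
    by (rule transpose_on_eq[OF ip U V E y linear_br(1) that])
  have tU: "(\<Sum>b\<in>E. ip (br y (e b)) w *\<^sub>R e b) \<in> U" for w
    using subU eU by (intro subspace_sum subspace_scale) auto
  have "trace_on scaleR U (\<lambda>v. transpose_on ip U (br y) (br x v))
      = (\<Sum>b\<in>E. ip (transpose_on ip U (br y) (br x (e b))) (e b))"
  proof (rule trace_on_orthonormal[OF ipU E])
    fix v w assume v: "v \<in> U" and w: "w \<in> U"
    have "ip (br y (e b)) (br x v + br x w) = ip (br y (e b)) (br x v) + ip (br y (e b)) (br x w)"
      if "b \<in> E" for b
      using ip_add[OF ip x[OF v] x[OF w] y[OF eU[OF that]]] ip_sym[OF ip _ y[OF eU[OF that]]] x v w
        subspace_add[OF V x[OF v] x[OF w]] by metis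
    then show "transpose_on ip U (br y) (br x (v + w))
        = transpose_on ip U (br y) (br x v) + transpose_on ip U (br y) (br x w)"
      using subspace_add[OF V x[OF v] x[OF w]]
      by (simp add: br_add t x v w scaleR_add_left sum.distrib cong: sum.cong)
  next
    fix a v assume v: "v \<in> U"
    have "ip (br y (e b)) (a *\<^sub>R br x v) = a * ip (br y (e b)) (br x v)" if "b \<in> E" for b
      using ip_scale[OF ip x[OF v] y[OF eU[OF that]]] ip_sym[OF ip _ y[OF eU[OF that]]] x[OF v]
        subspace_scale[OF V x[OF v]] by metis
    then show "transpose_on ip U (br y) (br x (a *\<^sub>R v)) = a *\<^sub>R transpose_on ip U (br y) (br x v)"
      using subspace_scale[OF V x[OF v]]
      by (simp add: br_scale t x v scaleR_sum_right cong: sum.cong)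
  qed (use t tU x in auto)
  also have "\<dots> = (\<Sum>b\<in>E. ip (br x (e b)) (br y (e b)))"
  proof (rule sum.cong[OF refl])
    fix b assume b: "b \<in> E"
    have fin: "finite E" using E by (simp add: orthonormal_basis_def)
    have "ip (transpose_on ip U (br y) (br x (e b))) (e b)
        = (\<Sum>b'\<in>E. ip (br y (e b')) (br x (e b)) * ip (e b') (e b))"
      unfolding t[OF x[OF eU[OF b]]] using eU b by (intro ip_sum_left[OF ipU subU]) auto
    also have "\<dots> = (\<Sum>b'\<in>E. if b' = b then ip (br y (e b)) (br x (e b)) else 0)"
      using E b by (intro sum.cong) (auto simp: orthonormal_basis_def)
    also have "\<dots> = ip (br x (e b)) (br y (e b))"
      using fin b ip_sym[OF ip y[OF eU[OF b]] x[OF eU[OF b]]] by simp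
    finally show "ip (transpose_on ip U (br y) (br x (e b))) (e b) = ip (br x (e b)) (br y (e b))" .
  qed
  finally show ?thesis .
qed

text \<open>\<open>ad [x, y]\<close> is a commutator of linear maps, so its trace is zero.\<close>

lemma (in real_lie_algebra) trace_ad_bracket:
  assumes B: "finite B" "independent B" "span B = UNIV"
  shows "(\<Sum>l\<in>B. representation B (br (br x y) l) l) = 0"
proof -
  let ?r = "representation B"
  have expand: "(\<Sum>b\<in>B. ?r z b *\<^sub>R b) = z" for z
    by (rule sum_representation_eq) (use B in auto)
  have coeff: "?r (br x z) l = (\<Sum>b\<in>B. ?r z b * ?r (br x b) l)" for x z l
  proof -
    have "?r (br x (\<Sum>b\<in>B. ?r z b *\<^sub>R b)) l = (\<Sum>b\<in>B. ?r z b * ?r (br x b) l)"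
      using B by (simp add: linear_sum[OF linear_br(1)] br_scale representation_sum representation_scale)
    then show ?thesis by (simp add: expand)
  qed
  have "(\<Sum>l\<in>B. ?r (br x (br y l)) l) = (\<Sum>l\<in>B. \<Sum>b\<in>B. ?r (br y l) b * ?r (br x b) l)"
    by (simp only: coeff[of x "br y _"])
  also have "\<dots> = (\<Sum>b\<in>B. \<Sum>l\<in>B. ?r (br x b) l * ?r (br y l) b)"
    by (subst sum.swap) (simp add: mult.commute)
  also have "\<dots> = (\<Sum>l\<in>B. ?r (br y (br x l)) l)"
    by (simp only: coeff[of y "br x _"])
  finally have "(\<Sum>l\<in>B. ?r (br x (br y l)) l - ?r (br y (br x l)) l) = 0"
    by (simp add: sum_subtractf)
  moreover have "?r (br (br x y) l) l = ?r (br x (br y l)) l - ?r (br y (br x l)) l" for l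
  proof -
    have "br (br x y) l = br x (br y l) - br y (br x l)" using br_deriv[of x y l] by simp
    then show ?thesis using B by (simp add: representation_diff)
  qed
  ultimately show ?thesis by simp
qed

text \<open>Grouping all summands but one into their joint span \<open>R\<close>, which has a basis consisting of
  vectors of the individual summands.\<close>

lemma direct_sum_others:
  assumes ds: "direct_sum n I W" and j: "j \<in> I"
  defines "R \<equiv> span (\<Union>i\<in>I - {j}. W i)"
  shows "W j \<inter> R \<subseteq> {0}" "\<And>x. x \<in> n \<Longrightarrow> \<exists>a\<in>W j. \<exists>b\<in>R. x = a + b" "W j \<subseteq> n" "\<And>i. i \<in> I \<Longrightarrow> W i \<subseteq> n"
proof -
  have fin: "finite I" and sub: "\<And>i. i \<in> I \<Longrightarrow> subspace (W i)"
    and n: "n = {\<Sum>i\<in>I. w i | w. \<forall>i\<in>I. w i \<in> W i}"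
    and uniq: "\<And>w. (\<forall>i\<in>I. w i \<in> W i) \<Longrightarrow> (\<Sum>i\<in>I. w i) = 0 \<Longrightarrow> \<forall>i\<in>I. w i = 0"
    using ds by (auto simp: direct_sum_def)
  have R: "\<exists>w. (\<forall>i\<in>I. w i \<in> W i) \<and> w j = 0 \<and> x = (\<Sum>i\<in>I. w i)" if "x \<in> R" for x
    using that unfolding R_def
  proof (induction rule: span_induct_alt)
    case base
    show ?case using sub subspace_0 by (intro exI[of _ "\<lambda>_. 0"]) auto
  next
    case (step a x y)
    then obtain w i where w: "\<forall>i\<in>I. w i \<in> W i" "w j = 0" "y = (\<Sum>i\<in>I. w i)"
      and i: "i \<in> I" "i \<noteq> j" "x \<in> W i" by auto
    let ?w = "\<lambda>k. w k + (if k = i then a *\<^sub>R x else 0)"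
    have "(\<Sum>k\<in>I. ?w k) = a *\<^sub>R x + y" using fin i w by (simp add: sum.distrib add.commute)
    moreover have "\<forall>k\<in>I. ?w k \<in> W k"
      using w(1) i sub by (auto intro: subspace_add subspace_scale)
    ultimately show ?case using w(2) i(2) by (intro exI[of _ ?w]) auto
  qed
  show "W j \<inter> R \<subseteq> {0}"
  proof
    fix x assume x: "x \<in> W j \<inter> R"
    then obtain w where w: "\<forall>i\<in>I. w i \<in> W i" "w j = 0" "x = (\<Sum>i\<in>I. w i)" using R by blast
    let ?w = "\<lambda>k. w k + (if k = j then - x else 0)"
    have "(\<Sum>k\<in>I. ?w k) = 0" using fin j w by (simp add: sum.distrib)
    moreover have "\<forall>k\<in>I. ?w k \<in> W k"
      using w(1,2) x j sub by (auto intro: subspace_neg)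
    ultimately have "?w j = 0" using uniq[of ?w] j by blast
    then show "x \<in> {0}" using w(2) by simp
  qed
  show Wn: "W i \<subseteq> n" if i: "i \<in> I" for i
  proof
    fix x assume x: "x \<in> W i"
    have "x = (\<Sum>k\<in>I. if k = i then x else 0)" using fin i by simp
    moreover have "\<forall>k\<in>I. (if k = i then x else 0) \<in> W k" using x sub subspace_0 by auto
    ultimately show "x \<in> n" unfolding n by blast
  qed
  show "W j \<subseteq> n" by (rule Wn[OF j])
  show "\<exists>a\<in>W j. \<exists>b\<in>R. x = a + b" if x: "x \<in> n" for x
  proof -
    obtain w where w: "\<forall>i\<in>I. w i \<in> W i" "x = (\<Sum>i\<in>I. w i)" using x unfolding n by blast
    have "x = w j + (\<Sum>i\<in>I - {j}. w i)" using fin j w(2) by (simp add: sum.remove)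
    moreover have "(\<Sum>i\<in>I - {j}. w i) \<in> R"
      unfolding R_def using w(1) by (intro span_sum span_base) auto
    ultimately show ?thesis using w(1) j by blast
  qed
qed

theorem theorem5p2:
  fixes br :: "'a::real_vector \<Rightarrow> 'a \<Rightarrow> 'a"
    and Z :: 'a
    and u l n :: "'a set"
    and k :: nat and \<nn> :: "nat \<Rightarrow> 'a set"
    and h :: "('a \<times> 'a) set"
    and \<Delta> \<Delta>p :: "('a \<times> 'a \<Rightarrow> complex) set"
    and Hv X :: "('a \<times> 'a \<Rightarrow> complex) \<Rightarrow> 'a \<times> 'a"
    and j :: nat and V1 V2 :: "'a set" and ipj :: "'a \<Rightarrow> 'a \<Rightarrow> real"
  assumes g: "lie_algebra scaleR (UNIV :: 'a set) br"
    and g_findim: "\<exists>B :: 'a set. finite B \<and> span B = UNIV"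
    and u_sub: "lie_subalgebra scaleR UNIV br u"
    and u_compact: "compact_semisimple u br"
    and n_ideal: "lie_ideal scaleR UNIV br n"
    and n_nilpotent: "nilpotent_lie scaleR n br"
    and Z_nonzero: "Z \<noteq> 0"
    and Z_commutes: "\<And>x. x \<in> u \<Longrightarrow> br Z x = 0"
    and g_decomp: "direct_sum2 l (span {Z}) u" "direct_sum2 UNIV l n"
    and n_decomp: "direct_sum n {1..k} \<nn>"
    and n_irred: "\<And>i. i \<in> {1..k} \<Longrightarrow> irreducible_module u br (\<nn> i)"
    and root_data: "compact_root_data br u h \<Delta> \<Delta>p Hv X"
    and j: "j \<in> {1..k}"
    and adapted: "adapted_decomposition \<Delta> \<Delta>p Hv X br (\<nn> j) V1 V2 ipj"
    and Z_acts: "\<And>i. i \<in> {1..k} \<Longrightarrow> \<exists>c>0. \<forall>v\<in>\<nn> i. br Z v = c *\<^sub>R v"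
  shows "\<exists>ip. inner_product_on (UNIV :: 'a set) ip \<and> negative_ricci br ip"
proof -
  interpret compact_roots br u h \<Delta> \<Delta>p Hv X
    by (intro compact_roots.intro real_lie_algebra.intro compact_roots_axioms.intro)
      (fact g, fact u_sub, fact u_compact, fact root_data)
  obtain B0 :: "'a set" where B0: "finite B0" "span B0 = UNIV" using g_findim by blast
  have fin_indep: "finite C" if "independent C" for C :: "'a set"
    using independent_span_bound[OF B0(1) that] B0(2) by simp
  have ex_basis: "\<exists>C. C \<subseteq> S \<and> finite C \<and> independent C \<and> span C = span S" for S :: "'a set"
  proof -
    obtain C where C: "C \<subseteq> S" "independent C" "S \<subseteq> span C"
      using maximal_independent_subset[of S] by blast
    have "span C = span S"
      using span_mono[OF C(1)] span_minimal[OF C(3) subspace_span] by blast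
    then show ?thesis using C fin_indep by blast
  qed
  have sub_u: "subspace u" and br_u: "\<And>x y. x \<in> u \<Longrightarrow> y \<in> u \<Longrightarrow> br x y \<in> u"
    using u_sub by (auto simp: lie_subalgebra_def subspace_raw_def)
  have sub_n: "subspace n" using n_ideal by (simp add: lie_ideal_def subspace_raw_def)
  \<comment> \<open>The components other than \<open>\<nn> j\<close>. A basis of their sum that is extracted from their union consists of
     eigenvectors of \<open>ad Z\<close>.\<close>
  define R where "R = (\<Union>i\<in>{1..k} - {j}. \<nn> i)"
  note others = direct_sum_others[OF n_decomp j, folded R_def]
  have sub_nn: "subspace (\<nn> i)" and br_nn: "\<And>x v. x \<in> u \<Longrightarrow> v \<in> \<nn> i \<Longrightarrow> br x v \<in> \<nn> i"
    and nn_nonzero: "\<nn> i \<noteq> {0}" if "i \<in> {1..k}" for i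
    using n_irred[OF that] by (auto simp: irreducible_module_def invariant_under_def)
  have br_R: "br x v \<in> span R" if x: "x \<in> u" and v: "v \<in> span R" for x v
  proof -
    have "br x ` span R = span (br x ` R)" by (rule linear_span_image[OF linear_br(1), symmetric])
    also have "\<dots> \<subseteq> span R"
      using br_nn[OF _ x] by (intro span_mono) (auto simp: R_def)
    finally show ?thesis using v by blast
  qed
  have R_n: "span R \<subseteq> n"
  proof (rule span_minimal[OF _ sub_n])
    show "R \<subseteq> n" unfolding R_def using others(4) by blast
  qed

  note ad = adapted[unfolded adapted_decomposition_def]
  have ds: "direct_sum2 (\<nn> j) V1 V2" by (rule ad[THEN conjunct1])
  note ad = ad[THEN conjunct2]
  have ipj: "inner_product_on (\<nn> j) ipj" by (rule ad[THEN conjunct1])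
  note ad = ad[THEN conjunct2]
  have inv1: "invariant_under (ihR \<Delta> Hv) br V1" by (rule ad[THEN conjunct1, THEN conjunct1])
  note ad = ad[THEN conjunct2]
  have swap: "br (xx \<alpha>) ` V1 \<subseteq> V2 \<and> br (yy \<alpha>) ` V1 \<subseteq> V2" if "\<alpha> \<in> \<Delta>p" for \<alpha>
    unfolding xx_def yy_def by (rule ad[THEN conjunct1, rule_format, OF that])
  note ad = ad[THEN conjunct2, THEN conjunct2, THEN conjunct2]
  have nonzero: "(\<exists>v\<in>V1. br (xx \<alpha>) v \<noteq> 0) \<and> (\<exists>v\<in>V1. br (yy \<alpha>) v \<noteq> 0)" if "\<alpha> \<in> \<Delta>p" for \<alpha>
    unfolding xx_def yy_def by (rule ad[THEN conjunct1, rule_format, OF that])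
  have orth: "trace_on scaleR V1 (\<lambda>v. transpose_on ipj V1 (br y) (br x v)) = 0"
    if "x \<in> fst ` (Xup X ` \<Delta>p \<union> Yup X ` \<Delta>p)" "y \<in> fst ` (Xup X ` \<Delta>p \<union> Yup X ` \<Delta>p)" "x \<noteq> y" for x y
    by (rule ad[THEN conjunct2, rule_format, OF that])
  have sub_V: "subspace V1" "subspace V2" and V12: "V1 \<inter> V2 = {0}"
    and nj_eq: "\<nn> j = {a + b | a b. a \<in> V1 \<and> b \<in> V2}"
    using ds by (auto simp: direct_sum2_def)
  have V_nj: "V1 \<subseteq> \<nn> j" "V2 \<subseteq> \<nn> j"
  proof -
    show "V1 \<subseteq> \<nn> j" unfolding nj_eq using subspace_0[OF sub_V(2)] by force
    show "V2 \<subseteq> \<nn> j" unfolding nj_eq using subspace_0[OF sub_V(1)] by force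
  qed

  obtain Bh where Bh: "Bh \<subseteq> tt ` \<Delta>" "finite Bh" "independent Bh" "span Bh = span (tt ` \<Delta>)"
    using ex_basis by blast
  define Bp where "Bp = pv ` (\<Delta>p \<times> UNIV)"
  have pv_zero: "\<forall>i\<in>F. f i = 0"
    if "finite F" "F \<subseteq> \<Delta>p \<times> UNIV" "(\<Sum>i\<in>F. f i *\<^sub>R pv i) = 0" for F f
    using pv_independent(2)[OF that(1,2) span_zero, of f] that(3) by auto
  have pv_inj: "inj_on pv (\<Delta>p \<times> UNIV)" by (rule independent_family(1)[OF pv_zero])
  have Bp_ind: "independent Bp" unfolding Bp_def by (rule independent_family(2)[OF pv_zero])
  have Bp_fin: "finite Bp" by (rule fin_indep[OF Bp_ind])
  have ex_on: "\<exists>E. orthonormal_basis ipj E (\<lambda>x. x) W" if W: "subspace W" "W \<subseteq> \<nn> j" for W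
  proof -
    obtain C where "finite C" "span C = span W" using ex_basis by blast
    then have C: "finite C" "span C = W" using W(1) by (simp_all add: span_eq_iff)
    then show ?thesis using ex_orthonormal_basis[of C ipj] ip_subset[OF ipj W(2)] by simp
  qed
  obtain B1 where B1: "orthonormal_basis ipj B1 (\<lambda>x. x) V1" using ex_on[OF sub_V(1) V_nj(1)] by blast
  obtain B2 where B2: "orthonormal_basis ipj B2 (\<lambda>x. x) V2" using ex_on[OF sub_V(2) V_nj(2)] by blast
  have B12: "finite B1" "span B1 = V1" "finite B2" "span B2 = V2"
    using B1 B2 by (auto simp: orthonormal_basis_def)
  obtain Bo where Bo: "Bo \<subseteq> R" "finite Bo" "independent Bo" "span Bo = span R"
    using ex_basis by blast
  have B12_ind: "independent B1" "independent B2"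
    using orthonormal_basis_independent[OF ip_subset[OF ipj V_nj(1)] B1]
      orthonormal_basis_independent[OF ip_subset[OF ipj V_nj(2)] B2] .

  \<comment> \<open>The bases of \<open>\<real> Z\<close>, of the torus, of the span of the \<open>X\<^sup>\<alpha>\<close> and \<open>Y\<^sup>\<alpha>\<close>, of \<open>V1\<close>, \<open>V2\<close> and of the other
     components are joined along the given direct sum decompositions.\<close>
  have hp: "span Bh \<inter> span Bp \<subseteq> {0}"
  proof
    fix x assume x: "x \<in> span Bh \<inter> span Bp"
    then have "x \<in> range (\<lambda>f. \<Sum>b\<in>Bp. f b *\<^sub>R b)" using span_finite[OF Bp_fin] by auto
    then obtain f where f: "x = (\<Sum>b\<in>Bp. f b *\<^sub>R b)" by blast
    have "x = (\<Sum>i\<in>\<Delta>p \<times> UNIV. f (pv i) *\<^sub>R pv i)"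
      unfolding f Bp_def by (simp add: sum.reindex[OF pv_inj])
    then have sum0: "x + (\<Sum>i\<in>\<Delta>p \<times> UNIV. (- f (pv i)) *\<^sub>R pv i) = 0"
      by (simp add: sum_negf)
    have fin: "finite (\<Delta>p \<times> (UNIV :: bool set))"
      using Bp_fin pv_inj finite_imageD unfolding Bp_def by blast
    have "x \<in> span (tt ` \<Delta>)" using x Bh(4) by blast
    from pv_independent(1)[OF fin order_refl this sum0] show "x \<in> {0}" by simp
  qed
  have u_span': "span (Bh \<union> Bp) = u"
  proof
    have "Bp \<subseteq> u"
      unfolding Bp_def using real_form(5,6)[OF pos_root] sub_u
      by (auto simp: pv_def intro: subspace_scale)
    then show "span (Bh \<union> Bp) \<subseteq> u"
      using Bh(1) real_form(4) sub_u by (intro span_minimal) auto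
    have "xx \<alpha> \<in> span (Bh \<union> Bp) \<and> yy \<alpha> \<in> span (Bh \<union> Bp)" if "\<alpha> \<in> \<Delta>p" for \<alpha>
    proof -
      have "pv (\<alpha>, True) \<in> span (Bh \<union> Bp)" "2 *\<^sub>R pv (\<alpha>, False) \<in> span (Bh \<union> Bp)"
        using that by (auto simp: Bp_def intro!: span_base span_scale)
      then show ?thesis by (simp add: pv_def)
    qed
    moreover have "tt ` \<Delta> \<subseteq> span (Bh \<union> Bp)"
      using Bh(4) span_superset[of "tt ` \<Delta>"] span_mono[of Bh "Bh \<union> Bp"] by blast
    ultimately show "u \<subseteq> span (Bh \<union> Bp)"
      unfolding u_eq by (intro span_minimal) auto
  qed
  have ind_u: "independent (Bh \<union> Bp)" and dis_u: "Bh \<inter> Bp = {}"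
    using independent_Un_span[OF Bh(2,3) Bp_fin Bp_ind hp] .
  note dl = g_decomp(1)[unfolded direct_sum2_def] and dg = g_decomp(2)[unfolded direct_sum2_def]
  have Zu: "span {Z} \<inter> u = {0}" by (rule dl[THEN conjunct2, THEN conjunct2, THEN conjunct1])
  have l_eq: "l = {a + b | a b. a \<in> span {Z} \<and> b \<in> u}"
    by (rule dl[THEN conjunct2, THEN conjunct2, THEN conjunct2])
  have sub_l: "subspace l" by (rule dg[THEN conjunct1])
  have ln: "l \<inter> n = {0}" by (rule dg[THEN conjunct2, THEN conjunct2, THEN conjunct1])
  have g_eq: "UNIV = {a + b | a b. a \<in> l \<and> b \<in> n}"
    by (rule dg[THEN conjunct2, THEN conjunct2, THEN conjunct2])
  have ind_l: "independent ({Z} \<union> (Bh \<union> Bp))" and dis_l: "{Z} \<inter> (Bh \<union> Bp) = {}"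
    using independent_Un_span[of "{Z}" "Bh \<union> Bp"] Z_nonzero Bh(2) Bp_fin ind_u Zu u_span' by auto
  have span_l: "span ({Z} \<union> (Bh \<union> Bp)) = l"
  proof (rule span_Un_eq[OF sub_l])
    show "{Z} \<subseteq> l" unfolding l_eq using subspace_0[OF sub_u] span_base[of Z "{Z}"] by force
    show "Bh \<union> Bp \<subseteq> l"
      unfolding l_eq using span_zero[of "{Z}"] u_span' span_superset[of "Bh \<union> Bp"] by force
    show "\<exists>a\<in>span {Z}. \<exists>b\<in>span (Bh \<union> Bp). x = a + b" if "x \<in> l" for x
      using that unfolding l_eq u_span' by blast
  qed
  have ind_nj: "independent (B1 \<union> B2)" and dis_nj: "B1 \<inter> B2 = {}"
    using independent_Un_span[OF B12(1) B12_ind(1) B12(3) B12_ind(2)] B12 V12 by auto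
  have span_nj: "span (B1 \<union> B2) = \<nn> j"
  proof (rule span_Un_eq[OF sub_nn[OF j]])
    show "B1 \<subseteq> \<nn> j" "B2 \<subseteq> \<nn> j" using span_superset[of B1] span_superset[of B2] V_nj unfolding B12 by blast+
    show "\<exists>a\<in>span B1. \<exists>b\<in>span B2. x = a + b" if "x \<in> \<nn> j" for x
      using that unfolding nj_eq B12 by blast
  qed
  have ind_n: "independent ((B1 \<union> B2) \<union> Bo)" and dis_n: "(B1 \<union> B2) \<inter> Bo = {}"
    using independent_Un_span[of "B1 \<union> B2" Bo] B12 Bo ind_nj span_nj others(1) by auto
  have span_n: "span ((B1 \<union> B2) \<union> Bo) = n"
  proof (rule span_Un_eq[OF sub_n])
    show "B1 \<union> B2 \<subseteq> n" using span_superset[of "B1 \<union> B2"] unfolding span_nj using others(3) by (rule order_trans)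
    show "Bo \<subseteq> n" using span_superset[of Bo] unfolding Bo(4) using R_n by (rule order_trans)
    show "\<exists>a\<in>span (B1 \<union> B2). \<exists>b\<in>span Bo. x = a + b" if "x \<in> n" for x
      using others(2)[OF that] unfolding span_nj Bo by blast
  qed
  define Bn where "Bn = (B1 \<union> B2) \<union> Bo"
  define B where "B = ({Z} \<union> (Bh \<union> Bp)) \<union> Bn"
  have fin_n: "finite Bn" using B12 Bo by (simp add: Bn_def)
  have ind_B: "independent B" and dis_B: "({Z} \<union> (Bh \<union> Bp)) \<inter> Bn = {}"
    unfolding B_def
    using independent_Un_span[of "{Z} \<union> (Bh \<union> Bp)" Bn] Bh(2) Bp_fin ind_l fin_n ind_n span_l span_n ln
    by (auto simp: Bn_def)
  have span_B: "span B = UNIV"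
    unfolding B_def
  proof (rule span_Un_eq)
    show "\<exists>a\<in>span ({Z} \<union> (Bh \<union> Bp)). \<exists>b\<in>span Bn. x = a + b" if "x \<in> UNIV" for x
      using that g_eq unfolding span_l Bn_def span_n by blast
  qed auto
  have fin_B: "finite B" using Bh(2) Bp_fin fin_n by (simp add: B_def)
  define c where "c i j k = representation B (br i j) k" for i j k
  define d :: "'a \<Rightarrow> nat" where
    "d b = (if b \<in> B2 then 3 else if b \<in> B1 \<union> Bo then 2 else if b \<in> Bp then 1 else 0)" for b
  have Bsub: "Bh \<subseteq> B" "Bp \<subseteq> B" "B1 \<subseteq> B" "B2 \<subseteq> B" "Bo \<subseteq> B" "Z \<in> B" "Bn \<subseteq> B"
    by (auto simp: B_def Bn_def)
  have d_Z: "d Z = 0" using dis_B dis_l by (auto simp: d_def Bn_def)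
  have d_h: "d b = 0" if "b \<in> Bh" for b using that dis_B dis_u by (auto simp: d_def Bn_def)
  have d_p: "d b = 1" if "b \<in> Bp" for b using that dis_B by (auto simp: d_def Bn_def)
  have d_1: "d b = 2" if "b \<in> B1 \<union> Bo" for b using that dis_nj dis_n by (auto simp: d_def)
  have d_2: "d b = 3" if "b \<in> B2" for b using that by (simp add: d_def)
  have B_cases: "b = Z \<or> b \<in> Bh \<or> b \<in> Bp \<or> b \<in> B1 \<or> b \<in> Bo \<or> b \<in> B2" if "b \<in> B" for b
    using that by (auto simp: B_def Bn_def)
  have deg0: "b = Z \<or> b \<in> Bh" if "b \<in> B" "d b = 0" for b
    using B_cases[OF that(1)] that(2) d_p d_1 d_2 by fastforce
  have deg1: "b \<in> Bp" if "b \<in> B" "d b = 1" for b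
    using B_cases[OF that(1)] that(2) d_Z d_h d_1 d_2 by fastforce
  have deg2: "b \<in> B1 \<union> Bo" if "b \<in> B" "d b = 2" for b
    using B_cases[OF that(1)] that(2) d_Z d_h d_p d_2 by fastforce
  have deg_high: "b \<in> Bn" if "b \<in> B" "d b \<ge> 2" for b
    using B_cases[OF that(1)] that(2) d_Z d_h d_p by (fastforce simp: Bn_def)
  have d_n: "d b \<ge> 2" if "b \<in> Bn" for b using that d_1 d_2 by (fastforce simp: Bn_def)
  have d_le: "d b \<le> 3" for b by (simp add: d_def)
  have c_out: "c i j k = 0" if "br i j \<in> span S" "S \<subseteq> B" "k \<notin> S" for i j k S
    unfolding c_def by (rule representation_outside[OF ind_B that(2,1,3)])
  have c_zero: "c i j k = 0" if "br i j = 0" for i j k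
    using that by (simp add: c_def representation_zero)
  have c_anti: "c j i k = - c i j k" for i j k
    using br_anti[of j i] span_B ind_B by (simp add: c_def representation_neg)
  have in_u: "b \<in> u" if "b \<in> Bh \<union> Bp" for b using span_base[OF that] unfolding u_span' .
  have Z_u: "br Z b = 0" if "b \<in> insert Z (Bh \<union> Bp)" for b
    using that Z_commutes[OF in_u] by (auto simp: br_self)
  have hh: "br a b = 0" if "a \<in> Bh" "b \<in> Bh" for a b
    using that Bh(1) torus_commutes by blast
  have h_p: "br a b \<in> span Bp" if a: "a \<in> Bh" and b: "b \<in> Bp" for a b
  proof -
    obtain \<beta> where \<beta>: "\<beta> \<in> \<Delta>" "a = tt \<beta>" using a Bh(1) by blast
    obtain \<alpha> s where \<alpha>: "\<alpha> \<in> \<Delta>p" "b = pv (\<alpha>, s)" using b by (auto simp: Bp_def)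
    have p: "pv (\<alpha>, t) \<in> span Bp" for t using \<alpha>(1) by (auto simp: Bp_def intro!: span_base)
    have "xx \<alpha> \<in> span Bp" "yy \<alpha> \<in> span Bp"
      using p[of True] span_scale[OF p[of False], of 2] by (simp_all add: pv_def)
    then show ?thesis
      unfolding \<alpha>(2) \<beta>(2) pv_def using torus_action[OF pos_root[OF \<alpha>(1)] \<beta>(1)]
      by (auto simp: br_scale intro!: span_scale span_neg)
  qed
  have h_1: "br a b \<in> span B1" if "a \<in> Bh" "b \<in> B1" for a b
    using inv1 that Bh(4) span_base[of a Bh] span_base[of b B1]
    unfolding invariant_under_def ihR_eq B12 by blast
  have u_o: "br a b \<in> span Bo" if "a \<in> u" "b \<in> Bo" for a b
    using br_R[OF that(1)] Bo(4) span_base[OF that(2)] by simp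
  have p_p: "br a b \<in> span (Bh \<union> Bp)" if "a \<in> Bp" "b \<in> Bp" for a b
    using br_u in_u that u_span' by simp
  have "\<exists>\<gamma>>0. br Z b = \<gamma> *\<^sub>R b" if "b \<in> Bn" for b
  proof -
    have "\<exists>i\<in>{1..k}. b \<in> \<nn> i"
    proof (cases "b \<in> Bo")
      case True
      then show ?thesis using Bo(1) by (auto simp: R_def)
    next
      case False
      then have "b \<in> B1 \<union> B2" using that by (simp add: Bn_def)
      from span_base[OF this] have "b \<in> \<nn> j" unfolding span_nj .
      then show ?thesis using j by blast
    qed
    then show ?thesis using Z_acts by blast
  qed
  then obtain \<gamma> where \<gamma>: "\<And>b. b \<in> Bn \<Longrightarrow> \<gamma> b > 0 \<and> br Z b = \<gamma> b *\<^sub>R b" by metis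
  have Z_n: "c Z a b = (if b = a then \<gamma> a else 0)" if "a \<in> Bn" for a b
    using \<gamma>[OF that] that Bsub(7) ind_B span_base[of a B]
    by (auto simp: c_def representation_scale representation_basis)

  \<comment> \<open>Only total degrees below \<open>3\<close> need an argument, because no basis vector has degree above \<open>3\<close>.\<close>
  have filt: "d k \<le> d i + d j" if ijk: "i \<in> B" "j \<in> B" "k \<in> B" and nz: "c i j k \<noteq> 0" for i j k
  proof -
    have half: "d k \<le> d i + d j" if ij: "i \<in> B" "j \<in> B" and nz: "c i j k \<noteq> 0" and le: "d i \<le> d j" for i j
    proof -
      have in_S: "k \<in> S" if "br i j \<in> span S" "S \<subseteq> B" for S using c_out[OF that] nz by blast
      consider "d i + d j \<ge> 3" | "d i = 0" "d j = 0" | "d i = 0" "d j = 1" | "d i = 0" "d j = 2"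
        | "d i = 1" "d j = 1" using le by linarith
      then show ?thesis
      proof cases
        case 1
        then show ?thesis using d_le[of k] by linarith
      next
        case 2
        then have "br i j = 0"
          using deg0[OF ij(1)] deg0[OF ij(2)] Z_u hh br_anti[of i Z] by (auto simp: br_self)
        then show ?thesis using c_zero nz by blast
      next
        case 3
        note j = deg1[OF ij(2) 3(2)]
        have "br i j \<in> span Bp" using deg0[OF ij(1) 3(1)] h_p[OF _ j] Z_u[of j] j span_zero by auto
        then show ?thesis using in_S[of Bp] Bsub d_p 3 by auto
      next
        case 4
        note j = deg2[OF ij(2) 4(2)]
        show ?thesis
        proof (cases "i = Z")
          case True
          have "j \<in> Bn" using j by (auto simp: Bn_def)
          then have "k = j" using Z_n nz True by (auto split: if_splits)
          then show ?thesis by simp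
        next
          case False
          then have i: "i \<in> Bh" using deg0[OF ij(1) 4(1)] by blast
          have "k \<in> B1 \<union> Bo"
            using j in_S[of B1] in_S[of Bo] h_1[OF i] u_o[OF in_u] i Bsub by auto
          then show ?thesis using d_1 4 by simp
        qed
      next
        case 5
        then have "k \<in> Bh \<union> Bp" using in_S[of "Bh \<union> Bp"] p_p deg1 ij Bsub by auto
        then show ?thesis using d_h d_p 5 by auto
      qed
    qed
    show ?thesis
    proof (cases "d i \<le> d j")
      case True
      then show ?thesis using half ijk nz by blast
    next
      case False
      then show ?thesis using half[of j i] ijk nz c_anti[of j i k] by simp
    qed
  qed

  have "\<exists>\<kappa>. (\<forall>b. \<kappa> b > 0) \<and>
      (\<forall>x. (\<exists>i\<in>B. x i \<noteq> 0) \<longrightarrow> ricci_form B (graded_part d \<kappa> c) x < 0)"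
  proof (rule ex_weights_ricci_form_graded_negative[where Z = Z and \<gamma> = \<gamma>])
    show "finite B" by (rule fin_B)
    show "Z \<in> B" by (rule Bsub)
    show "d Z = 0" by (rule d_Z)
    show "c j i k = - c i j k" for i j k by (rule c_anti)
    show "c Z j k = 0" if "j \<in> B" "d j \<le> 1" for j k
    proof (rule c_zero, rule Z_u)
      have "d j = 0 \<or> d j = 1" using that(2) by linarith
      then show "j \<in> insert Z (Bh \<union> Bp)" using deg0[OF that(1)] deg1[OF that(1)] by blast
    qed
    show "c Z j k = (if k = j then \<gamma> j else 0)" if "j \<in> B" "d j \<ge> 2" for j k
      by (rule Z_n[OF deg_high[OF that]])
    show "c i j k = 0" if "i \<in> B" "j \<in> B" "d i = 0" "d j = 0" for i j k
    proof (rule c_zero)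
      show "br i j = 0"
        using deg0[OF that(1,3)] deg0[OF that(2,4)] Z_u hh br_anti[of i Z] by (auto simp: br_self)
    qed
    show "(\<Sum>l\<in>B. c i l l) = 0" if i: "i \<in> B" "i \<noteq> Z" "d i = 0" for i
    proof -
      obtain \<alpha> where \<alpha>: "\<alpha> \<in> \<Delta>" "i = tt \<alpha>" using deg0[OF i(1,3)] i(2) Bh(1) by blast
      have "i = br ((1/2) *\<^sub>R xx \<alpha>) (yy \<alpha>)" using br_xx_yy[OF \<alpha>(1)] \<alpha>(2) by (simp add: br_scale)
      then show ?thesis unfolding c_def using trace_ad_bracket[OF fin_B ind_B span_B] by metis
    qed
    show "\<gamma> j > 0" if "j \<in> B" "d j \<ge> 2" for j using \<gamma>[OF deg_high[OF that]] by blast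
    show "\<exists>j\<in>B. d j \<ge> 2"
    proof -
      have "Bn \<noteq> {}"
      proof
        assume "Bn = {}"
        then have "B1 \<union> B2 = {}" by (simp add: Bn_def)
        from span_nj[unfolded this span_empty] nn_nonzero[OF j] show False by simp
      qed
      then show ?thesis using d_n Bsub(7) by blast
    qed
    show "\<forall>b\<in>B. y b = 0"
      if supp: "\<And>b. y b \<noteq> 0 \<Longrightarrow> d b = 0 \<and> b \<noteq> Z"
        and skew: "\<And>k l. k \<in> B \<Longrightarrow> l \<in> B \<Longrightarrow> d k = 1 \<Longrightarrow> d l = 1 \<Longrightarrow>
          (\<Sum>b\<in>B. y b * (c b k l + c b l k)) = 0" for y
    proof -
      \<comment> \<open>If \<open>ad H\<close> rotates the plane of \<open>X\<^sup>\<alpha>\<close> and \<open>Y\<^sup>\<alpha> / 2\<close> with speed \<open>\<theta>\<close>, then \<open>skew\<close> for these two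
         vectors reads \<open>2 * \<theta> - \<theta> / 2 = 0\<close>.\<close>
      define H where "H = (\<Sum>b\<in>Bh. y b *\<^sub>R b)"
      have supp_h: "b \<in> Bh" if "b \<in> B" "y b \<noteq> 0" for b using supp[OF that(2)] deg0[OF that(1)] by blast
      have H_B: "H = (\<Sum>b\<in>B. y b *\<^sub>R b)"
        unfolding H_def
      proof (rule sum.mono_neutral_left[OF fin_B Bsub(1)], rule ballI)
        fix b assume "b \<in> B - Bh"
        then have "y b = 0" using supp_h by blast
        then show "y b *\<^sub>R b = 0" by simp
      qed
      have H_span: "H \<in> span (tt ` \<Delta>)"
        unfolding H_def Bh(4)[symmetric] by (intro span_sum span_scale span_base)
      have coeff: "(\<Sum>b\<in>B. y b * c b k l) = representation B (br H k) l" for k l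
        unfolding H_B c_def using ind_B span_B
        by (simp add: linear_sum[OF linear_br(2)] br_scale representation_sum representation_scale)
      have H_xy: "br H (xx \<alpha>) = 0 \<and> br H (yy \<alpha>) = 0" if \<alpha>: "\<alpha> \<in> \<Delta>p" for \<alpha>
      proof -
        obtain \<theta> where \<theta>: "br H (xx \<alpha>) = \<theta> *\<^sub>R yy \<alpha>" "br H (yy \<alpha>) = - (\<theta> *\<^sub>R xx \<alpha>)"
          using torus_span_action[OF H_span pos_root[OF \<alpha>]] by blast
        let ?p = "pv (\<alpha>, True)" and ?q = "pv (\<alpha>, False)"
        have pq: "?p \<in> Bp" "?q \<in> Bp" using \<alpha> by (auto simp: Bp_def)
        have "br H ?p = (2 * \<theta>) *\<^sub>R ?q" "br H ?q = (- \<theta> / 2) *\<^sub>R ?p"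
          using \<theta> by (simp_all add: pv_def br_scale)
        then have "representation B (br H ?p) ?q = 2 * \<theta>" "representation B (br H ?q) ?p = - \<theta> / 2"
          using pq Bsub(2) ind_B span_B by (auto simp: representation_scale representation_neg representation_basis)
        moreover have "(\<Sum>b\<in>B. y b * (c b ?p ?q + c b ?q ?p)) = 0"
          using skew pq d_p Bsub(2) by auto
        ultimately have "\<theta> = 0" by (simp add: distrib_left sum.distrib coeff)
        then show ?thesis using \<theta> by simp
      qed
      have "H = 0" using torus_faithful[OF H_span] H_xy by blast
      then have "y b = 0" if "b \<in> Bh" for b
        using independentD[OF Bh(3) Bh(2) order_refl, of y] that by (simp add: H_def)
      then show ?thesis using supp_h by blast
    qed
    \<comment> \<open>Properties (5) and (6) concern the unscaled \<open>X\<^sup>\<alpha>\<close> and \<open>Y\<^sup>\<alpha>\<close>, and (6) requires distinct elements of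
       \<open>u\<close>; \<open>q\<close> and the factor \<open>s\<close> translate, and \<open>q_inj\<close> turns distinct indices into distinct elements.\<close>
    define q where "q i = (if snd i then xx (fst i) else yy (fst i))" for i :: "('a \<times> 'a \<Rightarrow> complex) \<times> bool"
    define s where "s i = (if snd i then 1 else 1/2 :: real)" for i :: "('a \<times> 'a \<Rightarrow> complex) \<times> bool"
    have pv_q: "pv i = s i *\<^sub>R q i" for i by (simp add: pv_def s_def q_def)
    have s0: "s i \<noteq> 0" for i by (simp add: s_def)
    have q_inj: "q i \<noteq> q i'" if i: "i \<in> \<Delta>p \<times> UNIV" "i' \<in> \<Delta>p \<times> UNIV" "i \<noteq> i'" for i i'
    proof
      assume eq: "q i = q i'"
      let ?f = "\<lambda>k. if k = i then 1 / s i else - 1 / s i'"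
      have "(\<Sum>k\<in>{i, i'}. ?f k *\<^sub>R pv k) = 0" using i(3) eq s0 by (simp add: pv_q)
      then have "?f i = 0" using pv_independent(2)[of "{i, i'}" 0 ?f i] i by (simp add: span_zero)
      then show False using s0 by simp
    qed
    have q_in: "q i \<in> fst ` (Xup X ` \<Delta>p \<union> Yup X ` \<Delta>p)" if "i \<in> \<Delta>p \<times> UNIV" for i
      using that by (auto simp: q_def xx_def yy_def)
    have q_V: "br (q i) v \<in> V2" if "i \<in> \<Delta>p \<times> UNIV" "v \<in> V1" for i v
      using that swap[of "fst i"] by (auto simp: q_def image_subset_iff)
    have c_q: "c (pv i) a b = s i * ipj (br (q i) a) b" if i: "i \<in> \<Delta>p \<times> UNIV" and ab: "a \<in> B1" "b \<in> B2" for i a b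
    proof -
      have "br (q i) a \<in> V2" using q_V[OF i] span_base[OF ab(1)] unfolding B12 by blast
      then have "representation B (br (q i) a) b = ipj (br (q i) a) b"
        by (rule representation_orthonormal[OF ip_subset[OF ipj V_nj(2)] B2 ind_B Bsub(4) _ ab(2)])
      then show ?thesis using ind_B span_B by (simp add: c_def pv_q br_scale representation_scale)
    qed
    have U: "{b \<in> B. d b = 2} = B1 \<union> Bo" using deg2 d_1 Bsub by blast
    have V: "{b \<in> B. d b = 3} = B2"
    proof -
      have "b \<in> B2" if "b \<in> B" "d b = 3" for b
        using B_cases[OF that(1)] that(2) d_Z d_h d_p d_1 by fastforce
      then show ?thesis using d_2 Bsub by blast
    qed
    show "(\<Sum>a\<in>{b \<in> B. d b = 2}. \<Sum>b\<in>{b \<in> B. d b = 3}. c p a b * c p' a b) = 0"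
      if p: "p \<in> B" "p' \<in> B" "d p = 1" "d p' = 1" "p \<noteq> p'" for p p'
    proof -
      obtain i i' where i: "i \<in> \<Delta>p \<times> UNIV" "p = pv i" "i' \<in> \<Delta>p \<times> UNIV" "p' = pv i'"
        using deg1[OF p(1,3)] deg1[OF p(2,4)] unfolding Bp_def by blast
      have out: "c p a b = 0" if "a \<in> Bo" "b \<in> B2" for a b
      proof (rule c_out[OF u_o[OF in_u that(1)] Bsub(5)])
        show "p \<in> Bh \<union> Bp" using deg1[OF p(1,3)] by blast
        show "b \<notin> Bo" using dis_n that(2) by blast
      qed
      have "(\<Sum>a\<in>B1 \<union> Bo. \<Sum>b\<in>B2. c p a b * c p' a b) = (\<Sum>a\<in>B1. \<Sum>b\<in>B2. c p a b * c p' a b)"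
        using out B12 Bo(2) by (intro sum.mono_neutral_right) auto
      also have "\<dots> = (\<Sum>a\<in>B1. s i * s i' * (\<Sum>b\<in>B2. ipj (br (q i) a) b * ipj (br (q i') a) b))"
        by (intro sum.cong refl) (simp add: i c_q sum_distrib_left mult_ac cong: sum.cong)
      also have "\<dots> = (\<Sum>a\<in>B1. s i * s i' * ipj (br (q i) a) (br (q i') a))"
      proof (rule sum.cong[OF refl])
        fix a assume "a \<in> B1"
        from span_base[OF this] have "a \<in> V1" unfolding B12 .
        then show "s i * s i' * (\<Sum>b\<in>B2. ipj (br (q i) a) b * ipj (br (q i') a) b)
            = s i * s i' * ipj (br (q i) a) (br (q i') a)"
          using ip_expansion[OF ip_subset[OF ipj V_nj(2)] B2 q_V[OF i(1)] q_V[OF i(3)]] by simp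
      qed
      also have "\<dots> = s i * s i' * trace_on scaleR V1 (\<lambda>v. transpose_on ipj V1 (br (q i')) (br (q i) v))"
      proof -
        have "br (q m) v \<in> \<nn> j" if "m \<in> \<Delta>p \<times> UNIV" "v \<in> V1" for m v
          using q_V[OF that] V_nj(2) by blast
        from trace_transpose_br[OF ipj V_nj(1) sub_nn[OF j] B1 this[OF i(1)] this[OF i(3)]]
        show ?thesis by (simp add: sum_distrib_left)
      qed
      also have "\<dots> = 0"
      proof -
        have "i \<noteq> i'" using p(5) i by blast
        then show ?thesis using orth[OF q_in[OF i(1)] q_in[OF i(3)]] q_inj[OF i(1,3)] by simp
      qed
      finally show ?thesis unfolding U V .
    qed
    show "\<exists>a\<in>B. \<exists>b\<in>B. d a = 2 \<and> d b = 3 \<and> c p a b \<noteq> 0" if p: "p \<in> B" "d p = 1" for p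
    proof -
      obtain i where i: "i \<in> \<Delta>p \<times> UNIV" "p = pv i" using deg1[OF p] unfolding Bp_def by blast
      have "\<exists>v\<in>V1. br (q i) v \<noteq> 0" using nonzero[of "fst i"] i(1) by (auto simp: q_def)
      then obtain v where v: "v \<in> V1" "br (q i) v \<noteq> 0" by blast
      have "\<exists>a\<in>B1. br (q i) a \<noteq> 0"
      proof (rule ccontr)
        assume none: "\<not> ?thesis"
        have "v \<in> span B1" using v B12 by simp
        then have "br (q i) v = 0"
          by (induction rule: span_induct_alt) (use none in \<open>auto simp: br_simps\<close>)
        then show False using v by blast
      qed
      then obtain a where a: "a \<in> B1" "br (q i) a \<noteq> 0" by blast
      have aV: "br (q i) a \<in> V2" using q_V[OF i(1)] span_base[OF a(1)] unfolding B12 by blast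
      have "\<exists>b\<in>B2. ipj (br (q i) a) b \<noteq> 0"
      proof (rule ccontr)
        assume "\<not> ?thesis"
        then have "br (q i) a = 0"
          using orthonormal_expansion[OF ip_subset[OF ipj V_nj(2)] B2 aV] by simp
        then show False using a by blast
      qed
      then obtain b where b: "b \<in> B2" "ipj (br (q i) a) b \<noteq> 0" by blast
      have "c p a b \<noteq> 0" using c_q[OF i(1) a(1) b(1)] b(2) s0 i(2) by simp
      then show ?thesis using a(1) b(1) d_1 d_2 Bsub by blast
    qed
  qed
  then obtain \<kappa> where \<kappa>: "\<And>b. \<kappa> b > 0"
    "\<And>x. \<exists>i\<in>B. x i \<noteq> 0 \<Longrightarrow> ricci_form B (graded_part d \<kappa> c) x < 0" by blast
  have c_eq: "c = (\<lambda>i j k. representation B (br i j) k)" by (intro ext) (simp add: c_def)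
  show ?thesis
    by (rule ex_negative_ricci_if_graded[where d = d and \<kappa> = \<kappa>, OF g fin_B ind_B span_B \<kappa>(1)])
      (use filt \<kappa>(2) in \<open>auto simp: c_eq\<close>)
qed

end
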